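(* Let $l>0$, $h_1,h_2>0$, $\tau>0$, and let $k_1,k_2$ satisfy $$0<k_1<\sqrt{\tfrac{h_1}{h_2}},\qquad 0<k_2<\sqrt{\tfrac{h_2}{h_1}} .$$ Let $\mathcal A_K$ (denoted $A-BKC_\Lambda$ in feedback notation), $X=L^2(0,l)\times L^2(0,l)$, the constant $\gamma_0>0$, and the closed-loop system (plant, observer, predictor and estimated state feedback law) be as defined in the context. Let $(\theta_1,\theta_2)$ denote the plant component of the solution of the closed-loop system with plant initial state $(\theta_{10},\theta_{20})\in X$ and observer initial state $(\hat\theta_{10},\hat\theta_{20})\in X$. Then the following hold. 1. If $\tau>l$, then $(\theta_1(t,\cdot),\theta_2(t,\cdot))$, $t>\tau$, decays exponentially for any initial value: there exist constants $D,\omega>0$ such that for all initial states $(\theta_{10},\theta_{20}),(\hat\theta_{10},\hat\theta_{20})\in X$, $$\left\|\begin{pmatrix}\theta_1(t,\cdot)\\ \theta_2(t,\cdot)\end{pmatrix}\right\|\le D e^{-\omega t}\left\|\begin{pmatrix}\theta_{10}\\ \theta_{20}\end{pmatrix}\right\|\qquad\text{for all } t>\tau .$$ 2. If $0<\tau\le l$ and $0<\gamma<\gamma_0$, then there exist positive constants $D_\tau$ and $C_\tau^0$, independent of $t$ and of the initial states, such that for all initial states in $X$ whose initial observation error $$\begin{pmatrix}w_1\\ w_2\end{pmatrix}=\begin{pmatrix}\hat\theta_{10}-\theta_{10}\\ \hat\theta_{20}-\theta_{20}\end{pmatrix}$$ belongs to $D(\mathcal A_K)$, one has $$\left\|\begin{pmatrix}\theta_1(t,\cdot)\\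 \theta_2(t,\cdot)\end{pmatrix}\right\|\le D_\tau e^{-\gamma t}\left[\left\|\begin{pmatrix}\theta_{10}\\ \theta_{20}\end{pmatrix}\right\|+C_\tau^0\left\|\mathcal A_K\begin{pmatrix}w_1\\ w_2\end{pmatrix}\right\|\right]\qquad\text{for all } t>\tau .$$
   Context: All functions are real-valued, and $\|\cdot\|$ is the norm of the Hilbert space $X=L^2(0,l)\times L^2(0,l)$. Solutions of the partial differential equations below are understood in the mild ($C_0$-semigroup / well-posed linear system) sense with states in $X$ and boundary inputs and outputs locally in $L^2$. **Plant** (parallel-flow heat exchanger, with boundary controls $u_1,u_2$ and observations delayed by $\tau$): for $0<x<l$, $t>0$, $$\partial_t\theta_1(t,x)=-\partial_x\theta_1(t,x)+h_1(\theta_2(t,x)-\theta_1(t,x)),\qquad \partial_t\theta_2(t,x)=-\partial_x\theta_2(t,x)+h_2(\theta_1(t,x)-\theta_2(t,x)),$$ $$\theta_1(t,0)=u_1(t),\quad \theta_2(t,0)=u_2(t)\quad(t\ge 0),\qquad y_1(t)=\theta_2(t-\tau,l),\quad y_2(t)=\theta_1(t-\tau,l)\quad(t\ge\tau),$$ $$\theta_1(0,x)=\theta_{10}(x),\quad \theta_2(0,x)=\theta_{20}(x).$$ **Observer** (estimates the state on $[0,t-\tau]$, for $t>\tau$): for $0<x<l$, $0<s<t-\tau$, $$\partial_s\hat\theta_1^+(s,x)=-\partial_x\hat\theta_1^+(s,x)+h_1(\hat\theta_2^+(s,x)-\hat\theta_1^+(s,x)),\qquad \partial_s\hat\theta_2^+(s,x)=-\partial_x\hat\theta_2^+(s,x)+h_2(\hat\theta_1^+(s,x)-\hat\theta_2^+(s,x)),$$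 $$\hat\theta_1^+(s,0)=-k_1[\hat\theta_2^+(s,l)-y_1(s+\tau)]+u_1(s),\qquad \hat\theta_2^+(s,0)=-k_2[\hat\theta_1^+(s,l)-y_2(s+\tau)]+u_2(s),$$ $$\hat\theta_1^+(0,x)=\hat\theta_{10}(x),\quad \hat\theta_2^+(0,x)=\hat\theta_{20}(x),$$ where $(\hat\theta_{10},\hat\theta_{20})$ is an arbitrarily assigned initial state of the observer. **Predictor** (for each $t>\tau$, estimates the state on $(t-\tau,t]$): for $0<x<l$, $t-\tau<s<t$, $$\partial_s\hat\theta_1^-(s,t,x)=-\partial_x\hat\theta_1^-(s,t,x)+h_1(\hat\theta_2^-(s,t,x)-\hat\theta_1^-(s,t,x)),\qquad \partial_s\hat\theta_2^-(s,t,x)=-\partial_x\hat\theta_2^-(s,t,x)+h_2(\hat\theta_1^-(s,t,x)-\hat\theta_2^-(s,t,x)),$$ $$\hat\theta_1^-(s,t,0)=u_1(s),\quad \hat\theta_2^-(s,t,0)=u_2(s)\quad (t-\tau\le s\le t),$$ $$\hat\theta_1^-(t-\tau,t,x)=\hat\theta_1^+(t-\tau,x),\quad \hat\theta_2^-(t-\tau,t,x)=\hat\theta_2^+(t-\tau,x).$$ **Estimated state feedback law**: $u_1(t)=u_2(t)=0$ for $0\le t\le\tau$, and for $t>\tau$ $$u_1(t)=-k_1\hat\theta_2^-(t,t,l),\qquad u_2(t)=-k_2\hat\theta_1^-(t,t,l).$$ The closed-loop system is the coupling of the plant, the observer, the predictor and this feedback law. Equivalently, with $\varepsilon_i^-(s,t,x)=\hat\theta_i^-(s,t,x)-\theta_i(s,x)$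 for $i=1,2$, the plant satisfies for $t>\tau$ the two transport equations above with boundary conditions $\theta_1(t,0)=-k_1\varepsilon_2^-(t,t,l)-k_1\theta_2(t,l)$ and $\theta_2(t,0)=-k_2\varepsilon_1^-(t,t,l)-k_2\theta_1(t,l)$. **The operator $\mathcal A_K=A-BKC_\Lambda$** is the generator on $X$ of the delay-free plant under the static feedback $u_1(t)=-k_1\theta_2(t,l)$, $u_2(t)=-k_2\theta_1(t,l)$, that is, $$\mathcal A_K\begin{pmatrix}f\\ g\end{pmatrix}=\begin{pmatrix}-f'+h_1(g-f)\\ -g'+h_2(f-g)\end{pmatrix},\qquad D(\mathcal A_K)=\left\{\begin{pmatrix}f\\ g\end{pmatrix}\in H^1(0,l)\times H^1(0,l):\ f(0)=-k_1g(l),\ g(0)=-k_2f(l)\right\}.$$ **The constant $\gamma_0$**: under $k_1^2<h_1/h_2$ and $k_2^2<h_2/h_1$, the $C_0$-semigroup generated by $\mathcal A_K$ is exponentially stable; $M,\gamma_0>0$ denote constants with $\|e^{\mathcal A_K t}\|\le Me^{-\gamma_0 t}$ for all $t\ge0$. *)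

theory Defs
  imports "HOL-Analysis.Analysis"
begin

section \<open>The Hilbert space \<open>L\<^sup>2(\<real>)\<close> and its subspaces \<open>L\<^sup>2(0, l)\<close>\<close>

definition square_integrable :: "(real \<Rightarrow> real) \<Rightarrow> bool" where
  "square_integrable f \<longleftrightarrow> f \<in> borel_measurable lborel \<and> integrable lborel (\<lambda>x. (f x)\<^sup>2)"

lemma square_integrable_mult:
  assumes "square_integrable f" "square_integrable g"
  shows "integrable lborel (\<lambda>x. f x * g x)"
proof (rule Bochner_Integration.integrable_bound)
  show "integrable lborel (\<lambda>x. (f x)\<^sup>2 + (g x)\<^sup>2)"
    using assms by (simp add: square_integrable_def)
  show "(\<lambda>x. f x * g x) \<in> borel_measurable lborel"
    using assms by (auto simp: square_integrable_def)
  show "AE x in lborel. norm (f x * g x) \<le> norm ((f x)\<^sup>2 + (g x)\<^sup>2)"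
  proof (rule AE_I2)
    fix x
    have "0 \<le> (\<bar>f x\<bar> - \<bar>g x\<bar>)\<^sup>2" by simp
    then have "2 * (\<bar>f x\<bar> * \<bar>g x\<bar>) \<le> (f x)\<^sup>2 + (g x)\<^sup>2"
      by (simp add: power2_diff)
    moreover have "0 \<le> \<bar>f x\<bar> * \<bar>g x\<bar>" by simp
    ultimately show "norm (f x * g x) \<le> norm ((f x)\<^sup>2 + (g x)\<^sup>2)"
      unfolding abs_mult real_norm_def by linarith
  qed
qed

lemma square_integrable_add:
  assumes "square_integrable f" "square_integrable g"
  shows "square_integrable (\<lambda>x. f x + g x)"
proof -
  have "integrable lborel (\<lambda>x. (f x)\<^sup>2 + (g x)\<^sup>2 + 2 * (f x * g x))"
    using assms square_integrable_mult[OF assms] by (simp add: square_integrable_def)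
  then show ?thesis
    using assms by (auto simp: square_integrable_def power2_sum mult.assoc)
qed

lemma square_integrable_cmult:
  "square_integrable f \<Longrightarrow> square_integrable (\<lambda>x. c * f x)"
  by (auto simp: square_integrable_def power_mult_distrib)

lemma square_integrable_0: "square_integrable (\<lambda>x. 0)"
  by (simp add: square_integrable_def)

quotient_type L2 = "real \<Rightarrow> real" / partial:
  "\<lambda>f g. square_integrable f \<and> square_integrable g \<and> (AE x in lborel. f x = g x)"
proof (rule part_equivpI)
  show "\<exists>f. square_integrable f \<and> square_integrable f \<and> (AE x in lborel. f x = f x)"
    using square_integrable_0 by auto
  show "symp (\<lambda>f g. square_integrable f \<and> square_integrable g \<and> (AE x in lborel. f x = g x))"
    by (auto simp: symp_def elim: eventually_mono)
  show "transp (\<lambda>f g. square_integrable f \<and> square_integrable g \<and> (AE x in lborel. f x = g x))"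
    by (auto simp: transp_def elim: AE_mp)
qed

instantiation L2 :: real_inner
begin

lift_definition zero_L2 :: L2 is "\<lambda>x. 0"
  by (simp add: square_integrable_0)

lift_definition plus_L2 :: "L2 \<Rightarrow> L2 \<Rightarrow> L2" is "\<lambda>f g x. f x + g x"
  by (auto simp: square_integrable_add elim: AE_mp)

lift_definition scaleR_L2 :: "real \<Rightarrow> L2 \<Rightarrow> L2" is "\<lambda>c f x. c * f x"
  by (auto simp: square_integrable_cmult elim: AE_mp)

definition uminus_L2 :: "L2 \<Rightarrow> L2" where "- f = (-1) *\<^sub>R (f :: L2)"

definition minus_L2 :: "L2 \<Rightarrow> L2 \<Rightarrow> L2" where "f - g = f + - (g :: L2)"

lift_definition inner_L2 :: "L2 \<Rightarrow> L2 \<Rightarrow> real" is "\<lambda>f g. \<integral>x. f x * g x \<partial>lborel"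
  by (rule integral_cong_AE) (auto simp: square_integrable_def elim: AE_mp)

definition norm_L2 :: "L2 \<Rightarrow> real" where "norm f = sqrt (inner f (f :: L2))"

definition dist_L2 :: "L2 \<Rightarrow> L2 \<Rightarrow> real" where "dist f g = norm (f - (g :: L2))"

definition sgn_L2 :: "L2 \<Rightarrow> L2" where "sgn f = scaleR (inverse (norm f)) (f :: L2)"

definition uniformity_L2 :: "(L2 \<times> L2) filter" where
  "uniformity_L2 = (INF e\<in>{0<..}. principal {(f, g). dist f g < e})"

definition open_L2 :: "L2 set \<Rightarrow> bool" where
  "open_L2 U \<longleftrightarrow> (\<forall>f\<in>U. \<forall>\<^sub>F (f', g) in uniformity. f' = f \<longrightarrow> g \<in> U)"

instance
proof
  fix f g h :: L2 and a b :: real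
  show "f + g + h = f + (g + h)"
    by transfer (auto simp: square_integrable_add add.assoc)
  show "f + g = g + f"
    by transfer (auto simp: square_integrable_add add.commute)
  show "0 + f = f" by transfer simp
  show "- f + f = 0"
    unfolding uminus_L2_def by transfer (auto simp: square_integrable_0 square_integrable_cmult intro!: square_integrable_add)
  show "f - g = f + - g" by (simp add: minus_L2_def)
  show "a *\<^sub>R (f + g) = a *\<^sub>R f + a *\<^sub>R g"
    by transfer (auto simp: square_integrable_add square_integrable_cmult distrib_left)
  show "(a + b) *\<^sub>R f = a *\<^sub>R f + b *\<^sub>R f"
    by transfer (auto simp: square_integrable_add square_integrable_cmult distrib_right)
  show "a *\<^sub>R b *\<^sub>R f = (a * b) *\<^sub>R f"
    by transfer (auto simp: square_integrable_cmult mult.assoc)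
  show "1 *\<^sub>R f = f" by transfer simp
  show "sgn f = scaleR (inverse (norm f)) f" by (simp add: sgn_L2_def)
  show "dist f g = norm (f - g)" by (simp add: dist_L2_def)
  show "inner f g = inner g f" by transfer (simp add: mult.commute)
  show "inner (f + g) h = inner f h + inner g h"
    by transfer (simp add: distrib_right square_integrable_mult)
  show "inner (a *\<^sub>R f) g = a * inner f g"
    by transfer (simp add: mult.assoc square_integrable_mult)
  show "0 \<le> inner f f" by transfer simp
  show "inner f f = 0 \<longleftrightarrow> f = 0"
  proof transfer
    fix f :: "real \<Rightarrow> real"
    assume f: "square_integrable f \<and> square_integrable f \<and> (AE x in lborel. f x = f x)"
    then have "integrable lborel (\<lambda>x. f x * f x)" by (simp add: square_integrable_mult)
    then have "(\<integral>x. f x * f x \<partial>lborel) = 0 \<longleftrightarrow> (AE x in lborel. f x * f x = 0)"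
      by (intro integral_nonneg_eq_0_iff_AE) auto
    then show "((\<integral>x. f x * f x \<partial>lborel) = 0) \<longleftrightarrow>
        (square_integrable f \<and> square_integrable (\<lambda>x. 0) \<and> (AE x in lborel. f x = 0))"
      using f by (simp add: square_integrable_0)
  qed
  show "norm f = sqrt (inner f f)" by (simp add: norm_L2_def)
qed (auto simp: uniformity_L2_def open_L2_def)

end

text \<open>\<open>L2_space l\<close> is the image of \<open>L\<^sup>2(0, l)\<close> in \<open>L\<^sup>2(\<real>)\<close> under extension by zero (an isometry).
  Here \<open>rep_L2 f\<close> is a representative of the class \<open>f\<close>. The norm of \<open>X = state_space l\<close> is the norm of the
  product type, \<open>\<parallel>(f, g)\<parallel>\<^sup>2 = \<parallel>f\<parallel>\<^sup>2 + \<parallel>g\<parallel>\<^sup>2\<close>.\<close>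

definition L2_space :: "real \<Rightarrow> L2 set" where
  "L2_space l = {f. AE x in lborel. x \<notin> {0<..<l} \<longrightarrow> rep_L2 f x = 0}"

definition state_space :: "real \<Rightarrow> (L2 \<times> L2) set" where
  "state_space l = L2_space l \<times> L2_space l"


section \<open>The Sobolev space \<open>H\<^sup>1(0, l)\<close>\<close>

text \<open>\<open>H1_rep l f \<phi> d\<close>: \<open>\<phi>\<close> is, on \<open>[0, l]\<close>, the absolutely continuous representative of
  \<open>f \<in> L\<^sup>2(0, l)\<close>, and its derivative is \<open>d \<in> L\<^sup>2(0, l)\<close>.\<close>

definition H1_rep :: "real \<Rightarrow> L2 \<Rightarrow> (real \<Rightarrow> real) \<Rightarrow> L2 \<Rightarrow> bool" where
  "H1_rep l f \<phi> d \<longleftrightarrow>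
     f \<in> L2_space l \<and> d \<in> L2_space l \<and>
     (AE x in lborel. x \<in> {0<..<l} \<longrightarrow> rep_L2 f x = \<phi> x) \<and>
     (\<forall>x\<in>{0..l}. (rep_L2 d has_integral (\<phi> x - \<phi> 0)) {0..x})"

definition H1 :: "real \<Rightarrow> L2 set" where
  "H1 l = {f. \<exists>\<phi> d. H1_rep l f \<phi> d}"

definition H1_deriv :: "real \<Rightarrow> L2 \<Rightarrow> L2" where
  "H1_deriv l f = (THE d. \<exists>\<phi>. H1_rep l f \<phi> d)"

definition H1_value :: "real \<Rightarrow> L2 \<Rightarrow> real \<Rightarrow> real" where
  "H1_value l f x = (THE c. \<exists>\<phi> d. H1_rep l f \<phi> d \<and> c = \<phi> x)"


lemma H1_rep_continuous:
  assumes "H1_rep l f \<phi> d"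
  shows "continuous_on {0..l} \<phi>"
proof (cases "0 \<le> l")
  case True
  have I: "(rep_L2 d has_integral (\<phi> x - \<phi> 0)) {0..x}" if "x \<in> {0..l}" for x
    using assms that by (auto simp: H1_rep_def)
  have "rep_L2 d integrable_on {0..l}"
    using I[of l] True by auto
  then have "continuous_on {0..l} (\<lambda>x. \<phi> 0 + integral {0..x} (rep_L2 d))"
    by (intro continuous_intros indefinite_integral_continuous_1)
  moreover have "\<phi> 0 + integral {0..x} (rep_L2 d) = \<phi> x" if "x \<in> {0..l}" for x
    using integral_unique[OF I[OF that]] by simp
  ultimately show ?thesis by (simp cong: continuous_on_cong_simp)
qed simp

lemma H1_rep_unique:
  assumes l: "0 < l" and f: "H1_rep l f \<phi> d" "H1_rep l f \<psi> e"
  shows "d = e" and "x \<in> {0..l} \<Longrightarrow> \<phi> x = \<psi> x"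
proof -
  have ae: "AE x in lborel. x \<in> {0<..<l} \<longrightarrow> \<phi> x - \<psi> x = 0"
    using f unfolding H1_rep_def by (auto elim: AE_mp)
  have cont: "continuous_on {0..l} (\<lambda>x. \<phi> x - \<psi> x)"
    using f by (intro continuous_intros H1_rep_continuous)
  have inner: "\<phi> x = \<psi> x" if "x \<in> {0<..<l}" for x
  proof (rule ccontr)
    assume ne: "\<phi> x \<noteq> \<psi> x"
    have "continuous_on {0<..<l} (\<lambda>x. \<phi> x - \<psi> x)"
      by (rule continuous_on_subset[OF cont]) auto
    then have op: "open ((\<lambda>x. \<phi> x - \<psi> x) -` (- {0}) \<inter> {0<..<l})" (is "open ?U")
      by (subst (asm) continuous_on_open_vimage) auto
    have "AE x in lborel. x \<notin> ?U" using ae by (auto elim: AE_mp)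
    then have "?U \<in> null_sets lborel"
      using op AE_iff_null_sets[of ?U lborel] by simp
    then have "negligible ?U"
      using negligible_iff_null_sets null_sets_completionI by blast
    then have "?U = {}" using op open_not_negligible by blast
    with ne that show False by auto
  qed
  have eq: "\<phi> x = \<psi> x" if "x \<in> {0..l}" for x
  proof -
    have "closure {0<..<l} = {0..l}" using l by simp
    then have "\<phi> x - \<psi> x = 0"
      using continuous_constant_on_closure[of "{0<..<l}" "\<lambda>x. \<phi> x - \<psi> x" 0 x] cont inner that
      by simp
    then show ?thesis by simp
  qed
  then show "x \<in> {0..l} \<Longrightarrow> \<phi> x = \<psi> x" by blast

  define h where "h = (\<lambda>x. rep_L2 d x - rep_L2 e x)"
  define g where "g = (\<lambda>x. if x \<in> {0..l} then h x else 0)"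
  have h0: "(h has_integral 0) {0..x}" if "x \<in> {0..l}" for x
  proof -
    have "(h has_integral ((\<phi> x - \<phi> 0) - (\<psi> x - \<psi> 0))) {0..x}"
      unfolding h_def using f that by (intro has_integral_diff) (auto simp: H1_rep_def)
    then show ?thesis using eq[OF that] eq[of 0] l by simp
  qed
  have h1: "(h has_integral 0) {a..b}" if "0 \<le> a" "a \<le> b" "b \<le> l" for a b
  proof -
    have int: "h integrable_on {0..b}" using h0[of b] that by auto
    have "integral {0..a} h + integral {a..b} h = integral {0..b} h"
      by (rule Henstock_Kurzweil_Integration.integral_combine) (use that int in auto)
    then have "integral {a..b} h = 0"
      using integral_unique[OF h0[of a]] integral_unique[OF h0[of b]] that by simp
    moreover have "h integrable_on {a..b}"
      by (rule integrable_on_subinterval[OF int]) (use that in auto)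
    ultimately show ?thesis using has_integral_integrable_integral by blast
  qed
  have g0: "(g has_integral 0) {a..b}" for a b
  proof -
    have "(h has_integral 0) ({a..b} \<inter> {0..l})"
    proof (cases "max a 0 \<le> min b l")
      case True
      then show ?thesis using h1[of "max a 0" "min b l"] by (simp add: Int_atLeastAtMost)
    next
      case False
      then have "{a..b} \<inter> {0..l} = {}" by auto
      then show ?thesis by (simp add: has_integral_empty)
    qed
    then show ?thesis
      unfolding g_def using has_integral_restrict_Int[of "{0..l}" h 0 "{a..b}"]
      by (simp add: Int_commute)
  qed
  have "\<And>a b. g integrable_on cbox a b" using g0 by (auto simp: integrable_on_def)
  then obtain N where N: "negligible N" and
    lim: "\<And>x e. \<lbrakk>x \<notin> N; 0 < e\<rbrakk> \<Longrightarrow> \<exists>d>0. \<forall>h. 0 < h \<and> h < d \<longrightarrow>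
            norm (integral (cbox x (x + h *\<^sub>R One)) g /\<^sub>R h ^ DIM(real) - g x) < e"
    using integrable_ccontinuous_explicit[of g] by blast
  have "g x = 0" if xN: "x \<notin> N" for x
  proof (rule ccontr)
    assume "g x \<noteq> 0"
    then obtain d where "d > 0" and d: "\<forall>h. 0 < h \<and> h < d \<longrightarrow>
            norm (integral (cbox x (x + h *\<^sub>R One)) g /\<^sub>R h ^ DIM(real) - g x) < \<bar>g x\<bar>"
      using lim[OF xN, of "\<bar>g x\<bar>"] by auto
    show False
      using \<open>d > 0\<close> d[rule_format, of "d/2"] integral_unique[OF g0] by simp
  qed
  moreover have "AE x in lebesgue. x \<notin> N"
    using N by (simp add: negligible_iff_null_sets AE_not_in)
  ultimately have "AE x in lebesgue. g x = 0" by (auto elim: AE_mp)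
  then have "AE x in lborel. g x = 0" by (simp add: AE_completion_iff)
  moreover have "AE x in lborel. x \<notin> {0<..<l} \<longrightarrow> rep_L2 d x = 0"
    "AE x in lborel. x \<notin> {0<..<l} \<longrightarrow> rep_L2 e x = 0"
    using f by (auto simp: H1_rep_def L2_space_def)
  ultimately have "AE x in lborel. rep_L2 d x = rep_L2 e x"
  proof eventually_elim
    case (elim x)
    then show ?case by (cases "x \<in> {0<..<l}") (auto simp: g_def h_def)
  qed
  then show "d = e"
    using Quotient_rel_rep[OF Quotient_L2] Quotient_rep_reflp[OF Quotient_L2] by metis
qed

lemma H1_deriv_eq: "0 < l \<Longrightarrow> H1_rep l f \<phi> d \<Longrightarrow> H1_deriv l f = d"
  unfolding H1_deriv_def using H1_rep_unique(1) by blast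

lemma H1_value_eq: "0 < l \<Longrightarrow> H1_rep l f \<phi> d \<Longrightarrow> x \<in> {0..l} \<Longrightarrow> H1_value l f x = \<phi> x"
  unfolding H1_value_def using H1_rep_unique(2) by blast


section \<open>The operators\<close>

definition exchanger_op :: "real \<Rightarrow> real \<Rightarrow> real \<Rightarrow> L2 \<times> L2 \<Rightarrow> L2 \<times> L2" where
  "exchanger_op l h1 h2 = (\<lambda>(f, g).
     (- H1_deriv l f + h1 *\<^sub>R (g - f), - H1_deriv l g + h2 *\<^sub>R (f - g)))"

text \<open>\<open>A\<^sub>K\<close> is \<open>exchanger_op\<close> restricted to \<open>dom_AK\<close>; the generator \<open>A\<close> of the plant with zero
  inputs is its restriction to \<open>dom_A\<close>.\<close>

definition dom_AK :: "real \<Rightarrow> real \<Rightarrow> real \<Rightarrow> (L2 \<times> L2) set" where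
  "dom_AK l k1 k2 = {(f, g). f \<in> H1 l \<and> g \<in> H1 l \<and>
     H1_value l f 0 = - k1 * H1_value l g l \<and> H1_value l g 0 = - k2 * H1_value l f l}"

definition dom_A :: "real \<Rightarrow> (L2 \<times> L2) set" where
  "dom_A l = {(f, g). f \<in> H1 l \<and> g \<in> H1 l \<and> H1_value l f 0 = 0 \<and> H1_value l g 0 = 0}"

text \<open>The observation: the first output is the value of the second component at \<open>x = l\<close>, and
  vice versa.\<close>

definition output_op :: "real \<Rightarrow> L2 \<times> L2 \<Rightarrow> real \<times> real" where
  "output_op l = (\<lambda>(f, g). (H1_value l g l, H1_value l f l))"

definition resolvent :: "('a::real_vector) set \<Rightarrow> ('a \<Rightarrow> 'a) \<Rightarrow> real \<Rightarrow> 'a \<Rightarrow> 'a" where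
  "resolvent D A s z = (THE w. w \<in> D \<and> s *\<^sub>R w - A w = z)"

text \<open>A state in \<open>X\<close> has no boundary values; its output is given by the \<open>\<Lambda>\<close>-extension
  \<open>C\<^sub>\<Lambda> z = lim\<^bsub>s\<rightarrow>\<infinity>\<^esub> C s (s - A)\<^sup>-\<^sup>1 z\<close> of \<open>C = output_op\<close>, whose domain consists of the \<open>z\<close> for
  which the limit exists. \<open>C_Lambda l h1 h2 z c1 c2\<close> says that \<open>z\<close> is in this domain and
  \<open>C\<^sub>\<Lambda> z = (c1, c2)\<close>. Thus \<open>c1\<close>, \<open>c2\<close> are the values at \<open>x = l\<close> of the second and first
  component of \<open>z\<close>.\<close>

definition C_Lambda :: "real \<Rightarrow> real \<Rightarrow> real \<Rightarrow> L2 \<times> L2 \<Rightarrow> real \<Rightarrow> real \<Rightarrow> bool" where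
  "C_Lambda l h1 h2 z c1 c2 \<longleftrightarrow>
     ((\<lambda>s. output_op l (s *\<^sub>R resolvent (dom_A l) (exchanger_op l h1 h2) s z))
        \<longlongrightarrow> (c1, c2)) at_top"


section \<open>Strongly continuous semigroups\<close>

definition C0_semigroup_on :: "('a::real_normed_vector) set \<Rightarrow> (real \<Rightarrow> 'a \<Rightarrow> 'a) \<Rightarrow> bool" where
  "C0_semigroup_on S T \<longleftrightarrow>
     (\<forall>t\<ge>0. (\<forall>x\<in>S. T t x \<in> S) \<and>
        (\<forall>x\<in>S. \<forall>y\<in>S. T t (x + y) = T t x + T t y) \<and>
        (\<forall>x\<in>S. \<forall>c. T t (c *\<^sub>R x) = c *\<^sub>R T t x) \<and>
        (\<exists>K. \<forall>x\<in>S. norm (T t x) \<le> K * norm x)) \<and>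
     (\<forall>x\<in>S. T 0 x = x) \<and>
     (\<forall>s\<ge>0. \<forall>t\<ge>0. \<forall>x\<in>S. T (s + t) x = T s (T t x)) \<and>
     (\<forall>x\<in>S. ((\<lambda>t. T t x) \<longlongrightarrow> x) (at_right 0))"

definition generator_on ::
    "('a::real_normed_vector) set \<Rightarrow> (real \<Rightarrow> 'a \<Rightarrow> 'a) \<Rightarrow> 'a set \<Rightarrow> ('a \<Rightarrow> 'a) \<Rightarrow> bool" where
  "generator_on S T D A \<longleftrightarrow>
     D = {x \<in> S. \<exists>y\<in>S. ((\<lambda>t. (T t x - x) /\<^sub>R t) \<longlongrightarrow> y) (at_right 0)} \<and>
     (\<forall>x\<in>D. ((\<lambda>t. (T t x - x) /\<^sub>R t) \<longlongrightarrow> A x) (at_right 0))"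


section \<open>Mild solutions and the closed-loop system\<close>

definition L2_loc :: "real set \<Rightarrow> (real \<Rightarrow> real) \<Rightarrow> bool" where
  "L2_loc J u \<longleftrightarrow> (\<forall>a b. {a..b} \<subseteq> J \<longrightarrow>
     u \<in> borel_measurable (lebesgue_on {a..b}) \<and> integrable (lebesgue_on {a..b}) (\<lambda>t. (u t)\<^sup>2))"

text \<open>Mild solution, on a time interval \<open>J\<close> with left end point \<open>a\<close>, of the heat exchanger
  equations with initial state \<open>z0\<close> at time \<open>a\<close> and boundary inputs \<open>u1\<close>, \<open>u2\<close> at \<open>x = 0\<close>: a continuous
  function \<open>z : J \<rightarrow> X\<close> that satisfies the equations and boundary conditions integrated over
  \<open>[a, t]\<close>. The integral \<open>(W1, W2)\<close> of the state is in \<open>H\<^sup>1\<close> and so has boundary values, although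
  \<open>z t\<close> has none.\<close>

definition mild_solution ::
    "real \<Rightarrow> real \<Rightarrow> real \<Rightarrow> real \<Rightarrow> real set \<Rightarrow> L2 \<times> L2 \<Rightarrow> (real \<Rightarrow> real) \<Rightarrow> (real \<Rightarrow> real)
      \<Rightarrow> (real \<Rightarrow> L2 \<times> L2) \<Rightarrow> bool" where
  "mild_solution l h1 h2 a J z0 u1 u2 z \<longleftrightarrow>
     continuous_on J z \<and> (\<forall>t\<in>J. z t \<in> state_space l) \<and> z a = z0 \<and>
     L2_loc J u1 \<and> L2_loc J u2 \<and>
     (\<forall>t\<in>J. \<exists>W1 W2. W1 \<in> H1 l \<and> W2 \<in> H1 l \<and>
        (z has_integral (W1, W2)) {a..t} \<and>
        z t - z0 = exchanger_op l h1 h2 (W1, W2) \<and>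
        (u1 has_integral H1_value l W1 0) {a..t} \<and>
        (u2 has_integral H1_value l W2 0) {a..t})"

text \<open>Identities between functions of time with values in \<open>\<real>\<close> are identities in \<open>L\<^sup>2\<^sub>l\<^sub>o\<^sub>c\<close>, that is,
  almost everywhere. \<open>z\<close> is the plant state, \<open>zp\<close> the observer state, and \<open>zm s t\<close> the predictor
  state at \<open>s \<in> [t - \<tau>, t]\<close>. \<open>(y1, y2)\<close> is the delayed plant output and \<open>(q1, q2)\<close> the observer
  output. Since the observer equations on \<open>[0, t - \<tau>]\<close> do not depend on \<open>t\<close>, they are imposed on
  \<open>[0, \<infinity>)\<close>.\<close>

definition closed_loop ::
    "real \<Rightarrow> real \<Rightarrow> real \<Rightarrow> real \<Rightarrow> real \<Rightarrow> real \<Rightarrow> L2 \<times> L2 \<Rightarrow> L2 \<times> L2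
      \<Rightarrow> (real \<Rightarrow> L2 \<times> L2) \<Rightarrow> (real \<Rightarrow> L2 \<times> L2) \<Rightarrow> (real \<Rightarrow> real \<Rightarrow> L2 \<times> L2)
      \<Rightarrow> (real \<Rightarrow> real) \<Rightarrow> (real \<Rightarrow> real) \<Rightarrow> (real \<Rightarrow> real) \<Rightarrow> (real \<Rightarrow> real)
      \<Rightarrow> (real \<Rightarrow> real) \<Rightarrow> (real \<Rightarrow> real) \<Rightarrow> bool" where
  "closed_loop l h1 h2 \<tau> k1 k2 z0 zh0 z zp zm u1 u2 y1 y2 q1 q2 \<longleftrightarrow>
     mild_solution l h1 h2 0 {0..} z0 u1 u2 z \<and>
     L2_loc {\<tau>..} y1 \<and> L2_loc {\<tau>..} y2 \<and>
     (AE t in lborel. t \<ge> \<tau> \<longrightarrow> C_Lambda l h1 h2 (z (t - \<tau>)) (y1 t) (y2 t)) \<and>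
     mild_solution l h1 h2 0 {0..} zh0
       (\<lambda>s. - k1 * (q1 s - y1 (s + \<tau>)) + u1 s) (\<lambda>s. - k2 * (q2 s - y2 (s + \<tau>)) + u2 s) zp \<and>
     L2_loc {0..} q1 \<and> L2_loc {0..} q2 \<and>
     (AE s in lborel. s \<ge> 0 \<longrightarrow> C_Lambda l h1 h2 (zp s) (q1 s) (q2 s)) \<and>
     (\<forall>t>\<tau>. mild_solution l h1 h2 (t - \<tau>) {t - \<tau>..t} (zp (t - \<tau>)) u1 u2 (\<lambda>s. zm s t)) \<and>
     (AE t in lborel. 0 \<le> t \<and> t \<le> \<tau> \<longrightarrow> u1 t = 0 \<and> u2 t = 0) \<and>
     (AE t in lborel. t > \<tau> \<longrightarrow>
        (\<exists>p1 p2. C_Lambda l h1 h2 (zm t t) p1 p2 \<and> u1 t = - k1 * p1 \<and> u2 t = - k2 * p2))"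

end

theory Submission
  imports Defs "HOL-Real_Asymp.Real_Asymp"
begin

text \<open>In the coordinates \<open>h2 \<theta>1 + h1 \<theta>2\<close> and \<open>\<theta>1 - \<theta>2\<close> the equations decouple into damped transport
  equations, so a mild solution is \<open>e\<^bsup>Hx\<^esup> v(t - x)\<close> with the exchange matrix \<open>H\<close> and a boundary trace
  \<open>v\<close> that consists of the transported initial state and the input, and \<open>C\<^sub>\<Lambda>\<close> reads off \<open>e\<^bsup>Hl\<^esup> v(t - l)\<close>
  for almost every \<open>t\<close>. The closed loop thus becomes a difference equation with the delay \<open>l\<close> and the
  matrix \<open>N = - K e\<^bsup>Hl\<^esup>\<close>. If \<open>\<tau> \<ge> l\<close>, the predictor is exact and the trace \<open>v\<close> of the plant vanishes on
  \<open>(0, \<infinity>)\<close>. If \<open>\<tau> < l\<close>, then \<open>v(t) = N (v + w)(t - l)\<close> for \<open>t > \<tau>\<close>, where \<open>w\<close> is the trace of the observation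
  error and satisfies \<open>w(t) = N w(t - l)\<close>; \<open>w\<close> is bounded pointwise by the graph norm of the initial
  error. As \<open>- N\<close> is a positive matrix, its norm in a suitable weighted maximum norm is its Perron
  eigenvalue \<open>\<rho>\<close>, and the eigenfunctions of \<open>A\<^sub>K\<close> that belong to \<open>\<rho>\<close> show \<open>\<rho> \<le> e\<^bsup>-\<gamma>\<^sub>0 l\<^esup>\<close>.\<close>

section \<open>Representatives of classes in \<open>L\<^sup>2\<close>\<close>

text \<open>A state in L2 has no value at x = l, and a mild solution satisfies the equations only
  after integration in time, so nothing can be differentiated along a characteristic directly. The
  proof works with primitives in x instead: they are continuous in time and place, and the solution
  formula becomes an identity between integrals. Point values return only at Lebesgue points of the
  trace, so every recursion holds almost everywhere and is followed along whole orbits t + k l. The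
  matrix N has the eigenvalue -\<rho>, so the matching eigenvalue (ln \<rho> + i \<pi>) / l of A_K
  is not real. In the real space its eigenfunction appears as a pair spanning an invariant plane, on
  which the semigroup rotates and scales. The observation error contracts at the same rate as the
  plant that it drives. This resonance produces terms n \<rho>^n, which is why the rate must be
  strictly below \<open>\<gamma>\<^sub>0\<close>. The error is measured by A_K w because \<rho> < 1
  makes A_K boundedly invertible, even from L2 into bounded functions.\<close>

lemma rep_L2_square_integrable: "square_integrable (rep_L2 f)"
  using Quotient_rep_reflp[OF Quotient_L2] by blast

lemma rep_abs_L2: "square_integrable f \<Longrightarrow> AE x in lborel. rep_L2 (abs_L2 f) x = f x"
  using Quotient_rep_abs[OF Quotient_L2, of f] by auto

lemma L2_eqI: "AE x in lborel. rep_L2 f x = rep_L2 g x \<Longrightarrow> f = g"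
  using Quotient_rel_rep[OF Quotient_L2] Quotient_rep_reflp[OF Quotient_L2] by metis

lemma rep_L2_add: "AE x in lborel. rep_L2 (f + g) x = rep_L2 f x + rep_L2 g x"
  unfolding plus_L2_def map_fun_apply
  by (intro rep_abs_L2 square_integrable_add rep_L2_square_integrable)

lemma rep_L2_scaleR: "AE x in lborel. rep_L2 (c *\<^sub>R f) x = c * rep_L2 f x"
  unfolding scaleR_L2_def map_fun_apply id_apply
  by (intro rep_abs_L2 square_integrable_cmult rep_L2_square_integrable)

lemma rep_L2_uminus: "AE x in lborel. rep_L2 (- f) x = - rep_L2 f x"
  using rep_L2_scaleR[of "-1" f] unfolding uminus_L2_def by simp

lemma rep_L2_diff: "AE x in lborel. rep_L2 (f - g) x = rep_L2 f x - rep_L2 g x"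
  using rep_L2_add[of f "-g"] rep_L2_uminus[of g] by eventually_elim simp

lemma inner_L2_rep: "inner f g = (\<integral>x. rep_L2 f x * rep_L2 g x \<partial>lborel)"
  unfolding inner_L2_def map_fun_apply by simp

text \<open>\<open>\<Psi>\<close> is only an indefinite integral and need not be differentiable
  everywhere, so the fundamental theorem does not apply to the product. Instead the defect
  \<open>D\<close> has increments bounded by
  \<open>2 * L * \<bar>t - s\<bar> * \<bar>A t - A s\<bar>\<close>, where \<open>A\<close>
  integrates the absolute value of \<open>g\<close>. Continuity of \<open>A\<close> makes the
  derivative of \<open>D\<close> zero at every point, not just almost everywhere, so
  \<open>D\<close> is constant.\<close>

lemma indefinite_integral_by_parts:
  fixes \<eta> \<eta>' g \<Psi> :: "real \<Rightarrow> real"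
  assumes g: "g absolutely_integrable_on {a..b}"
    and \<Psi>: "\<And>x. x \<in> {a..b} \<Longrightarrow> \<Psi> x = c + integral {a..x} g"
    and \<eta>: "\<And>x. x \<in> {a..b} \<Longrightarrow> (\<eta> has_real_derivative \<eta>' x) (at x within {a..b})"
    and \<eta>': "continuous_on {a..b} \<eta>'"
    and x: "x \<in> {a..b}"
  shows "((\<lambda>y. \<eta>' y * \<Psi> y + \<eta> y * g y) has_integral (\<eta> x * \<Psi> x - \<eta> a * \<Psi> a)) {a..x}"
proof -
  define h where "h = (\<lambda>y. \<eta>' y * \<Psi> y + \<eta> y * g y)"
  define D where "D = (\<lambda>y. \<eta> y * \<Psi> y - integral {a..y} h)"
  define A where "A = (\<lambda>y. integral {a..y} (\<lambda>t. \<bar>g t\<bar>))"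
  have gi: "g integrable_on {a..b}" and gai: "(\<lambda>t. \<bar>g t\<bar>) integrable_on {a..b}"
    using g by (auto simp: absolutely_integrable_on_def)
  have c\<eta>: "continuous_on {a..b} \<eta>"
    using \<eta> by (meson DERIV_continuous continuous_on_eq_continuous_within)
  have "continuous_on {a..b} (\<lambda>x. c + integral {a..x} g)"
    by (intro continuous_intros indefinite_integral_continuous_1 gi)
  then have c\<Psi>: "continuous_on {a..b} \<Psi>" using \<Psi> by (simp cong: continuous_on_cong_simp)
  have cA: "continuous_on {a..b} A"
    unfolding A_def by (intro indefinite_integral_continuous_1 gai)
  have \<eta>g: "(\<lambda>y. \<eta> y * g y) absolutely_integrable_on {a..b}"
  proof (rule absolutely_integrable_bounded_measurable_product_real[OF _ _ _ g])
    show "\<eta> \<in> borel_measurable (lebesgue_on {a..b})"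
      by (rule continuous_imp_measurable_on_sets_lebesgue[OF c\<eta>]) simp
    show "bounded (\<eta> ` {a..b})"
      by (intro compact_imp_bounded compact_continuous_image c\<eta> compact_Icc)
  qed simp
  have hi: "h integrable_on {a..b}"
    unfolding h_def
  proof (rule integrable_add)
    show "(\<lambda>y. \<eta>' y * \<Psi> y) integrable_on {a..b}"
      by (intro integrable_continuous_interval continuous_intros \<eta>' c\<Psi>)
  qed (use \<eta>g in \<open>simp add: absolutely_integrable_on_def\<close>)
  have sub: "f integrable_on {s..t}" if "f integrable_on {a..b}" "a \<le> s" "t \<le> b" for f :: "real \<Rightarrow> real" and s t
    by (rule integrable_on_subinterval[OF that(1)]) (use that in auto)
  have diff: "integral {a..t} f - integral {a..s} f = integral {s..t} f"
    if "f integrable_on {a..b}" "a \<le> s" "s \<le> t" "t \<le> b" for f :: "real \<Rightarrow> real" and s t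
    using Henstock_Kurzweil_Integration.integral_combine[of a s t f] sub[OF that(1), of a t] that by simp
  obtain L where L: "\<And>t. t \<in> {a..b} \<Longrightarrow> \<bar>\<eta>' t\<bar> \<le> L"
  proof -
    have "bounded (\<eta>' ` {a..b})"
      by (intro compact_imp_bounded compact_continuous_image \<eta>' compact_Icc)
    then obtain L where "\<forall>y\<in>\<eta>' ` {a..b}. norm y \<le> L" unfolding bounded_iff by blast
    then show ?thesis using that[of L] by simp
  qed
  have L0: "0 \<le> L" using L[OF x] by linarith
  have lip: "\<bar>\<eta> t - \<eta> s\<bar> \<le> L * \<bar>t - s\<bar>" if "s \<in> {a..b}" "t \<in> {a..b}" for s t
    using field_differentiable_bound[of "{a..b}" \<eta> \<eta>' L t s] \<eta> L that by auto
  have main: "\<bar>D t - D s\<bar> \<le> 2 * L * (t - s) * (A t - A s)" if st: "a \<le> s" "s \<le> t" "t \<le> b" for s t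
  proof -
    have \<Psi>d: "\<Psi> r - \<Psi> s = integral {s..r} g" if "r \<in> {s..t}" for r
      using \<Psi>[of r] \<Psi>[of s] diff[OF gi, of s r] st that by simp
    have \<eta>d: "(\<eta>' has_integral (\<eta> t - \<eta> s)) {s..t}"
      using st by (intro fundamental_theorem_of_calculus)
        (auto simp: has_real_derivative_iff_has_vector_derivative[symmetric] intro: DERIV_subset[OF \<eta>])
    have Ig: "(g has_integral (\<Psi> t - \<Psi> s)) {s..t}"
      using \<Psi>d[of t] sub[OF gi] st by (simp add: has_integral_integral[symmetric])
    have Ih: "(h has_integral (integral {a..t} h - integral {a..s} h)) {s..t}"
      using diff[OF hi st] sub[OF hi] st by (simp add: has_integral_integral[symmetric])
    \<comment> \<open>This splitting of the increment of the product leaves the integrand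
      \<open>(\<eta> t - \<eta> r) * g r - \<eta>' r * (\<Psi> r - \<Psi> s)\<close>, in which each
      term carries a small increment.\<close>
    have "((\<lambda>r. \<eta> t * g r + \<Psi> s * \<eta>' r - h r) has_integral
       (\<eta> t * (\<Psi> t - \<Psi> s) + \<Psi> s * (\<eta> t - \<eta> s) - (integral {a..t} h - integral {a..s} h))) {s..t}"
      by (intro has_integral_diff has_integral_add has_integral_mult_right Ig Ih \<eta>d)
    also have "\<eta> t * (\<Psi> t - \<Psi> s) + \<Psi> s * (\<eta> t - \<eta> s) - (integral {a..t} h - integral {a..s} h) = D t - D s"
      by (simp add: D_def algebra_simps)
    finally have ID: "((\<lambda>r. \<eta> t * g r + \<Psi> s * \<eta>' r - h r) has_integral (D t - D s)) {s..t}" .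
    define B where "B = A t - A s"
    have B: "integral {s..t} (\<lambda>t. \<bar>g t\<bar>) = B"
      using diff[OF gai st] by (simp add: B_def A_def)
    have bnd: "norm (\<eta> t * g r + \<Psi> s * \<eta>' r - h r) \<le> L * (t - s) * \<bar>g r\<bar> + L * B" if r: "r \<in> {s..t}" for r
    proof -
      have "\<eta> t * g r + \<Psi> s * \<eta>' r - h r = (\<eta> t - \<eta> r) * g r - \<eta>' r * (\<Psi> r - \<Psi> s)"
        by (simp add: h_def algebra_simps)
      moreover have "\<bar>(\<eta> t - \<eta> r) * g r\<bar> \<le> L * (t - s) * \<bar>g r\<bar>"
      proof -
        have "\<bar>\<eta> t - \<eta> r\<bar> \<le> L * \<bar>t - r\<bar>" using lip[of r t] r st by auto
        also have "\<dots> \<le> L * (t - s)" using r L0 by (intro mult_left_mono) auto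
        finally show ?thesis by (simp add: abs_mult mult_right_mono)
      qed
      moreover have "\<bar>\<eta>' r * (\<Psi> r - \<Psi> s)\<bar> \<le> L * B"
      proof -
        have "\<bar>\<Psi> r - \<Psi> s\<bar> \<le> integral {s..r} (\<lambda>t. \<bar>g t\<bar>)"
          unfolding \<Psi>d[OF r] real_norm_def[symmetric]
          using sub[OF gi, of s r] sub[OF gai, of s r] r st
          by (intro integral_norm_bound_integral) auto
        also have "\<dots> \<le> B"
          unfolding B[symmetric] using sub[OF gai, of s r] sub[OF gai, of s t] r st
          by (intro integral_subset_le) auto
        finally show ?thesis unfolding abs_mult
          using L[of r] L0 r st by (intro mult_mono) auto
      qed
      ultimately show ?thesis unfolding real_norm_def by linarith
    qed
    have "norm (integral {s..t} (\<lambda>r. \<eta> t * g r + \<Psi> s * \<eta>' r - h r))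
        \<le> integral {s..t} (\<lambda>r. L * (t - s) * \<bar>g r\<bar> + L * B)"
      using ID bnd sub[OF gai, of s t] st
      by (intro integral_norm_bound_integral) (auto intro!: integrable_add integrable_on_mult_right)
    also have "\<dots> = L * (t - s) * B + L * B * (t - s)"
      using sub[OF gai, of s t] st by (subst integral_add) (auto simp: B intro!: integrable_on_mult_right)
    finally show ?thesis using integral_unique[OF ID] by (simp add: B_def algebra_simps)
  qed
  have main': "\<bar>D t - D s\<bar> \<le> 2 * L * \<bar>t - s\<bar> * \<bar>A t - A s\<bar>" if "s \<in> {a..b}" "t \<in> {a..b}" for s t
  proof -
    have mono: "A s \<le> A t" if "a \<le> s" "s \<le> t" "t \<le> b" for s t
      using diff[OF gai, of s t] that integral_nonneg[OF sub[OF gai, of s t]] by (auto simp: A_def)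
    show ?thesis
    proof (cases "s \<le> t")
      case True then show ?thesis using main[of s t] mono[of s t] that by auto
    next
      case False
      then have "\<bar>D s - D t\<bar> \<le> 2 * L * (s - t) * (A s - A t)" using main[of t s] that by auto
      then show ?thesis using mono[of t s] that False by (simp add: abs_minus_commute)
    qed
  qed
  have "(D has_derivative (\<lambda>h. 0)) (at s within {a..b})" if s: "s \<in> {a..b}" for s
  proof -
    have lim: "((\<lambda>t. 2 * L * \<bar>A t - A s\<bar>) \<longlongrightarrow> 0) (at s within {a..b})"
    proof -
      have "(A \<longlongrightarrow> A s) (at s within {a..b})" using cA s by (auto simp: continuous_on_def)
      then have "((\<lambda>t. 2 * L * \<bar>A t - A s\<bar>) \<longlongrightarrow> 2 * L * \<bar>A s - A s\<bar>) (at s within {a..b})"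
        by (intro tendsto_intros)
      then show ?thesis by simp
    qed
    have "((\<lambda>t. (D t - D s) / (t - s)) \<longlongrightarrow> 0) (at s within {a..b})"
    proof (rule Lim_null_comparison[OF _ lim])
      show "\<forall>\<^sub>F t in at s within {a..b}. norm ((D t - D s) / (t - s)) \<le> 2 * L * \<bar>A t - A s\<bar>"
        unfolding eventually_at_filter using main'[OF s]
        by (intro always_eventually) (auto simp: divide_simps abs_mult mult_ac)
    qed
    then have "(D has_field_derivative 0) (at s within {a..b})"
      by (simp add: has_field_derivative_iff)
    then show ?thesis by (simp add: has_field_derivative_def lambda_zero)
  qed
  then have "D x = D a"
    using has_derivative_zero_unique[of "{a..b}" D a x] x by auto
  then have "integral {a..x} h = \<eta> x * \<Psi> x - \<eta> a * \<Psi> a" by (simp add: D_def)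
  then show ?thesis
    unfolding h_def[symmetric] using integrable_integral[OF sub[OF hi, of a x]] x by simp
qed

section \<open>Transport along characteristics and Abel means\<close>

text \<open>In the application \<open>F\<close> is a primitive in x of the state and
  \<open>V\<close> a primitive of its boundary trace. As \<open>F\<close> is merely continuous, its
  difference to the expected solution is integrated once more in time. The result \<open>K\<close>
  is continuously differentiable with opposite partial derivatives in t and x, hence constant along
  t - x, and it vanishes where a characteristic enters the rectangle.\<close>

lemma transport_characteristics:
  fixes F :: "real \<Rightarrow> real \<Rightarrow> real" and V :: "real \<Rightarrow> real"
  assumes l: "0 < l" and ab: "a \<le> b"
    and cF: "continuous_on ({a..b} \<times> {0..l}) (\<lambda>(t, x). F t x)"
    and cV: "continuous_on {a - l..b} V"
    and eq: "\<And>t x. t \<in> {a..b} \<Longrightarrow> x \<in> {0..l} \<Longrightarrow>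
       integral {a..t} (\<lambda>s. F s x) = integral {0..x} (\<lambda>y. V t - V (a - y) - F t y)"
    and init: "\<And>x. x \<in> {0..l} \<Longrightarrow> F a x = V a - V (a - x)"
    and t: "t \<in> {a..b}" and x: "x \<in> {0..l}"
  shows "F t x = V t - V (t - x)"
proof (cases "a = b")
  case True
  then show ?thesis using init x t by auto
next
  case False
  with ab have ab': "a < b" by simp
  define W where "W = (\<lambda>s. integral {a - l..s} V)"
  define K where "K = (\<lambda>t x. integral {a..t} (\<lambda>s. F s x) - (W t - W (t - x) - W a + W (a - x)))"
  have dW: "(W has_real_derivative V s) (at s within {a - l..b})" if "s \<in> {a - l..b}" for s
    unfolding W_def has_real_derivative_iff_has_vector_derivative
    using integral_has_vector_derivative[OF cV that] .
  have cFt: "continuous_on {a..b} (\<lambda>s. F s x)" if "x \<in> {0..l}" for x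
  proof -
    have "continuous_on {a..b} ((\<lambda>(t, x). F t x) \<circ> (\<lambda>s. (s, x)))"
      using that by (intro continuous_on_compose continuous_on_subset[OF cF] continuous_intros) auto
    then show ?thesis by (simp add: o_def)
  qed
  have cFx: "continuous_on {0..l} (\<lambda>x. F s x)" if "s \<in> {a..b}" for s
  proof -
    have "continuous_on {0..l} ((\<lambda>(t, x). F t x) \<circ> (\<lambda>x. (s, x)))"
      using that by (intro continuous_on_compose continuous_on_subset[OF cF] continuous_intros) auto
    then show ?thesis by (simp add: o_def)
  qed
  have dGt: "((\<lambda>t. integral {a..t} (\<lambda>s. F s x)) has_real_derivative F t x) (at t within {a..b})"
    if "t \<in> {a..b}" "x \<in> {0..l}" for t x
    unfolding has_real_derivative_iff_has_vector_derivative
    using integral_has_vector_derivative[OF cFt[OF that(2)] that(1)] .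
  have shift: "((\<lambda>t. W (c + e * t)) has_real_derivative e * V (c + e * s)) (at s within S)"
    if "\<And>t. t \<in> S \<Longrightarrow> c + e * t \<in> {a - l..b}" "s \<in> S" for c e s S
  proof -
    have "((\<lambda>t. c + e * t) has_real_derivative e) (at s within S)"
      by (auto intro!: derivative_eq_intros)
    moreover have "(W has_real_derivative V (c + e * s)) (at (c + e * s) within (\<lambda>t. c + e * t) ` S)"
      by (rule DERIV_subset[OF dW]) (use that in auto)
    ultimately show ?thesis
      using DERIV_image_chain[of W "V (c + e * s)" "\<lambda>t. c + e * t" s S e] by (simp add: o_def mult.commute)
  qed
  have dWtx: "((\<lambda>t. W (t - x)) has_real_derivative V (t - x)) (at t within {a..b})"
    if "t \<in> {a..b}" "x \<in> {0..l}" for t x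
    using shift[of "{a..b}" "-x" 1 t] that by auto
  have dWxt: "((\<lambda>x. W (t - x)) has_real_derivative - V (t - x)) (at x within {0..l})"
    if "t \<in> {a..b}" "x \<in> {0..l}" for t x
    using shift[of "{0..l}" t "-1" x] that by auto
  have Kt: "((\<lambda>t. K t x) has_real_derivative F t x - (V t - V (t - x))) (at t within {a..b})"
    if "t \<in> {a..b}" "x \<in> {0..l}" for t x
  proof -
    have "(W has_real_derivative V t) (at t within {a..b})"
      by (rule DERIV_subset[OF dW]) (use that l in auto)
    then show ?thesis
      unfolding K_def using that
      by (auto intro!: derivative_eq_intros dGt dWtx)
  qed
  have Kx: "((\<lambda>x. K t x) has_real_derivative - (F t x - (V t - V (t - x)))) (at x within {0..l})"
    if "t \<in> {a..b}" "x \<in> {0..l}" for t x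
  proof -
    have "continuous_on {0..l} (\<lambda>y. V (a - y))"
      by (rule continuous_on_compose2[OF cV]) (auto intro!: continuous_intros simp: ab)
    then have "continuous_on {0..l} (\<lambda>y. V t - V (a - y) - F t y)"
      by (intro continuous_intros cFx that)
    then have "((\<lambda>x. integral {0..x} (\<lambda>y. V t - V (a - y) - F t y)) has_real_derivative
        V t - V (a - x) - F t x) (at x within {0..l})"
      unfolding has_real_derivative_iff_has_vector_derivative
      using integral_has_vector_derivative[OF _ that(2)] by blast
    then have "((\<lambda>x. integral {a..t} (\<lambda>s. F s x)) has_real_derivative
        V t - V (a - x) - F t x) (at x within {0..l})"
      by (rule has_field_derivative_transform_within[OF _ zero_less_one that(2)]) (use eq that in auto)
    then show ?thesis
      unfolding K_def using dWxt[OF that] dWxt[of a x] that ab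
      by (auto intro!: derivative_eq_intros)
  qed
  have cK': "continuous_on ({a..b} \<times> {0..l}) (\<lambda>(t, x). F t x - (V t - V (t - x)))"
  proof -
    have "continuous_on ({a..b} \<times> {0..l}) (\<lambda>p. V (fst p))"
      by (rule continuous_on_compose2[OF cV]) (auto intro!: continuous_intros simp: l less_imp_le)
    moreover have "continuous_on ({a..b} \<times> {0..l}) (\<lambda>p. V (fst p - snd p))"
      by (rule continuous_on_compose2[OF cV]) (auto intro!: continuous_intros simp: l less_imp_le)
    ultimately show ?thesis using cF by (auto simp: case_prod_unfold intro!: continuous_intros)
  qed
  have K0: "K t x = 0" if t: "t \<in> {a..b}" and x: "x \<in> {0..l}" for t x
  proof -
    \<comment> \<open>The characteristic through (t, x) is followed back to \<open>r = r0\<close>,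
      where it meets either the boundary x = 0 or the initial line t = a.\<close>
    define r0 where "r0 = max 0 (a - (t - x))"
    have r0: "0 \<le> r0" "r0 \<le> x" "a \<le> t - x + r0" using t x by (auto simp: r0_def)
    have K: "((\<lambda>r. K (t - x + r) r) has_derivative (\<lambda>h. 0)) (at r within {r0..x})" if r: "r \<in> {r0..x}" for r
    proof -
      let ?f = "\<lambda>s y. F s y - (V s - V (s - y))"
      let ?s = "t - x + r"
      have s: "?s \<in> {a..b}" "r \<in> {0..l}" using r r0 t x by auto
      have d1: "((\<lambda>(t, x). K t x) has_derivative
          (\<lambda>(tx, ty). (\<lambda>h. ?f ?s r * h) tx + (blinfun_scaleR_right (- ?f ?s r)) ty)) (at (?s, r) within {a..b} \<times> {0..l})"
      proof (rule has_derivative_partialsI[where fy = "\<lambda>t x. blinfun_scaleR_right (- ?f t x)"])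
        show "((\<lambda>s. K s r) has_derivative (\<lambda>h. ?f ?s r * h)) (at ?s within {a..b})"
          using Kt[OF s] by (simp add: has_field_derivative_def)
        show "((\<lambda>y. K s y) has_derivative blinfun_apply (blinfun_scaleR_right (- ?f s y))) (at y within {0..l})"
          if "s \<in> {a..b}" "y \<in> {0..l}" for s y
          using Kx[OF that] by (simp add: has_field_derivative_def real_scaleR_def[abs_def])
        have "((\<lambda>(t, x). ?f t x) \<longlongrightarrow> ?f ?s r) (at (?s, r) within {a..b} \<times> {0..l})"
          using bspec[OF cK'[unfolded continuous_on_def], of "(?s, r)"] s
          by (simp only: mem_Times_iff fst_conv snd_conv prod.case simp_thms)
        then have "((\<lambda>p. blinfun_scaleR_right (- (\<lambda>(t, x). ?f t x) p)) \<longlongrightarrow> blinfun_scaleR_right (- ?f ?s r)) (at (?s, r) within {a..b} \<times> {0..l})"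
          by (intro tendsto_intros bounded_linear.tendsto[OF bounded_linear_blinfun_scaleR_right])
        then show "continuous (at (?s, r) within {a..b} \<times> {0..l}) (\<lambda>(x, y). blinfun_scaleR_right (- ?f x y))"
          by (simp add: continuous_within case_prod_unfold)
      qed (use s in auto)
      have d2: "((\<lambda>r. (t - x + r, r)) has_derivative (\<lambda>h. (h, h))) (at r within {r0..x})"
        by (auto intro!: derivative_eq_intros)
      have sub: "(\<lambda>r. (t - x + r, r)) ` {r0..x} \<subseteq> {a..b} \<times> {0..l}"
        using r0 t x by auto
      show ?thesis
        using has_derivative_in_compose[OF d2 has_derivative_subset[OF d1 sub]] by (simp flip: distrib_right)
    qed
    have "K (t - x + x) x = K (t - x + r0) r0"
      using has_derivative_zero_unique[of "{r0..x}" "\<lambda>r. K (t - x + r) r" r0 x] K r0 by auto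
    also have "K (t - x + r0) r0 = 0"
    proof (cases "a \<le> t - x")
      case True
      then have "r0 = 0" by (simp add: r0_def)
      moreover have "integral {a..t - x} (\<lambda>s. F s 0) = 0"
        using eq[of "t - x" 0] True t x l by simp
      ultimately show ?thesis by (simp add: K_def)
    next
      case False
      then have "t - x + r0 = a" by (simp add: r0_def)
      then show ?thesis by (simp add: K_def)
    qed
    finally show ?thesis by simp
  qed
  \<comment> \<open>\<open>K\<close> vanishes identically, so its time derivative, which is the
    difference in question, is 0.\<close>
  have "((\<lambda>t. 0) has_real_derivative F t x - (V t - V (t - x))) (at t within {a..b})"
    by (rule has_field_derivative_transform_within[OF Kt[OF t x] zero_less_one t]) (use K0 x in auto)
  moreover have "((\<lambda>t. 0) has_real_derivative 0) (at t within {a..b})" by simp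
  moreover have "at t within {a..b} \<noteq> bot"
    using t ab' by (simp add: trivial_limit_within islimpt_Icc)
  ultimately show ?thesis
    using has_field_derivative_unique[of "\<lambda>t. 0" _ t "{a..b}"] by fastforce
qed

section \<open>One-sided Lebesgue points and Abel means\<close>

lemma indefinite_integral_right_derivative_AE:
  fixes v :: "real \<Rightarrow> real"
  assumes v: "\<And>a b. v integrable_on {a..b}"
  shows "AE s in lebesgue. ((\<lambda>h. integral {s..s + h} v / h) \<longlongrightarrow> v s) (at_right 0)"
proof -
  obtain N where N: "negligible N" and
    lim: "\<And>x e. \<lbrakk>x \<notin> N; 0 < e\<rbrakk> \<Longrightarrow> \<exists>d>0. \<forall>h. 0 < h \<and> h < d \<longrightarrow>
            norm (integral (cbox x (x + h *\<^sub>R One)) v /\<^sub>R h ^ DIM(real) - v x) < e"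
    using integrable_ccontinuous_explicit[of v] v by (metis cbox_interval)
  have "((\<lambda>h. integral {s..s + h} v / h) \<longlongrightarrow> v s) (at_right 0)" if "s \<notin> N" for s
    unfolding tendsto_iff
  proof (intro allI impI)
    fix e :: real assume "e > 0"
    from lim[OF that this] obtain d where "d > 0" "\<forall>h. 0 < h \<and> h < d \<longrightarrow>
            norm (integral (cbox s (s + h *\<^sub>R One)) v /\<^sub>R h ^ DIM(real) - v s) < e" by blast
    then show "\<forall>\<^sub>F h in at_right 0. dist (integral {s..s + h} v / h) (v s) < e"
      by (auto simp: eventually_at_right dist_real_def divide_inverse mult.commute)
  qed
  then show ?thesis using N by (auto simp: eventually_ae_filter_negligible)
qed

lemma AE_eq_if_integrals_eq:
  fixes f g :: "real \<Rightarrow> real"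
  assumes f: "f integrable_on {a..b}" and g: "g integrable_on {a..b}"
    and eq: "\<And>x. x \<in> {a..b} \<Longrightarrow> integral {a..x} f = integral {a..x} g"
  shows "AE x in lebesgue. x \<in> {a<..<b} \<longrightarrow> f x = g x"
proof -
  define F where "F = (\<lambda>h x. if x \<in> {a..b} then h x else (0::real))"
  have int: "F h integrable_on {s..t}" if "h integrable_on {a..b}" for h s t
  proof -
    have "h integrable_on ({s..t} \<inter> {a..b})"
      unfolding Int_atLeastAtMost by (rule integrable_on_subinterval[OF that]) auto
    then show ?thesis unfolding F_def using integrable_restrict_Int[of "{a..b}" h "{s..t}"] by (simp only: Int_commute)
  qed
  have ae: "AE s in lebesgue. ((\<lambda>h. integral {s..s + h} (F k) / h) \<longlongrightarrow> F k s) (at_right 0)"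
    if "k integrable_on {a..b}" for k
    by (rule indefinite_integral_right_derivative_AE) (rule int[OF that])
  have eq': "integral {s..s + h} (F f) = integral {s..s + h} (F g)" if "a \<le> s" "0 \<le> h" "s + h \<le> b" for s h
  proof -
    have *: "integral {s..s + h} (F k) = integral {a..s+h} k - integral {a..s} k" if "k integrable_on {a..b}" for k
    proof -
      have "integral {s..s + h} (F k) = integral {s..s+h} k"
        using \<open>a \<le> s\<close> \<open>s + h \<le> b\<close> by (intro integral_cong) (auto simp: F_def)
      then show ?thesis
        using Henstock_Kurzweil_Integration.integral_combine[of a s "s+h" k] \<open>a \<le> s\<close> \<open>0 \<le> h\<close>
          integrable_on_subinterval[OF that, of a "s+h"] \<open>s + h \<le> b\<close> by auto
    qed
    show ?thesis using eq[of s] eq[of "s+h"] that by (simp add: *[OF f] *[OF g])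
  qed
  from ae[OF f] ae[OF g] show ?thesis
  proof eventually_elim
    case (elim s)
    show ?case
    proof
      assume s: "s \<in> {a<..<b}"
      have "\<forall>\<^sub>F h in at_right 0. integral {s..s + h} (F f) / h = integral {s..s + h} (F g) / h"
        unfolding eventually_at_right_field using s eq'[of s]
        by (intro exI[of _ "b - s"]) auto
      then have "((\<lambda>h. integral {s..s + h} (F g) / h) \<longlongrightarrow> F f s) (at_right 0)"
        by (rule Lim_transform_eventually[OF elim(1)])
      then have "F f s = F g s" using elim(2) by (intro tendsto_unique[of "at_right (0::real)"]) auto
      then show "f s = g s" using s by (simp add: F_def)
    qed
  qed
qed

text \<open>If \<open>F\<close> is the primitive of f with F(0) = 0, integration by parts turns the
  expression into s times the integral of e^(-s(l - y)) f(y), which concentrates at y = l. Only the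
  left difference quotient of \<open>F\<close> at l matters: the linear part of \<open>F\<close>
  gives \<open>D\<close> up to exponentially small terms, and the remainder \<open>R\<close> is o(l
  - y) against a kernel s^2 e^(-s(l - y)) whose first moment is at most 1.\<close>

lemma abelian_mean_left_derivative:
  fixes F :: "real \<Rightarrow> real"
  assumes l: "0 < l" and F: "continuous_on {0..l} F"
    and D: "((\<lambda>h. (F l - F (l - h)) / h) \<longlongrightarrow> D) (at_right 0)"
  shows "((\<lambda>s. s * F l - s\<^sup>2 * integral {0..l} (\<lambda>y. exp (- s * (l - y)) * F y)) \<longlongrightarrow> D) at_top"
proof -
  define R where "R = (\<lambda>y. F y - F l + D * (l - y))"
  define E where "E = (\<lambda>s. exp (- s * l))"
  have cR: "continuous_on {0..l} R" unfolding R_def by (intro continuous_intros F)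
  have ie: "((\<lambda>y. exp (- s * (l - y))) has_integral (1 - E s) / s) {0..l}" if "s > 0" for s
  proof -
    have "((\<lambda>y. exp (- s * (l - y))) has_integral (exp (- s * (l - l)) / s - exp (- s * (l - 0)) / s)) {0..l}"
      using l that by (intro fundamental_theorem_of_calculus)
        (auto intro!: derivative_eq_intros simp flip: has_real_derivative_iff_has_vector_derivative)
    then show ?thesis by (simp add: E_def diff_divide_distrib)
  qed
  have ie1: "((\<lambda>y. exp (- s * (l - y)) * (l - y)) has_integral (1 - E s * (1 + s * l)) / s\<^sup>2) {0..l}" if "s > 0" for s
  proof -
    have "((\<lambda>y. exp (- s * (l - y)) * (l - y)) has_integral
      (exp (- s * (l - l)) * ((l - l) / s + 1 / s\<^sup>2) - exp (- s * (l - 0)) * ((l - 0) / s + 1 / s\<^sup>2))) {0..l}"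
      using l that by (intro fundamental_theorem_of_calculus)
        (auto intro!: derivative_eq_intros simp flip: has_real_derivative_iff_has_vector_derivative
         simp: field_simps power2_eq_square)
    also have "(exp (- s * (l - l)) * ((l - l) / s + 1 / s\<^sup>2) - exp (- s * (l - 0)) * ((l - 0) / s + 1 / s\<^sup>2))
       = (1 - E s * (1 + s * l)) / s\<^sup>2"
      using that by (simp add: E_def field_simps power2_eq_square)
    finally show ?thesis .
  qed
  have ie2: "integral {0..l} (\<lambda>y. exp (- s * (l - y)) * (l - y)\<^sup>2) \<le> 2 / s ^ 3" if "s > 0" for s
  proof -
    have "((\<lambda>y. exp (- s * (l - y)) * (l - y)\<^sup>2) has_integral
      (exp (- s * (l - l)) * ((l - l)\<^sup>2 / s + 2 * (l - l) / s\<^sup>2 + 2 / s ^ 3)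
       - exp (- s * (l - 0)) * ((l - 0)\<^sup>2 / s + 2 * (l - 0) / s\<^sup>2 + 2 / s ^ 3))) {0..l}"
      using l that by (intro fundamental_theorem_of_calculus)
        (auto intro!: derivative_eq_intros simp flip: has_real_derivative_iff_has_vector_derivative
         simp: field_simps power2_eq_square power3_eq_cube)
    then have "integral {0..l} (\<lambda>y. exp (- s * (l - y)) * (l - y)\<^sup>2) =
       2 / s ^ 3 - exp (- s * (l - 0)) * ((l - 0)\<^sup>2 / s + 2 * (l - 0) / s\<^sup>2 + 2 / s ^ 3)"
      by (simp add: integral_unique)
    moreover have "0 \<le> exp (- s * (l - 0)) * ((l - 0)\<^sup>2 / s + 2 * (l - 0) / s\<^sup>2 + 2 / s ^ 3)"
      using l that by auto
    ultimately show ?thesis by linarith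
  qed
  define J where "J = (\<lambda>s. s\<^sup>2 * integral {0..l} (\<lambda>y. exp (- s * (l - y)) * R y))"
  have Jlim: "(J \<longlongrightarrow> 0) at_top"
    unfolding tendsto_iff
  proof (intro allI impI)
    fix e :: real assume e: "e > 0"
    have "((\<lambda>h. (F l - F (l - h)) / h - D) \<longlongrightarrow> D - D) (at_right 0)"
      by (intro tendsto_intros D)
    from tendstoD[OF this, of "e / 2"] e
    have "\<forall>\<^sub>F h in at_right 0. \<bar>(F l - F (l - h)) / h - D\<bar> < e / 2"
      by (simp add: dist_real_def)
    then obtain \<delta> where \<delta>: "\<delta> > 0" "\<And>h. 0 < h \<Longrightarrow> h < \<delta> \<Longrightarrow> \<bar>(F l - F (l - h)) / h - D\<bar> < e / 2"
      by (auto simp: eventually_at_right_field)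
    obtain C where C: "\<And>y. y \<in> {0..l} \<Longrightarrow> \<bar>R y\<bar> \<le> C" "C \<ge> 0"
    proof -
      have "bounded (R ` {0..l})"
        by (intro compact_imp_bounded compact_continuous_image cR compact_Icc)
      then obtain C where C: "\<forall>y\<in>R ` {0..l}. norm y \<le> C" unfolding bounded_iff by blast
      have "0 \<le> norm (R 0)" by simp
      also have "\<dots> \<le> C" using C l by force
      finally show ?thesis using that[of C] C by simp
    qed
    \<comment> \<open>At distance at least \<open>\<delta>\<close> from l the bound \<open>C\<close>
      is absorbed into \<open>K * (l - y)\<^sup>2\<close>, whose weighted integral is only of order
      1 / s.\<close>
    define K where "K = C / \<delta>\<^sup>2"
    have K0: "K \<ge> 0" using C by (simp add: K_def)
    have bnd: "\<bar>R y\<bar> \<le> e / 2 * (l - y) + K * (l - y)\<^sup>2" if y: "y \<in> {0..l}" for y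
    proof -
      consider "y = l" | "0 < l - y" "l - y < \<delta>" | "\<delta> \<le> l - y" using y by fastforce
      then show ?thesis
      proof cases
        case 1 then show ?thesis by (simp add: R_def)
      next
        case 2
        have "R y = (D - (F l - F (l - (l - y))) / (l - y)) * (l - y)"
          using 2 by (simp add: R_def field_simps)
        then have "\<bar>R y\<bar> = \<bar>(F l - F (l - (l - y))) / (l - y) - D\<bar> * (l - y)"
          using 2 by (simp add: abs_mult abs_minus_commute)
        also have "\<dots> \<le> e / 2 * (l - y)"
          using \<delta>(2)[OF 2] 2 by (intro mult_right_mono) auto
        finally show ?thesis using K0 by (simp add: add_increasing2)
      next
        case 3
        have "\<bar>R y\<bar> \<le> C" using C y by blast
        also have "C = K * \<delta>\<^sup>2" using \<delta> by (simp add: K_def)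
        also have "\<dots> \<le> K * (l - y)\<^sup>2" using 3 \<delta> K0 by (intro mult_left_mono power_mono) auto
        finally show ?thesis using e y by (simp add: add_increasing)
      qed
    qed
    have Jb: "\<bar>J s\<bar> \<le> e / 2 + 2 * K / s" if s: "s > 0" for s
    proof -
      let ?w = "\<lambda>y. exp (- s * (l - y))"
      have "\<bar>integral {0..l} (\<lambda>y. ?w y * R y)\<bar> \<le> integral {0..l} (\<lambda>y. e / 2 * (?w y * (l - y)) + K * (?w y * (l - y)\<^sup>2))"
        unfolding real_norm_def[symmetric]
      proof (rule integral_norm_bound_integral)
        fix y assume y: "y \<in> {0..l}"
        have "norm (?w y * R y) = ?w y * \<bar>R y\<bar>" by (simp add: abs_mult)
        also have "\<dots> \<le> ?w y * (e / 2 * (l - y) + K * (l - y)\<^sup>2)"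
          by (intro mult_left_mono bnd y) simp
        finally show "norm (?w y * R y) \<le> e / 2 * (?w y * (l - y)) + K * (?w y * (l - y)\<^sup>2)"
          by (simp only: distrib_left mult_ac)
      qed (intro integrable_continuous_interval continuous_intros cR; simp)+
      also have "\<dots> = e / 2 * integral {0..l} (\<lambda>y. ?w y * (l - y)) + K * integral {0..l} (\<lambda>y. ?w y * (l - y)\<^sup>2)"
      proof (subst integral_add)
        show "(\<lambda>y. e / 2 * (?w y * (l - y))) integrable_on {0..l}"
          by (intro integrable_continuous_interval continuous_intros)
        show "(\<lambda>y. K * (?w y * (l - y)\<^sup>2)) integrable_on {0..l}"
          by (intro integrable_continuous_interval continuous_intros)
      qed simp
      also have "\<dots> \<le> e / 2 * (1 / s\<^sup>2) + K * (2 / s ^ 3)"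
      proof (intro add_mono mult_left_mono K0 ie2 s)
        show "integral {0..l} (\<lambda>y. ?w y * (l - y)) \<le> 1 / s\<^sup>2"
          unfolding integral_unique[OF ie1[OF s]] using l s by (intro divide_right_mono) (auto simp: E_def)
      qed (use e in simp)
      finally have "\<bar>J s\<bar> \<le> s\<^sup>2 * (e / 2 * (1 / s\<^sup>2) + K * (2 / s ^ 3))"
        unfolding J_def abs_mult by (simp add: mult_left_mono)
      also have "\<dots> = e / 2 + 2 * K / s"
        using s by (simp add: field_simps power2_eq_square power3_eq_cube)
      finally show ?thesis .
    qed
    have "((\<lambda>s. 2 * K / s) \<longlongrightarrow> 0) at_top"
      by (intro tendsto_divide_0[OF tendsto_const] filterlim_at_top_imp_at_infinity filterlim_ident)
    then have "\<forall>\<^sub>F s in at_top. 2 * K / s < e / 2"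
      using e by (intro order_tendstoD(2)) auto
    then show "\<forall>\<^sub>F s in at_top. dist (J s) 0 < e"
      using eventually_gt_at_top[of 0] by eventually_elim (use Jb in \<open>force simp: dist_real_def\<close>)
  qed
  \<comment> \<open>Insert F = R + F(l) - D (l - y); the moments of the kernel of order 0 and 1 are
    known exactly.\<close>
  have eq: "s * F l - s\<^sup>2 * integral {0..l} (\<lambda>y. exp (- s * (l - y)) * F y)
      = s * E s * F l + D * (1 - E s * (1 + s * l)) - J s" if s: "s > 0" for s
  proof -
    let ?w = "\<lambda>y. exp (- s * (l - y))"
    have iR: "((\<lambda>y. ?w y * R y) has_integral integral {0..l} (\<lambda>y. ?w y * R y)) {0..l}"
      by (intro integrable_integral integrable_continuous_interval continuous_intros cR)
    have "((\<lambda>y. ?w y * R y + F l * ?w y - D * (?w y * (l - y))) has_integral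
      (integral {0..l} (\<lambda>y. ?w y * R y) + F l * ((1 - E s) / s) - D * ((1 - E s * (1 + s * l)) / s\<^sup>2))) {0..l}"
      by (intro has_integral_add has_integral_diff has_integral_mult_right iR ie ie1 s)
    also have "(\<lambda>y. ?w y * R y + F l * ?w y - D * (?w y * (l - y))) = (\<lambda>y. ?w y * F y)"
      by (auto simp: R_def algebra_simps)
    finally have "s\<^sup>2 * integral {0..l} (\<lambda>y. ?w y * F y) =
       s\<^sup>2 * (integral {0..l} (\<lambda>y. ?w y * R y) + F l * ((1 - E s) / s) - D * ((1 - E s * (1 + s * l)) / s\<^sup>2))"
      by (simp add: integral_unique)
    also have "\<dots> = J s + F l * s * (1 - E s) - D * (1 - E s * (1 + s * l))"
      using s by (simp add: J_def field_simps power2_eq_square)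
    finally show ?thesis by (simp add: algebra_simps)
  qed
  have "((\<lambda>s. s * E s * F l + D * (1 - E s * (1 + s * l)) - J s) \<longlongrightarrow> 0 * F l + D * (1 - 0) - 0) at_top"
  proof (intro tendsto_intros Jlim)
    show "((\<lambda>s. s * E s) \<longlongrightarrow> 0) at_top" unfolding E_def using l by real_asymp
    show "((\<lambda>s. E s * (1 + s * l)) \<longlongrightarrow> 0) at_top" unfolding E_def using l by real_asymp
  qed
  then have "((\<lambda>s. s * E s * F l + D * (1 - E s * (1 + s * l)) - J s) \<longlongrightarrow> D) at_top" by simp
  then show ?thesis
    by (rule Lim_transform_eventually) (rule eventually_mono[OF eventually_gt_at_top[of 0]], rule eq[symmetric])
qed

section \<open>Mild solutions of the damped transport equation\<close>

lemma has_integral_cong_AE_Icc: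
  fixes f g :: "real \<Rightarrow> real"
  assumes "AE x in lebesgue. x \<in> {a<..<b} \<longrightarrow> f x = g x" and "a \<le> c" "d \<le> b"
  shows "(f has_integral i) {c..d} \<longleftrightarrow> (g has_integral i) {c..d}"
proof -
  obtain N where N: "negligible N" "{x. \<not> (x \<in> {a<..<b} \<longrightarrow> f x = g x)} \<subseteq> N"
    using assms(1) by (auto simp: eventually_ae_filter_negligible)
  have "negligible (N \<union> {a, b})" using N by simp
  then show ?thesis
    by (rule has_integral_spike_eq) (use N assms in force)
qed

lemma integral_cong_AE_Icc:
  fixes f g :: "real \<Rightarrow> real"
  assumes "AE x in lebesgue. x \<in> {a<..<b} \<longrightarrow> f x = g x" and "a \<le> c" "d \<le> b"
  shows "integral {c..d} f = integral {c..d} g"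
  using has_integral_cong_AE_Icc[OF assms] unfolding integral_def integrable_on_def by simp

lemma has_integral_reflect_shift:
  fixes v :: "real \<Rightarrow> real"
  assumes "(v has_integral i) {t - d..t - c}"
  shows "((\<lambda>y. v (t - y)) has_integral i) {c..d}"
proof -
  have "(\<lambda>x. (1 / - 1) *\<^sub>R x + - ((1 / - 1) *\<^sub>R t)) ` cbox (t - d) (t - c) = {c..d}"
    by (auto simp: image_iff intro!: bexI[of _ "t - _"])
  then show ?thesis
    using has_integral_affinity[of v i "t - d" "t - c" "-1" t] assms by (simp add: algebra_simps)
qed

lemma integral_reflect_shift:
  fixes v :: "real \<Rightarrow> real"
  shows "integral {c..d} (\<lambda>y. v (t - y)) = integral {t - d..t - c} v"
proof (cases "v integrable_on {t - d..t - c}")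
  case True
  then show ?thesis by (intro integral_unique has_integral_reflect_shift integrable_integral)
next
  case False
  have "\<not> (\<lambda>y. v (t - y)) integrable_on {c..d}"
    using has_integral_reflect_shift[of "\<lambda>y. v (t - y)" _ t "t - c" "t - d"] False
    by (auto simp: integrable_on_def)
  with False show ?thesis by (simp add: not_integrable_integral)
qed

section \<open>Square integrability on intervals, the subspaces L2(0, l) and truncated
  functions\<close>

lemma square_absolutely_integrable_imp:
  fixes f :: "real \<Rightarrow> real"
  assumes "f \<in> borel_measurable (lebesgue_on {a..b})" "(\<lambda>x. (f x)\<^sup>2) integrable_on {a..b}"
  shows "f absolutely_integrable_on {a..b}"
proof (rule measurable_bounded_by_integrable_imp_absolutely_integrable)
  show "(\<lambda>x. 1 + (f x)\<^sup>2) integrable_on {a..b}" by (intro integrable_add assms integrable_const_ivl)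
  show "norm (f x) \<le> 1 + (f x)\<^sup>2" for x
  proof -
    have "0 \<le> (\<bar>f x\<bar> - 1)\<^sup>2" by simp
    then have "2 * \<bar>f x\<bar> \<le> 1 + (f x)\<^sup>2" by (simp add: power2_diff)
    then show ?thesis by simp
  qed
qed (use assms in auto)

lemma rep_L2_measurable: "rep_L2 f \<in> borel_measurable (lebesgue_on S)"
proof -
  have "rep_L2 f \<in> borel_measurable lebesgue"
    using rep_L2_square_integrable[of f] by (simp add: square_integrable_def measurable_completion)
  then show ?thesis by (rule measurable_restrict_space1)
qed

lemma rep_L2_square_integrable_on: "(\<lambda>x. (rep_L2 f x)\<^sup>2) integrable_on {a..b}"
proof -
  have "(\<lambda>x. (rep_L2 f x)\<^sup>2) integrable_on UNIV"
    using rep_L2_square_integrable[of f] by (intro integrable_on_lborel) (simp add: square_integrable_def)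
  then show ?thesis by (rule integrable_on_subinterval) simp
qed

lemma rep_L2_absolutely_integrable: "rep_L2 f absolutely_integrable_on {a..b}"
  by (intro square_absolutely_integrable_imp rep_L2_measurable rep_L2_square_integrable_on)

lemma continuous_mult_rep_L2_absolutely_integrable:
  assumes "continuous_on {a..b} w"
  shows "(\<lambda>y. w y * rep_L2 f y) absolutely_integrable_on {a..b}"
proof (rule absolutely_integrable_bounded_measurable_product_real[OF _ _ _ rep_L2_absolutely_integrable])
  show "w \<in> borel_measurable (lebesgue_on {a..b})"
    by (rule continuous_imp_measurable_on_sets_lebesgue[OF assms]) simp
  show "bounded (w ` {a..b})"
    by (intro compact_imp_bounded compact_continuous_image assms compact_Icc)
qed simp

lemma L2_space_add:
  assumes "f \<in> L2_space l" "g \<in> L2_space l"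
  shows "f + g \<in> L2_space l"
  using assms rep_L2_add[of f g] unfolding L2_space_def mem_Collect_eq
  by eventually_elim auto

lemma L2_space_scaleR:
  assumes "f \<in> L2_space l"
  shows "c *\<^sub>R f \<in> L2_space l"
  using assms rep_L2_scaleR[of c f] unfolding L2_space_def mem_Collect_eq
  by eventually_elim auto

lemma L2_space_uminus: "f \<in> L2_space l \<Longrightarrow> - f \<in> L2_space l"
  using L2_space_scaleR[of f l "-1"] by simp

lemma L2_space_diff: "f \<in> L2_space l \<Longrightarrow> g \<in> L2_space l \<Longrightarrow> f - g \<in> L2_space l"
  using L2_space_add[of f l "- g"] L2_space_uminus[of g l] by simp

text \<open>Besides elements of L2(0, l) this supplies test functions: with a point x in place of
  \<open>l\<close>, pairing with \<open>cut_L2 x w\<close> is integration against \<open>w\<close>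
  over [0, x].\<close>

definition cut_L2 :: "real \<Rightarrow> (real \<Rightarrow> real) \<Rightarrow> L2" where
  "cut_L2 l \<phi> = abs_L2 (\<lambda>x. indicator {0..l} x * \<phi> x)"

lemma square_integrable_cut:
  assumes "continuous_on {0..l} \<phi>"
  shows "square_integrable (\<lambda>x. indicator {0..l} x * \<phi> x)"
  unfolding square_integrable_def
proof
  show "(\<lambda>x. indicator {0..l} x * \<phi> x) \<in> borel_measurable lborel"
    using borel_measurable_continuous_on_indicator[OF _ assms] by simp
  have "set_integrable lborel {0..l} (\<lambda>x. (\<phi> x)\<^sup>2)"
    by (intro borel_integrable_atLeastAtMost' continuous_intros assms)
  then have "integrable lborel (\<lambda>x. indicator {0..l} x * (\<phi> x)\<^sup>2)"
    by (simp add: set_integrable_def)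
  also have "(\<lambda>x. indicator {0..l} x * (\<phi> x)\<^sup>2) = (\<lambda>x. (indicator {0..l} x * \<phi> x)\<^sup>2)"
    by (auto simp: indicator_def)
  finally show "integrable lborel (\<lambda>x. (indicator {0..l} x * \<phi> x)\<^sup>2)" .
qed

lemma rep_cut_L2:
  assumes "continuous_on {0..l} \<phi>"
  shows "AE x in lborel. rep_L2 (cut_L2 l \<phi>) x = indicator {0..l} x * \<phi> x"
  unfolding cut_L2_def by (intro rep_abs_L2 square_integrable_cut assms)

lemma cut_L2_in_L2_space:
  assumes "continuous_on {0..l} \<phi>"
  shows "cut_L2 l \<phi> \<in> L2_space l"
  unfolding L2_space_def mem_Collect_eq
  using rep_cut_L2[OF assms] AE_lborel_singleton[of 0] AE_lborel_singleton[of l]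
  by eventually_elim (auto simp: indicator_def)

text \<open>As a bounded functional of \<open>f\<close>, the integral commutes with the time
  integral of L2-valued functions and obeys the Cauchy-Schwarz inequality.\<close>

lemma inner_cut_L2:
  assumes "continuous_on {0..x} w"
  shows "inner (cut_L2 x w) f = integral {0..x} (\<lambda>y. w y * rep_L2 f y)"
proof -
  have i: "set_integrable lborel {0..x} (\<lambda>y. w y * rep_L2 f y)"
    using square_integrable_mult[OF square_integrable_cut[OF assms] rep_L2_square_integrable[of f]]
    by (simp add: set_integrable_def mult.assoc)
  have "inner (cut_L2 x w) f = (\<integral>y. indicator {0..x} y *\<^sub>R (w y * rep_L2 f y) \<partial>lborel)"
    unfolding inner_L2_rep
  proof (rule integral_cong_AE)
    show "AE y in lborel. rep_L2 (cut_L2 x w) y * rep_L2 f y = indicator {0..x} y *\<^sub>R (w y * rep_L2 f y)"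
      using rep_cut_L2[OF assms] by eventually_elim simp
    show "(\<lambda>y. rep_L2 (cut_L2 x w) y * rep_L2 f y) \<in> borel_measurable lborel"
      using square_integrable_mult[OF rep_L2_square_integrable rep_L2_square_integrable] by blast
    show "(\<lambda>y. indicator {0..x} y *\<^sub>R (w y * rep_L2 f y)) \<in> borel_measurable lborel"
      using i by (auto simp: set_integrable_def)
  qed
  also have "\<dots> = integral {0..x} (\<lambda>y. w y * rep_L2 f y)"
    using set_borel_integral_eq_integral(2)[OF i] by (simp add: set_lebesgue_integral_def)
  finally show ?thesis .
qed

lemma norm_L2_space:
  assumes "f \<in> L2_space l"
  shows "(norm f)\<^sup>2 = integral {0..l} (\<lambda>x. (rep_L2 f x)\<^sup>2)"
proof -
  have si: "set_integrable lborel {0..l} (\<lambda>x. (rep_L2 f x)\<^sup>2)"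
    unfolding set_integrable_def using rep_L2_square_integrable[of f]
    by (intro integrable_mult_indicator) (auto simp: square_integrable_def)
  have "(norm f)\<^sup>2 = (\<integral>x. rep_L2 f x * rep_L2 f x \<partial>lborel)"
    by (simp add: power2_norm_eq_inner inner_L2_rep)
  also have "\<dots> = (\<integral>x. indicator {0..l} x *\<^sub>R (rep_L2 f x)\<^sup>2 \<partial>lborel)"
  proof (rule integral_cong_AE)
    have "AE x in lborel. x \<notin> {0<..<l} \<longrightarrow> rep_L2 f x = 0" using assms by (simp add: L2_space_def)
    then show "AE x in lborel. rep_L2 f x * rep_L2 f x = indicator {0..l} x *\<^sub>R (rep_L2 f x)\<^sup>2"
      by eventually_elim (auto simp: indicator_def power2_eq_square)
    show "(\<lambda>x. rep_L2 f x * rep_L2 f x) \<in> borel_measurable lborel"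
      using square_integrable_mult[OF rep_L2_square_integrable rep_L2_square_integrable] by blast
    show "(\<lambda>x. indicator {0..l} x *\<^sub>R (rep_L2 f x)\<^sup>2) \<in> borel_measurable lborel"
      using si by (auto simp: set_integrable_def)
  qed
  also have "\<dots> = integral {0..l} (\<lambda>x. (rep_L2 f x)\<^sup>2)"
    using set_borel_integral_eq_integral(2)[OF si] by (simp add: set_lebesgue_integral_def)
  finally show ?thesis .
qed

text \<open>The weight is the integrating factor of f' + \<kappa> f. For the two decoupled
  components \<kappa> is 0 and \<open>h1 + h2\<close>, and in the resolvent these are shifted by s.
  Unlike the representative itself, the primitive depends only on the class, so it is linear in
  \<open>f\<close> at every single x.\<close>

definition weighted_primitive :: "real \<Rightarrow> L2 \<Rightarrow> real \<Rightarrow> real" where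
  "weighted_primitive \<kappa> f x = integral {0..x} (\<lambda>y. exp (\<kappa> * y) * rep_L2 f y)"

lemma weighted_primitive_inner: "weighted_primitive \<kappa> f x = inner (cut_L2 x (\<lambda>y. exp (\<kappa> * y))) f"
  unfolding weighted_primitive_def by (intro inner_cut_L2[symmetric] continuous_intros)

lemma weighted_primitive_linear:
  "weighted_primitive \<kappa> (f + g) x = weighted_primitive \<kappa> f x + weighted_primitive \<kappa> g x"
  "weighted_primitive \<kappa> (f - g) x = weighted_primitive \<kappa> f x - weighted_primitive \<kappa> g x"
  "weighted_primitive \<kappa> (c *\<^sub>R f) x = c * weighted_primitive \<kappa> f x"
  "weighted_primitive \<kappa> (- f) x = - weighted_primitive \<kappa> f x"
  by (simp_all add: weighted_primitive_inner inner_add_right inner_diff_right)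

lemma weighted_primitive_bound:
  assumes "0 \<le> \<kappa>" "x \<in> {0..l}"
  shows "\<bar>weighted_primitive \<kappa> f x\<bar> \<le> exp (\<kappa> * l) * sqrt l * norm f"
proof -
  let ?c = "cut_L2 x (\<lambda>y. exp (\<kappa> * y))"
  have c: "continuous_on {0..x} (\<lambda>y. exp (\<kappa> * y))" by (intro continuous_intros)
  have "(norm ?c)\<^sup>2 = integral {0..x} (\<lambda>y. exp (\<kappa> * y) * rep_L2 ?c y)"
    by (simp add: power2_norm_eq_inner inner_cut_L2[OF c])
  also have "\<dots> = integral {0..x} (\<lambda>y. exp (\<kappa> * y) * exp (\<kappa> * y))"
  proof (rule integral_cong_AE_Icc[of 0 x])
    show "AE y in lebesgue. y \<in> {0<..<x} \<longrightarrow> exp (\<kappa> * y) * rep_L2 ?c y = exp (\<kappa> * y) * exp (\<kappa> * y)"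
      using AE_completion[OF rep_cut_L2[OF c]] by eventually_elim simp
  qed auto
  also have "\<dots> \<le> integral {0..x} (\<lambda>y. exp (\<kappa> * l) * exp (\<kappa> * l))"
  proof (rule integral_le)
    fix y assume "y \<in> {0..x}"
    then have "exp (\<kappa> * y) \<le> exp (\<kappa> * l)" using assms by (simp add: mult_left_mono)
    then show "exp (\<kappa> * y) * exp (\<kappa> * y) \<le> exp (\<kappa> * l) * exp (\<kappa> * l)"
      by (intro mult_mono) auto
  qed (intro integrable_continuous_interval continuous_intros)+
  also have "\<dots> \<le> exp (\<kappa> * l) * exp (\<kappa> * l) * l"
    using assms by (simp add: mult_left_mono mult.commute)
  also have "\<dots> = (exp (\<kappa> * l) * sqrt l)\<^sup>2"
    using assms by (simp add: power_mult_distrib power2_eq_square[of "exp (\<kappa> * l)"])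
  finally have "norm ?c \<le> exp (\<kappa> * l) * sqrt l"
    by (rule power2_le_imp_le) (use assms in auto)
  then have "norm ?c * norm f \<le> exp (\<kappa> * l) * sqrt l * norm f" by (rule mult_right_mono) simp
  moreover have "\<bar>inner ?c f\<bar> \<le> norm ?c * norm f" by (rule Cauchy_Schwarz_ineq2)
  ultimately show ?thesis unfolding weighted_primitive_inner by linarith
qed

lemma weighted_primitive_continuous: "continuous_on {0..l} (weighted_primitive \<kappa> f)"
  unfolding weighted_primitive_def[abs_def]
  by (intro indefinite_integral_continuous_1 set_lebesgue_integral_eq_integral(1)
      continuous_mult_rep_L2_absolutely_integrable continuous_intros)

text \<open>The bound on the primitive is uniform in x, so norm continuity of \<open>z\<close> in
  time gives joint continuity.\<close>

lemma weighted_primitive_continuous2: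
  assumes z: "continuous_on J z" and \<kappa>: "0 \<le> \<kappa>"
  shows "continuous_on (J \<times> {0..l}) (\<lambda>(t, x). weighted_primitive \<kappa> (z t) x)"
  unfolding continuous_on_def
proof (intro ballI)
  fix p assume p: "p \<in> J \<times> {0..l}"
  obtain t x where [simp]: "p = (t, x)" by force
  let ?F = "at p within J \<times> {0..l}"
  let ?C = "exp (\<kappa> * l) * sqrt l"
  have c1: "continuous_on (J \<times> {0..l}) (\<lambda>q. z (fst q))"
    by (rule continuous_on_compose2[OF z]) (auto intro!: continuous_intros)
  have c2: "continuous_on (J \<times> {0..l}) (\<lambda>q. weighted_primitive \<kappa> (z t) (snd q))"
    by (rule continuous_on_compose2[OF weighted_primitive_continuous]) (auto intro!: continuous_intros)
  have "((\<lambda>q. ?C * norm (z (fst q) - z t)) \<longlongrightarrow> ?C * norm (z t - z t)) ?F"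
    using c1 p by (intro tendsto_intros) (auto simp: continuous_on_def)
  then have l1: "((\<lambda>q. ?C * norm (z (fst q) - z t)) \<longlongrightarrow> 0) ?F" by simp
  have "((\<lambda>q. weighted_primitive \<kappa> (z (fst q) - z t) (snd q)) \<longlongrightarrow> 0) ?F"
  proof (rule Lim_null_comparison[OF _ l1])
    show "\<forall>\<^sub>F q in ?F. norm (weighted_primitive \<kappa> (z (fst q) - z t) (snd q)) \<le> ?C * norm (z (fst q) - z t)"
      unfolding eventually_at_filter using weighted_primitive_bound[OF \<kappa>]
      by (intro always_eventually) auto
  qed
  moreover have "((\<lambda>q. weighted_primitive \<kappa> (z t) (snd q)) \<longlongrightarrow> weighted_primitive \<kappa> (z t) x) ?F"
    using c2 p unfolding continuous_on_def by force
  ultimately have "((\<lambda>q. weighted_primitive \<kappa> (z (fst q) - z t) (snd q) + weighted_primitive \<kappa> (z t) (snd q))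
      \<longlongrightarrow> 0 + weighted_primitive \<kappa> (z t) x) ?F"
    by (rule tendsto_add)
  then show "((\<lambda>(t, x). weighted_primitive \<kappa> (z t) x) \<longlongrightarrow> (case p of (t, x) \<Rightarrow> weighted_primitive \<kappa> (z t) x)) ?F"
    by (simp add: weighted_primitive_linear case_prod_unfold)
qed

lemma has_integral_weighted_primitive:
  assumes "(z has_integral W) {a..b}"
  shows "((\<lambda>s. weighted_primitive \<kappa> (z s) x) has_integral weighted_primitive \<kappa> W x) {a..b}"
  using has_integral_linear[OF assms bounded_linear_inner_right[of "cut_L2 x (\<lambda>y. exp (\<kappa> * y))"]]
  by (simp add: weighted_primitive_inner o_def)

section \<open>Functions in H1 and integrating factors\<close>

lemma H1_rep_weighted:
  assumes f: "H1_rep l f \<phi> d" and x: "x \<in> {0..l}"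
  shows "exp (\<kappa> * x) * \<phi> x - \<phi> 0 = weighted_primitive \<kappa> (d + \<kappa> *\<^sub>R f) x"
proof -
  have \<phi>: "\<phi> x = \<phi> 0 + integral {0..x} (rep_L2 d)" if "x \<in> {0..l}" for x
    using f that by (auto simp: H1_rep_def dest!: bspec integral_unique)
  have ae: "AE y in lebesgue. y \<in> {0<..<l} \<longrightarrow>
      \<kappa> * exp (\<kappa> * y) * \<phi> y + exp (\<kappa> * y) * rep_L2 d y = exp (\<kappa> * y) * rep_L2 (d + \<kappa> *\<^sub>R f) y"
  proof (rule AE_completion)
    have "AE y in lborel. y \<in> {0<..<l} \<longrightarrow> rep_L2 f y = \<phi> y" using f by (simp add: H1_rep_def)
    then show "AE y in lborel. y \<in> {0<..<l} \<longrightarrow>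
      \<kappa> * exp (\<kappa> * y) * \<phi> y + exp (\<kappa> * y) * rep_L2 d y = exp (\<kappa> * y) * rep_L2 (d + \<kappa> *\<^sub>R f) y"
      using rep_L2_add[of d "\<kappa> *\<^sub>R f"] rep_L2_scaleR[of \<kappa> f]
      by eventually_elim (auto simp: algebra_simps)
  qed
  have "((\<lambda>y. \<kappa> * exp (\<kappa> * y) * \<phi> y + exp (\<kappa> * y) * rep_L2 d y) has_integral
      (exp (\<kappa> * x) * \<phi> x - exp (\<kappa> * 0) * \<phi> 0)) {0..x}"
    by (rule indefinite_integral_by_parts[OF rep_L2_absolutely_integrable \<phi> _ _ x])
      (auto intro!: derivative_eq_intros continuous_intros)
  then show ?thesis
    using integral_cong_AE_Icc[OF ae, of 0 x] x unfolding weighted_primitive_def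
    by (auto dest!: integral_unique)
qed

lemma H1_rep_cut_L2:
  assumes \<phi>: "\<And>x. x \<in> {0..l} \<Longrightarrow> (\<phi> has_real_derivative \<phi>' x) (at x within {0..l})"
    and \<phi>': "continuous_on {0..l} \<phi>'"
  shows "H1_rep l (cut_L2 l \<phi>) \<phi> (cut_L2 l \<phi>')"
proof -
  have c: "continuous_on {0..l} \<phi>"
    using \<phi> by (meson DERIV_continuous continuous_on_eq_continuous_within)
  show ?thesis
    unfolding H1_rep_def
  proof (intro conjI ballI cut_L2_in_L2_space c \<phi>')
    show "AE x in lborel. x \<in> {0<..<l} \<longrightarrow> rep_L2 (cut_L2 l \<phi>) x = \<phi> x"
      using rep_cut_L2[OF c] by eventually_elim auto
    fix x assume x: "x \<in> {0..l}"
    have ae: "AE x in lebesgue. x \<in> {0<..<l} \<longrightarrow> rep_L2 (cut_L2 l \<phi>') x = \<phi>' x"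
      using AE_completion[OF rep_cut_L2[OF \<phi>']] by eventually_elim auto
    have "(\<phi>' has_integral (\<phi> x - \<phi> 0)) {0..x}"
      using x by (intro fundamental_theorem_of_calculus)
        (auto simp flip: has_real_derivative_iff_has_vector_derivative intro: DERIV_subset[OF \<phi>])
    then show "(rep_L2 (cut_L2 l \<phi>') has_integral (\<phi> x - \<phi> 0)) {0..x}"
      using has_integral_cong_AE_Icc[OF ae, of 0 x] x by simp
  qed
qed

text \<open>Variation of constants for the equation with \<open>\<phi>' + \<mu> \<phi> = f\<close>
  and \<open>\<phi> 0 = 0\<close>. Both decoupled components of the resolvent have this
  form.\<close>

lemma H1_rep_linear_ode:
  fixes \<mu> :: real
  assumes f: "f \<in> L2_space l"
  defines "\<phi> \<equiv> \<lambda>x. exp (- \<mu> * x) * weighted_primitive \<mu> f x"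
  shows "H1_rep l (cut_L2 l \<phi>) \<phi> (f - \<mu> *\<^sub>R cut_L2 l \<phi>)"
proof -
  have c: "continuous_on {0..l} \<phi>"
    unfolding \<phi>_def by (intro continuous_intros weighted_primitive_continuous)
  have r: "AE x in lborel. x \<in> {0<..<l} \<longrightarrow> rep_L2 (cut_L2 l \<phi>) x = \<phi> x"
    using rep_cut_L2[OF c] by eventually_elim auto
  show ?thesis
    unfolding H1_rep_def
  proof (intro conjI ballI cut_L2_in_L2_space c L2_space_diff L2_space_scaleR f r)
    fix x assume x: "x \<in> {0..l}"
    have ae: "AE x in lebesgue. x \<in> {0<..<l} \<longrightarrow> rep_L2 (f - \<mu> *\<^sub>R cut_L2 l \<phi>) x =
        - \<mu> * exp (- \<mu> * x) * weighted_primitive \<mu> f x + exp (- \<mu> * x) * (exp (\<mu> * x) * rep_L2 f x)"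
    proof (rule AE_completion)
      show "AE x in lborel. x \<in> {0<..<l} \<longrightarrow> rep_L2 (f - \<mu> *\<^sub>R cut_L2 l \<phi>) x =
        - \<mu> * exp (- \<mu> * x) * weighted_primitive \<mu> f x + exp (- \<mu> * x) * (exp (\<mu> * x) * rep_L2 f x)"
        using r rep_L2_diff[of f "\<mu> *\<^sub>R cut_L2 l \<phi>"] rep_L2_scaleR[of \<mu> "cut_L2 l \<phi>"]
        by eventually_elim (auto simp: \<phi>_def mult.assoc[symmetric] simp flip: exp_add)
    qed
    have "((\<lambda>x. - \<mu> * exp (- \<mu> * x) * weighted_primitive \<mu> f x + exp (- \<mu> * x) * (exp (\<mu> * x) * rep_L2 f x)) has_integral
       (exp (- \<mu> * x) * weighted_primitive \<mu> f x - exp (- \<mu> * 0) * weighted_primitive \<mu> f 0)) {0..x}"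
      by (rule indefinite_integral_by_parts[where b = l and c = 0])
        (use x in \<open>auto intro!: derivative_eq_intros continuous_intros continuous_mult_rep_L2_absolutely_integrable
          simp: weighted_primitive_def\<close>)
    then show "(rep_L2 (f - \<mu> *\<^sub>R cut_L2 l \<phi>) has_integral (\<phi> x - \<phi> 0)) {0..x}"
      using has_integral_cong_AE_Icc[OF ae, of 0 x] x by (simp add: \<phi>_def)
  qed
qed

text \<open>This is z(t, x) = e^(-\<kappa> x) v(t - x) in a form that needs no point values; on
  [a - l, a] the trace \<open>v\<close> encodes the initial state. Multiplying the time-integrated
  equation by the integrating factor and integrating twice in x yields the identity required by
  \<open>transport_characteristics\<close>, with the primitive of \<open>v\<close> as
  \<open>V\<close>.\<close>

lemma transport_mild_solution_primitive:
  assumes l: "0 < l" and \<kappa>: "0 \<le> \<kappa>" and ab: "a \<le> b"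
    and z: "continuous_on {a..b} z"
    and mild: "\<And>t. t \<in> {a..b} \<Longrightarrow> \<exists>W \<phi> d. H1_rep l W \<phi> d \<and> (z has_integral W) {a..t} \<and>
       z t - z a = - d - \<kappa> *\<^sub>R W \<and> \<phi> 0 = integral {a..t} v"
    and v: "v integrable_on {a - l..b}"
    and init: "\<And>x. x \<in> {0..l} \<Longrightarrow> weighted_primitive \<kappa> (z a) x = integral {a - x..a} v"
    and t: "t \<in> {a..b}" and x: "x \<in> {0..l}"
  shows "weighted_primitive \<kappa> (z t) x = integral {t - x..t} v"
proof -
  define V where "V = (\<lambda>s. integral {a - l..s} v)"
  have V: "integral {s..t} v = V t - V s" if "a - l \<le> s" "s \<le> t" "t \<le> b" for s t
    using Henstock_Kurzweil_Integration.integral_combine[of "a - l" s t v]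
      integrable_on_subinterval[OF v, of "a - l" t] that by (auto simp: V_def)
  have "weighted_primitive \<kappa> (z t) x = V t - V (t - x)"
  proof (rule transport_characteristics[OF l ab weighted_primitive_continuous2[OF z \<kappa>] _ _ _ t x])
    show "continuous_on {a - l..b} V" unfolding V_def by (rule indefinite_integral_continuous_1[OF v])
    show init': "weighted_primitive \<kappa> (z a) x = V a - V (a - x)" if "x \<in> {0..l}" for x
      using init[OF that] V[of "a - x" a] that ab by simp
    fix t x assume t: "t \<in> {a..b}" and x: "x \<in> {0..l}"
    obtain W \<phi> d where W: "H1_rep l W \<phi> d" "(z has_integral W) {a..t}"
       "z t - z a = - d - \<kappa> *\<^sub>R W" "\<phi> 0 = integral {a..t} v"
      using mild[OF t] by blast
    have "integral {a..t} (\<lambda>s. weighted_primitive \<kappa> (z s) x) = weighted_primitive \<kappa> W x"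
      using has_integral_weighted_primitive[OF W(2)] by (rule integral_unique)
    also have "\<dots> = integral {0..x} (\<lambda>y. exp (\<kappa> * y) * \<phi> y)"
      unfolding weighted_primitive_def
    proof (rule integral_cong_AE_Icc[of 0 l])
      have "AE y in lborel. y \<in> {0<..<l} \<longrightarrow> rep_L2 W y = \<phi> y" using W(1) by (simp add: H1_rep_def)
      from AE_completion[OF this]
      show "AE y in lebesgue. y \<in> {0<..<l} \<longrightarrow> exp (\<kappa> * y) * rep_L2 W y = exp (\<kappa> * y) * \<phi> y"
        by eventually_elim simp
    qed (use x in auto)
    also have "\<dots> = integral {0..x} (\<lambda>y. V t - V (a - y) - weighted_primitive \<kappa> (z t) y)"
    proof (rule integral_cong)
      fix y assume y: "y \<in> {0..x}"
      then have y': "y \<in> {0..l}" using x by auto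
      have "d + \<kappa> *\<^sub>R W = - (z t - z a)" using W(3) by simp
      then have "exp (\<kappa> * y) * \<phi> y = \<phi> 0 - (weighted_primitive \<kappa> (z t) y - weighted_primitive \<kappa> (z a) y)"
        using H1_rep_weighted[OF W(1) y', of \<kappa>] by (simp add: weighted_primitive_linear)
      also have "\<phi> 0 = V t - V a" using V[of a t] t l W(4) by simp
      finally show "exp (\<kappa> * y) * \<phi> y = V t - V (a - y) - weighted_primitive \<kappa> (z t) y"
        using init'[OF y'] by simp
    qed
    finally show "integral {a..t} (\<lambda>s. weighted_primitive \<kappa> (z s) x)
      = integral {0..x} (\<lambda>y. V t - V (a - y) - weighted_primitive \<kappa> (z t) y)" .
  qed
  then show ?thesis using V[of "t - x" t] t x by auto
qed

text \<open>Equality of the two primitives for all x gives f(x) = e^(-\<kappa> x) v(t - x) for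
  almost every x, and the exponential factor is at most 1.\<close>

lemma norm_L2_le_trace:
  assumes f: "f \<in> L2_space l" and \<kappa>: "0 \<le> \<kappa>"
    and v: "v integrable_on {t - l..t}" and v2: "(\<lambda>s. (v s)\<^sup>2) integrable_on {t - l..t}"
    and F: "\<And>x. x \<in> {0..l} \<Longrightarrow> weighted_primitive \<kappa> f x = integral {t - x..t} v"
  shows "(norm f)\<^sup>2 \<le> integral {t - l..t} (\<lambda>s. (v s)\<^sup>2)"
proof -
  have r: "(\<lambda>y. h (t - y)) integrable_on {0..l}" if "h integrable_on {t - l..t}" for h :: "real \<Rightarrow> real"
    using has_integral_reflect_shift[of h _ t l 0] that by (auto simp: integrable_on_def)
  have "AE x in lebesgue. x \<in> {0<..<l} \<longrightarrow> exp (\<kappa> * x) * rep_L2 f x = v (t - x)"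
  proof (rule AE_eq_if_integrals_eq)
    show "(\<lambda>x. exp (\<kappa> * x) * rep_L2 f x) integrable_on {0..l}"
      by (intro set_lebesgue_integral_eq_integral(1) continuous_mult_rep_L2_absolutely_integrable continuous_intros)
    show "(\<lambda>x. v (t - x)) integrable_on {0..l}" by (rule r[OF v])
    show "integral {0..x} (\<lambda>x. exp (\<kappa> * x) * rep_L2 f x) = integral {0..x} (\<lambda>x. v (t - x))" if "x \<in> {0..l}" for x
      using F[OF that] by (simp add: weighted_primitive_def integral_reflect_shift)
  qed
  then have ae: "AE x in lebesgue. x \<in> {0<..<l} \<longrightarrow> (rep_L2 f x)\<^sup>2 = (exp (- \<kappa> * x) * v (t - x))\<^sup>2"
  proof eventually_elim
    case (elim x)
    show ?case
    proof
      assume "x \<in> {0<..<l}"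
      then have "v (t - x) = exp (\<kappa> * x) * rep_L2 f x" using elim by simp
      then show "(rep_L2 f x)\<^sup>2 = (exp (- \<kappa> * x) * v (t - x))\<^sup>2"
        by (simp add: mult.assoc[symmetric] flip: exp_add)
    qed
  qed
  have i: "(\<lambda>x. (exp (- \<kappa> * x) * v (t - x))\<^sup>2) integrable_on {0..l}"
    using rep_L2_square_integrable_on[of f 0 l] has_integral_cong_AE_Icc[OF ae, of 0 l]
    by (auto simp: integrable_on_def)
  have "(norm f)\<^sup>2 = integral {0..l} (\<lambda>x. (exp (- \<kappa> * x) * v (t - x))\<^sup>2)"
    unfolding norm_L2_space[OF f] by (rule integral_cong_AE_Icc[OF ae]) auto
  also have "\<dots> \<le> integral {0..l} (\<lambda>x. (v (t - x))\<^sup>2)"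
  proof (rule integral_le[OF i r[OF v2]])
    fix x assume "x \<in> {0..l}"
    then have "(exp (- \<kappa> * x))\<^sup>2 \<le> 1" using \<kappa> by (intro power_le_one) auto
    then have "(exp (- \<kappa> * x))\<^sup>2 * (v (t - x))\<^sup>2 \<le> 1 * (v (t - x))\<^sup>2" by (rule mult_right_mono) simp
    then show "(exp (- \<kappa> * x) * v (t - x))\<^sup>2 \<le> (v (t - x))\<^sup>2" by (simp add: power_mult_distrib)
  qed
  also have "\<dots> = integral {t - l..t} (\<lambda>s. (v s)\<^sup>2)"
    using integral_reflect_shift[of 0 l "\<lambda>s. (v s)\<^sup>2" t] by simp
  finally show ?thesis .
qed

section \<open>The resolvent of the exchanger and \<open>C\<^sub>\<Lambda>\<close>\<close>

text \<open>The coefficients (h2, h1) of \<open>mean_part\<close> and (1, -1) of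
  \<open>diff_part\<close> are the left eigenvectors of the exchange matrix for the eigenvalues 0
  and -(h1 + h2).\<close>

definition mean_part :: "real \<Rightarrow> real \<Rightarrow> L2 \<times> L2 \<Rightarrow> L2" where
  "mean_part h1 h2 z = h2 *\<^sub>R fst z + h1 *\<^sub>R snd z"

definition diff_part :: "L2 \<times> L2 \<Rightarrow> L2" where
  "diff_part z = fst z - snd z"

lemma mean_part_in_L2_space: "z \<in> state_space l \<Longrightarrow> mean_part h1 h2 z \<in> L2_space l"
  by (auto simp: state_space_def mean_part_def intro!: L2_space_add L2_space_scaleR)

lemma diff_part_in_L2_space: "z \<in> state_space l \<Longrightarrow> diff_part z \<in> L2_space l"
  by (auto simp: state_space_def diff_part_def intro!: L2_space_diff)

lemma H1_rep_lincomb: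
  assumes f: "H1_rep l f \<phi> d" and g: "H1_rep l g \<psi> e"
  shows "H1_rep l (a *\<^sub>R f + b *\<^sub>R g) (\<lambda>x. a * \<phi> x + b * \<psi> x) (a *\<^sub>R d + b *\<^sub>R e)"
proof -
  have r: "AE x in lborel. rep_L2 (a *\<^sub>R u + b *\<^sub>R v) x = a * rep_L2 u x + b * rep_L2 v x" for u v
    using rep_L2_add[of "a *\<^sub>R u" "b *\<^sub>R v"] rep_L2_scaleR[of a u] rep_L2_scaleR[of b v]
    by eventually_elim simp
  show ?thesis
    unfolding H1_rep_def
  proof (intro conjI ballI)
    show "a *\<^sub>R f + b *\<^sub>R g \<in> L2_space l" "a *\<^sub>R d + b *\<^sub>R e \<in> L2_space l"
      using f g by (auto simp: H1_rep_def intro!: L2_space_add L2_space_scaleR)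
    have "AE x in lborel. x \<in> {0<..<l} \<longrightarrow> rep_L2 f x = \<phi> x" "AE x in lborel. x \<in> {0<..<l} \<longrightarrow> rep_L2 g x = \<psi> x"
      using f g by (auto simp: H1_rep_def)
    with r[of f g] show "AE x in lborel. x \<in> {0<..<l} \<longrightarrow> rep_L2 (a *\<^sub>R f + b *\<^sub>R g) x = a * \<phi> x + b * \<psi> x"
      by eventually_elim auto
    fix x assume x: "x \<in> {0..l}"
    have "((\<lambda>x. a * rep_L2 d x + b * rep_L2 e x) has_integral (a * (\<phi> x - \<phi> 0) + b * (\<psi> x - \<psi> 0))) {0..x}"
      using f g x by (intro has_integral_add has_integral_mult_right) (auto simp: H1_rep_def)
    moreover have ae: "AE y in lborel. y \<in> {0..x} \<longrightarrow> rep_L2 (a *\<^sub>R d + b *\<^sub>R e) y = a * rep_L2 d y + b * rep_L2 e y"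
      using r[of d e] by eventually_elim simp
    ultimately have "(rep_L2 (a *\<^sub>R d + b *\<^sub>R e) has_integral (a * (\<phi> x - \<phi> 0) + b * (\<psi> x - \<psi> 0))) {0..x}"
      unfolding has_integral_AE[OF ae] by simp
    then show "(rep_L2 (a *\<^sub>R d + b *\<^sub>R e) has_integral
        (a * \<phi> x + b * \<psi> x - (a * \<phi> 0 + b * \<psi> 0))) {0..x}"
      by (simp add: algebra_simps)
  qed
qed

lemma H1_rep_inject:
  assumes f: "H1_rep l f \<phi> d" and g: "H1_rep l g \<psi> e"
    and eq: "\<And>x. x \<in> {0<..<l} \<Longrightarrow> \<phi> x = \<psi> x"
  shows "f = g"
proof (rule L2_eqI)
  have "AE x in lborel. x \<in> {0<..<l} \<longrightarrow> rep_L2 f x = \<phi> x" "AE x in lborel. x \<in> {0<..<l} \<longrightarrow> rep_L2 g x = \<psi> x"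
    "AE x in lborel. x \<notin> {0<..<l} \<longrightarrow> rep_L2 f x = 0" "AE x in lborel. x \<notin> {0<..<l} \<longrightarrow> rep_L2 g x = 0"
    using f g by (auto simp: H1_rep_def L2_space_def)
  then show "AE x in lborel. rep_L2 f x = rep_L2 g x"
  proof eventually_elim
    case (elim x)
    then show ?case using eq[of x] by (cases "x \<in> {0<..<l}") metis+
  qed
qed

lemma H1_rep_of_H1:
  assumes "0 < l" "f \<in> H1 l"
  obtains \<phi> where "H1_rep l f \<phi> (H1_deriv l f)" "\<And>x. x \<in> {0..l} \<Longrightarrow> H1_value l f x = \<phi> x"
  using assms H1_deriv_eq H1_value_eq unfolding H1_def by blast

text \<open>Testing with inner products turns vector identities with fractional coefficients into
  real ones, which \<open>algebra\<close> can settle.\<close>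

lemma inner_ext: "(\<And>v. inner x v = inner y v) \<Longrightarrow> x = (y :: 'a :: real_inner)"
  using vector_eq_rdot by blast

lemma exp_minus_cancel: "exp (- a * x) * (exp (a * x) * r) = (r :: real)"
  by (simp add: exp_minus)

text \<open>The functions \<open>p\<close> and \<open>q\<close> solve p' + s p =
  \<open>mean_part h1 h2 z\<close> and q' + (s + \<kappa>) q = \<open>diff_part z\<close> with value
  0 at x = 0, and \<open>w\<close> returns from these coordinates to the two components. This works
  for every real s, since with zero inflow the equation is an initial value problem in x. The second
  component comes first in the output, so \<open>h2\<close> stands in the first entry.\<close>

lemma exchanger_resolvent:
  fixes h1 h2 s :: real
  assumes l: "0 < l" and h: "0 < h1" "0 < h2" and z: "z \<in> state_space l"
  defines "\<kappa> \<equiv> h1 + h2"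
  defines "p \<equiv> \<lambda>x. exp (- s * x) * weighted_primitive s (mean_part h1 h2 z) x"
    and "q \<equiv> \<lambda>x. exp (- (s + \<kappa>) * x) * weighted_primitive (s + \<kappa>) (diff_part z) x"
  defines "w \<equiv> ((1 / \<kappa>) *\<^sub>R cut_L2 l p + (h1 / \<kappa>) *\<^sub>R cut_L2 l q, (1 / \<kappa>) *\<^sub>R cut_L2 l p + (- h2 / \<kappa>) *\<^sub>R cut_L2 l q)"
  shows "resolvent (dom_A l) (exchanger_op l h1 h2) s z = w"
    and "output_op l (s *\<^sub>R resolvent (dom_A l) (exchanger_op l h1 h2) s z)
      = ((s * p l - h2 * (s * q l)) / \<kappa>, (s * p l + h1 * (s * q l)) / \<kappa>)"
proof -
  have \<kappa>: "\<kappa> > 0" and \<kappa>_eq: "\<kappa> = h1 + h2" using h by (simp_all add: \<kappa>_def)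
  note mem = mean_part_in_L2_space[OF z] diff_part_in_L2_space[OF z]
  have P: "H1_rep l (cut_L2 l p) p (mean_part h1 h2 z - s *\<^sub>R cut_L2 l p)"
    unfolding p_def by (rule H1_rep_linear_ode[OF mem(1)])
  have Q: "H1_rep l (cut_L2 l q) q (diff_part z - (s + \<kappa>) *\<^sub>R cut_L2 l q)"
    unfolding q_def by (rule H1_rep_linear_ode[OF mem(2)])
  note W1 = H1_rep_lincomb[OF P Q, of "1 / \<kappa>" "h1 / \<kappa>"]
  note W2 = H1_rep_lincomb[OF P Q, of "1 / \<kappa>" "- h2 / \<kappa>"]
  have pq0: "p 0 = 0" "q 0 = 0" by (auto simp: p_def q_def weighted_primitive_def)
  have wd: "w \<in> dom_A l"
    using W1 W2 H1_value_eq[OF l W1, of 0] H1_value_eq[OF l W2, of 0] pq0 l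
    by (auto simp: w_def dom_A_def H1_def)
  have iw: "inner (fst w) v = (1 / \<kappa>) * inner (cut_L2 l p) v + h1 / \<kappa> * inner (cut_L2 l q) v"
    "inner (snd w) v = (1 / \<kappa>) * inner (cut_L2 l p) v + - h2 / \<kappa> * inner (cut_L2 l q) v" for v
    by (simp_all add: w_def inner_simps)
  have dw: "H1_deriv l (fst w) = (1 / \<kappa>) *\<^sub>R (mean_part h1 h2 z - s *\<^sub>R cut_L2 l p)
      + (h1 / \<kappa>) *\<^sub>R (diff_part z - (s + \<kappa>) *\<^sub>R cut_L2 l q)"
    "H1_deriv l (snd w) = (1 / \<kappa>) *\<^sub>R (mean_part h1 h2 z - s *\<^sub>R cut_L2 l p)
      + (- h2 / \<kappa>) *\<^sub>R (diff_part z - (s + \<kappa>) *\<^sub>R cut_L2 l q)"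
    using H1_deriv_eq[OF l W1] H1_deriv_eq[OF l W2] by (simp_all only: w_def fst_conv snd_conv)
  have eq: "s *\<^sub>R w - exchanger_op l h1 h2 w = z"
  proof (rule prod_eqI)
    show "fst (s *\<^sub>R w - exchanger_op l h1 h2 w) = fst z"
    proof (rule inner_ext)
      fix v
      show "inner (fst (s *\<^sub>R w - exchanger_op l h1 h2 w)) v = inner (fst z) v"
        by (use \<kappa> in \<open>simp add: exchanger_op_def case_prod_unfold dw iw mean_part_def diff_part_def
             inner_simps divide_simps\<close>) (use \<kappa>_eq in algebra)
    qed
    show "snd (s *\<^sub>R w - exchanger_op l h1 h2 w) = snd z"
    proof (rule inner_ext)
      fix v
      show "inner (snd (s *\<^sub>R w - exchanger_op l h1 h2 w)) v = inner (snd z) v"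
        by (use \<kappa> in \<open>simp add: exchanger_op_def case_prod_unfold dw iw mean_part_def diff_part_def
             inner_simps divide_simps\<close>) (use \<kappa>_eq in algebra)
    qed
  qed
  \<comment> \<open>The integrating factor expresses both decoupled coordinates of any solution by
    the data and the zero inflow.\<close>
  have uniq: "w' = w" if w': "w' \<in> dom_A l" "s *\<^sub>R w' - exchanger_op l h1 h2 w' = z" for w'
  proof -
    obtain f g where w'_eq: "w' = (f, g)" by force
    have fg: "f \<in> H1 l" "g \<in> H1 l" "H1_value l f 0 = 0" "H1_value l g 0 = 0"
      using w'(1) by (auto simp: w'_eq dom_A_def)
    obtain \<phi> where \<phi>: "H1_rep l f \<phi> (H1_deriv l f)" "\<phi> 0 = 0"
      using H1_rep_of_H1[OF l fg(1)] fg(3) l by (metis atLeastAtMost_iff less_imp_le order_refl)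
    obtain \<psi> where \<psi>: "H1_rep l g \<psi> (H1_deriv l g)" "\<psi> 0 = 0"
      using H1_rep_of_H1[OF l fg(2)] fg(4) l by (metis atLeastAtMost_iff less_imp_le order_refl)
    have zeq: "fst z = s *\<^sub>R f - (- H1_deriv l f + h1 *\<^sub>R (g - f))"
      "snd z = s *\<^sub>R g - (- H1_deriv l g + h2 *\<^sub>R (f - g))"
      using w'(2) by (auto simp: w'_eq exchanger_op_def)
    note P' = H1_rep_lincomb[OF \<phi>(1) \<psi>(1), of h2 h1]
    note Q' = H1_rep_lincomb[OF \<phi>(1) \<psi>(1), of 1 "-1"]
    have dP: "h2 *\<^sub>R H1_deriv l f + h1 *\<^sub>R H1_deriv l g + s *\<^sub>R (h2 *\<^sub>R f + h1 *\<^sub>R g) = mean_part h1 h2 z"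
      unfolding mean_part_def zeq by (rule inner_ext) (simp add: inner_simps algebra_simps)
    have dQ: "1 *\<^sub>R H1_deriv l f + (- 1) *\<^sub>R H1_deriv l g + (s + \<kappa>) *\<^sub>R (1 *\<^sub>R f + (- 1) *\<^sub>R g) = diff_part z"
      unfolding diff_part_def zeq \<kappa>_def by (rule inner_ext) (simp add: inner_simps algebra_simps)
    have Peq: "h2 *\<^sub>R f + h1 *\<^sub>R g = cut_L2 l p"
    proof (rule H1_rep_inject[OF P' P])
      fix x assume "x \<in> {0<..<l}"
      then have "exp (s * x) * (h2 * \<phi> x + h1 * \<psi> x) = weighted_primitive s (mean_part h1 h2 z) x"
        using H1_rep_weighted[OF P', of x s, unfolded dP] \<phi>(2) \<psi>(2) by simp
      then have "exp (- s * x) * (exp (s * x) * (h2 * \<phi> x + h1 * \<psi> x)) = p x" by (simp add: p_def)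
      then show "h2 * \<phi> x + h1 * \<psi> x = p x" by (simp only: exp_minus_cancel)
    qed
    have Qeq: "1 *\<^sub>R f + (- 1) *\<^sub>R g = cut_L2 l q"
    proof (rule H1_rep_inject[OF Q' Q])
      fix x assume "x \<in> {0<..<l}"
      then have "exp ((s + \<kappa>) * x) * (1 * \<phi> x + (- 1) * \<psi> x) = weighted_primitive (s + \<kappa>) (diff_part z) x"
        using H1_rep_weighted[OF Q', of x "s + \<kappa>", unfolded dQ] \<phi>(2) \<psi>(2) by simp
      then have "exp (- (s + \<kappa>) * x) * (exp ((s + \<kappa>) * x) * (1 * \<phi> x + (- 1) * \<psi> x)) = q x"
        by (simp add: q_def)
      then show "1 * \<phi> x + (- 1) * \<psi> x = q x"
        by (simp only: exp_minus_cancel)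
    qed
    have "f = (1 / \<kappa>) *\<^sub>R cut_L2 l p + (h1 / \<kappa>) *\<^sub>R cut_L2 l q"
      unfolding Peq[symmetric] Qeq[symmetric]
      by (rule inner_ext) (use \<kappa> in \<open>simp add: inner_simps divide_simps\<close>, use \<kappa>_eq in algebra)
    moreover have "g = (1 / \<kappa>) *\<^sub>R cut_L2 l p + (- h2 / \<kappa>) *\<^sub>R cut_L2 l q"
      unfolding Peq[symmetric] Qeq[symmetric]
      by (rule inner_ext) (use \<kappa> in \<open>simp add: inner_simps divide_simps\<close>, use \<kappa>_eq in algebra)
    ultimately show ?thesis by (simp add: w'_eq w_def)
  qed
  show res: "resolvent (dom_A l) (exchanger_op l h1 h2) s z = w"
    unfolding resolvent_def by (rule the_equality, rule conjI[OF wd eq], erule conjE, rule uniq)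
  have sc: "H1_value l (s *\<^sub>R f) l = s * \<phi> l" if "H1_rep l f \<phi> d" for f \<phi> d
    using H1_value_eq[OF l H1_rep_lincomb[OF that that, of s 0], of l] l by simp
  show "output_op l (s *\<^sub>R resolvent (dom_A l) (exchanger_op l h1 h2) s z)
      = ((s * p l - h2 * (s * q l)) / \<kappa>, (s * p l + h1 * (s * q l)) / \<kappa>)"
  proof -
    have val: "H1_value l (s *\<^sub>R fst w) l = s * (1 / \<kappa> * p l + h1 / \<kappa> * q l)"
      "H1_value l (s *\<^sub>R snd w) l = s * (1 / \<kappa> * p l + - h2 / \<kappa> * q l)"
      using sc[OF W1] sc[OF W2] by (simp_all only: w_def fst_conv snd_conv)
    show ?thesis
      unfolding res using \<kappa> by (simp add: output_op_def case_prod_unfold val field_simps)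
  qed
qed

text \<open>Integration by parts against e^(s y) rewrites the primitive with the moving weight s +
  \<kappa> through the fixed primitive with weight \<kappa>, which brings the expression into the
  form of the Abel mean. Since \<open>D\<close> plays the part of e^(\<kappa> l) f(l), the limit is
  the boundary value f(l).\<close>

lemma resolvent_boundary_limit:
  assumes l: "0 < l"
    and D: "((\<lambda>h. (weighted_primitive \<kappa> f l - weighted_primitive \<kappa> f (l - h)) / h) \<longlongrightarrow> D) (at_right 0)"
  shows "((\<lambda>s. s * (exp (- (s + \<kappa>) * l) * weighted_primitive (s + \<kappa>) f l)) \<longlongrightarrow> exp (- \<kappa> * l) * D) at_top"
proof -
  let ?F = "weighted_primitive \<kappa> f"
  have "s * (exp (- (s + \<kappa>) * l) * weighted_primitive (s + \<kappa>) f l)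
     = exp (- \<kappa> * l) * (s * ?F l - s\<^sup>2 * integral {0..l} (\<lambda>y. exp (- s * (l - y)) * ?F y))" for s
  proof -
    have "((\<lambda>y. s * exp (s * y) * ?F y + exp (s * y) * (exp (\<kappa> * y) * rep_L2 f y)) has_integral
       (exp (s * l) * ?F l - exp (s * 0) * ?F 0)) {0..l}"
      by (rule indefinite_integral_by_parts[where b = l and c = 0])
        (use l in \<open>auto intro!: derivative_eq_intros continuous_intros continuous_mult_rep_L2_absolutely_integrable
          simp: weighted_primitive_def\<close>)
    moreover have "((\<lambda>y. s * exp (s * y) * ?F y) has_integral s * exp (s * l) * integral {0..l} (\<lambda>y. exp (- s * (l - y)) * ?F y)) {0..l}"
    proof -
      have "((\<lambda>y. s * exp (s * l) * (exp (- s * (l - y)) * ?F y)) has_integral s * exp (s * l) * integral {0..l} (\<lambda>y. exp (- s * (l - y)) * ?F y)) {0..l}"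
        by (intro has_integral_mult_right integrable_integral integrable_continuous_interval continuous_intros
          weighted_primitive_continuous)
      also have "(\<lambda>y. s * exp (s * l) * (exp (- s * (l - y)) * ?F y)) = (\<lambda>y. s * exp (s * y) * ?F y)"
      proof
        fix y
        have "s * exp (s * l) * (exp (- s * (l - y)) * ?F y) = s * (exp (s * l) * exp (- s * (l - y))) * ?F y"
          by (simp only: mult_ac)
        also have "exp (s * l) * exp (- s * (l - y)) = exp (s * y)"
          by (simp add: right_diff_distrib flip: exp_add)
        finally show "s * exp (s * l) * (exp (- s * (l - y)) * ?F y) = s * exp (s * y) * ?F y" .
      qed
      finally show ?thesis .
    qed
    ultimately have "((\<lambda>y. s * exp (s * y) * ?F y + exp (s * y) * (exp (\<kappa> * y) * rep_L2 f y) - s * exp (s * y) * ?F y) has_integral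
       (exp (s * l) * ?F l - exp (s * 0) * ?F 0 - s * exp (s * l) * integral {0..l} (\<lambda>y. exp (- s * (l - y)) * ?F y))) {0..l}"
      by (rule has_integral_diff)
    also have "(\<lambda>y. s * exp (s * y) * ?F y + exp (s * y) * (exp (\<kappa> * y) * rep_L2 f y) - s * exp (s * y) * ?F y)
       = (\<lambda>y. exp ((s + \<kappa>) * y) * rep_L2 f y)"
      by (simp add: distrib_right exp_add mult.assoc)
    finally have "weighted_primitive (s + \<kappa>) f l
       = exp (s * l) * ?F l - s * exp (s * l) * integral {0..l} (\<lambda>y. exp (- s * (l - y)) * ?F y)"
      unfolding weighted_primitive_def[of "s + \<kappa>"] by (simp add: integral_unique weighted_primitive_def)
    also have "\<dots> = exp (s * l) * (?F l - s * integral {0..l} (\<lambda>y. exp (- s * (l - y)) * ?F y))"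
      by (simp add: algebra_simps)
    finally have *: "weighted_primitive (s + \<kappa>) f l
       = exp (s * l) * (?F l - s * integral {0..l} (\<lambda>y. exp (- s * (l - y)) * ?F y))" .
    have "exp (- (s + \<kappa>) * l) * exp (s * l) = exp (- \<kappa> * l)"
      by (simp add: algebra_simps flip: exp_add)
    then have c: "s * (exp (- (s + \<kappa>) * l) * (exp (s * l) * R)) = exp (- \<kappa> * l) * (s * R)" for R
      by (metis (no_types, opaque_lifting) mult.assoc mult.left_commute)
    show ?thesis unfolding * c by (simp add: right_diff_distrib power2_eq_square mult.assoc)
  qed
  then show ?thesis
    using tendsto_mult[OF tendsto_const abelian_mean_left_derivative[OF l weighted_primitive_continuous D]] by presburger
qed

text \<open>If x = l is a one-sided Lebesgue point, the boundary values of the two coordinates are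
  \<open>p\<close> and e^(-(h1 + h2) l) \<open>q\<close>. Uniqueness of limits then identifies the
  value of the \<Lambda>-extension, in swapped order of the components.\<close>

lemma C_Lambda_eq_boundary_value:
  fixes h1 h2 :: real
  assumes l: "0 < l" and h: "0 < h1" "0 < h2" and z: "z \<in> state_space l"
    and C: "C_Lambda l h1 h2 z c1 c2"
    and P: "((\<lambda>h. (weighted_primitive 0 (mean_part h1 h2 z) l - weighted_primitive 0 (mean_part h1 h2 z) (l - h)) / h)
       \<longlongrightarrow> p) (at_right 0)"
    and Q: "((\<lambda>h. (weighted_primitive (h1 + h2) (diff_part z) l - weighted_primitive (h1 + h2) (diff_part z) (l - h)) / h)
       \<longlongrightarrow> q) (at_right 0)"
  shows "c1 = (p - h2 * (exp (- (h1 + h2) * l) * q)) / (h1 + h2)"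
    and "c2 = (p + h1 * (exp (- (h1 + h2) * l) * q)) / (h1 + h2)"
proof -
  let ?p = "\<lambda>s. s * (exp (- s * l) * weighted_primitive s (mean_part h1 h2 z) l)"
  let ?q = "\<lambda>s. s * (exp (- (s + (h1 + h2)) * l) * weighted_primitive (s + (h1 + h2)) (diff_part z) l)"
  let ?q' = "exp (- (h1 + h2) * l) * q"
  have p: "(?p \<longlongrightarrow> p) at_top"
    using resolvent_boundary_limit[OF l P] by simp
  have q: "(?q \<longlongrightarrow> ?q') at_top"
    by (rule resolvent_boundary_limit[OF l Q])
  have "((\<lambda>s. ((?p s - h2 * ?q s) / (h1 + h2), (?p s + h1 * ?q s) / (h1 + h2)))
     \<longlongrightarrow> ((p - h2 * ?q') / (h1 + h2), (p + h1 * ?q') / (h1 + h2))) at_top"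
    by (intro tendsto_intros p q) (use h in auto)
  moreover have "((\<lambda>s. ((?p s - h2 * ?q s) / (h1 + h2), (?p s + h1 * ?q s) / (h1 + h2))) \<longlongrightarrow> (c1, c2)) at_top"
    using C unfolding C_Lambda_def exchanger_resolvent(2)[OF l h z] by simp
  ultimately have "((p - h2 * ?q') / (h1 + h2), (p + h1 * ?q') / (h1 + h2)) = (c1, c2)"
    by (rule tendsto_unique[OF trivial_limit_at_top_linorder])
  then show "c1 = (p - h2 * ?q') / (h1 + h2)" "c2 = (p + h1 * ?q') / (h1 + h2)" by auto
qed

section \<open>Boundary traces of mild solutions\<close>

lemma AE_lebesgue_shift:
  assumes "AE t in lebesgue. P t"
  shows "AE t in lebesgue. P (t + c :: real)"
proof -
  obtain N where N: "negligible N" "{t. \<not> P t} \<subseteq> N"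
    using assms by (auto simp: eventually_ae_filter_negligible)
  have "{t. \<not> P (t + c)} \<subseteq> (+) (- c) ` N"
    using N(2) by (force simp: image_iff intro: bexI[of _ "_ + c"])
  then show ?thesis
    using negligible_translation[OF N(1), of "- c"] by (auto simp: eventually_ae_filter_negligible)
qed

text \<open>A gauge-integral counterpart of \<open>L2_loc\<close> on the whole line, needed because
  traces live at negative times too. Measurability and absolute integrability follow from the two
  gauge integrals.\<close>

definition locally_square_integrable :: "(real \<Rightarrow> real) \<Rightarrow> bool" where
  "locally_square_integrable v \<longleftrightarrow> (\<forall>a b. v integrable_on {a..b} \<and> (\<lambda>s. (v s)\<^sup>2) integrable_on {a..b})"

lemma locally_square_integrable_imp:
  assumes "locally_square_integrable v"
  shows "v integrable_on {a..b}" "(\<lambda>s. (v s)\<^sup>2) integrable_on {a..b}" "v absolutely_integrable_on {a..b}"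
    "v \<in> borel_measurable (lebesgue_on {a..b})"
proof -
  show 1: "v integrable_on {a..b}" and 2: "(\<lambda>s. (v s)\<^sup>2) integrable_on {a..b}"
    using assms by (auto simp: locally_square_integrable_def)
  show "v \<in> borel_measurable (lebesgue_on {a..b})" by (rule integrable_imp_measurable[OF 1])
  then show "v absolutely_integrable_on {a..b}" by (rule square_absolutely_integrable_imp[OF _ 2])
qed

lemma locally_square_integrable_lincomb:
  assumes v: "locally_square_integrable v" and w: "locally_square_integrable w"
  shows "locally_square_integrable (\<lambda>s. a * v s + b * w s)"
  unfolding locally_square_integrable_def
proof (intro allI conjI)
  fix c d
  note v' = locally_square_integrable_imp[OF v, of c d] and w' = locally_square_integrable_imp[OF w, of c d]
  show "(\<lambda>s. a * v s + b * w s) integrable_on {c..d}"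
    by (intro integrable_add integrable_on_mult_right v' w')
  have "(\<lambda>s. v s * w s) integrable_on {c..d}"
  proof (rule measurable_bounded_by_integrable_imp_integrable)
    show "(\<lambda>s. v s * w s) \<in> borel_measurable (lebesgue_on {c..d})"
      by (intro borel_measurable_times v' w')
    show "(\<lambda>s. (v s)\<^sup>2 + (w s)\<^sup>2) integrable_on {c..d}" by (intro integrable_add v' w')
    show "norm (v s * w s) \<le> (v s)\<^sup>2 + (w s)\<^sup>2" for s
      using sum_squares_bound[of "\<bar>v s\<bar>" "\<bar>w s\<bar>"] by (simp add: abs_mult mult.assoc) (smt (verit) mult_nonneg_nonneg abs_ge_zero)
  qed simp
  then have "(\<lambda>s. a\<^sup>2 * (v s)\<^sup>2 + b\<^sup>2 * (w s)\<^sup>2 + 2 * a * b * (v s * w s)) integrable_on {c..d}"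
    by (intro integrable_add integrable_on_mult_right v' w')
  then show "(\<lambda>s. (a * v s + b * w s)\<^sup>2) integrable_on {c..d}"
    by (simp add: power2_sum power_mult_distrib mult_ac)
qed

lemma locally_square_integrable_mult_continuous:
  assumes v: "locally_square_integrable v" and w: "continuous_on UNIV w"
  shows "locally_square_integrable (\<lambda>s. w s * v s)"
  unfolding locally_square_integrable_def
proof (intro allI conjI)
  fix c d :: real
  have prod: "(\<lambda>s. g s * h s) integrable_on {c..d}"
    if g: "continuous_on UNIV g" and h: "h absolutely_integrable_on {c..d}" for g h :: "real \<Rightarrow> real"
  proof -
    have g': "continuous_on {c..d} g" by (rule continuous_on_subset[OF g]) simp
    have "(\<lambda>s. g s * h s) absolutely_integrable_on {c..d}"
    proof (rule absolutely_integrable_bounded_measurable_product_real[OF _ _ _ h])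
      show "g \<in> borel_measurable (lebesgue_on {c..d})"
        by (rule continuous_imp_measurable_on_sets_lebesgue[OF g']) simp
      show "bounded (g ` {c..d})"
        by (intro compact_imp_bounded compact_continuous_image g' compact_Icc)
    qed simp
    then show ?thesis by (rule set_lebesgue_integral_eq_integral(1))
  qed
  show "(\<lambda>s. w s * v s) integrable_on {c..d}"
    by (rule prod[OF w locally_square_integrable_imp(3)[OF v]])
  have "(\<lambda>s. (v s)\<^sup>2) absolutely_integrable_on {c..d}"
    using locally_square_integrable_imp(2)[OF v] by (intro nonnegative_absolutely_integrable_1) auto
  then have "(\<lambda>s. (w s)\<^sup>2 * (v s)\<^sup>2) integrable_on {c..d}"
    by (rule prod[rotated]) (intro continuous_intros w)
  then show "(\<lambda>s. (w s * v s)\<^sup>2) integrable_on {c..d}" by (simp add: power_mult_distrib)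
qed

lemma integrable_on_piecewise:
  fixes f g :: "real \<Rightarrow> real"
  assumes f: "\<And>a b. b \<le> c \<Longrightarrow> f integrable_on {a..b}" and g: "\<And>a b. c \<le> a \<Longrightarrow> g integrable_on {a..b}"
  shows "(\<lambda>s. if s \<le> c then f s else g s) integrable_on {a..b}"
proof -
  have 1: "(\<lambda>s. if s \<le> c then f s else g s) integrable_on {a..b}" if "b \<le> c" for a b
    by (rule integrable_eq[OF f[OF that]]) (use that in auto)
  have 2: "(\<lambda>s. if s \<le> c then f s else g s) integrable_on {a..b}" if "c \<le> a" for a b
    by (rule integrable_spike[OF g[OF that, of b], of "{c}"]) (use that in auto)
  show ?thesis
  proof (cases "a \<le> c \<and> c \<le> b")
    case True
    then show ?thesis using Henstock_Kurzweil_Integration.integrable_combine[OF _ _ 1 2, of a c b] by auto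
  qed (use 1 2 in force)
qed

lemma locally_square_integrable_reflected_rep_L2: "locally_square_integrable (\<lambda>s. rep_L2 f (- s))"
  unfolding locally_square_integrable_def
proof (intro allI conjI)
  fix a b
  have r: "(\<lambda>s. g (- s)) integrable_on {a..b}" if "g integrable_on {- b..- a}" for g :: "real \<Rightarrow> real"
    using that has_integral_reflect_shift[of g _ 0 b a] by (auto simp: integrable_on_def)
  show "(\<lambda>s. rep_L2 f (- s)) integrable_on {a..b}"
    by (intro r set_lebesgue_integral_eq_integral(1) rep_L2_absolutely_integrable)
  show "(\<lambda>s. (rep_L2 f (- s))\<^sup>2) integrable_on {a..b}"
    using r[OF rep_L2_square_integrable_on] .
qed

lemma L2_loc_integrable:
  assumes "L2_loc J u" "{a..b} \<subseteq> J"
  shows "u integrable_on {a..b}" "(\<lambda>s. (u s)\<^sup>2) integrable_on {a..b}"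
proof -
  have m: "u \<in> borel_measurable (lebesgue_on {a..b})" "integrable (lebesgue_on {a..b}) (\<lambda>t. (u t)\<^sup>2)"
    using assms by (auto simp: L2_loc_def)
  show 2: "(\<lambda>s. (u s)\<^sup>2) integrable_on {a..b}" by (rule integrable_on_lebesgue_on[OF m(2)]) simp
  show "u integrable_on {a..b}"
    using square_absolutely_integrable_imp[OF m(1) 2] by (rule set_lebesgue_integral_eq_integral(1))
qed

text \<open>The value at time \<open>s\<close> and \<open>x = 0\<close> on the characteristic through \<open>(s, 0)\<close>: for \<open>s \<le> 0\<close> it is
  obtained by transporting the initial state backwards in time, that is, the state at time \<open>t\<close>
  is \<open>e\<^bsup>Hx\<^esup> (v1, v2)(t - x)\<close>, where \<open>H\<close> is the exchange matrix.\<close>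

definition inflow1 :: "real \<Rightarrow> real \<Rightarrow> L2 \<times> L2 \<Rightarrow> (real \<Rightarrow> real) \<Rightarrow> real \<Rightarrow> real" where
  "inflow1 h1 h2 z0 u s = (if s \<le> 0 then
     (rep_L2 (mean_part h1 h2 z0) (- s) + h1 * (exp (- (h1 + h2) * s) * rep_L2 (diff_part z0) (- s))) / (h1 + h2)
     else u s)"

definition inflow2 :: "real \<Rightarrow> real \<Rightarrow> L2 \<times> L2 \<Rightarrow> (real \<Rightarrow> real) \<Rightarrow> real \<Rightarrow> real" where
  "inflow2 h1 h2 z0 u s = (if s \<le> 0 then
     (rep_L2 (mean_part h1 h2 z0) (- s) - h2 * (exp (- (h1 + h2) * s) * rep_L2 (diff_part z0) (- s))) / (h1 + h2)
     else u s)"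

text \<open>The relation z(x) = e^(Hx) (v1, v2)(t - x) in the decoupled coordinates, stated through
  primitives so that it holds for every x. It sees the trace only on [t - l, t].\<close>

definition boundary_trace ::
    "real \<Rightarrow> real \<Rightarrow> real \<Rightarrow> L2 \<times> L2 \<Rightarrow> real \<Rightarrow> (real \<Rightarrow> real) \<Rightarrow> (real \<Rightarrow> real) \<Rightarrow> bool" where
  "boundary_trace l h1 h2 z t v1 v2 \<longleftrightarrow> (\<forall>x\<in>{0..l}.
     weighted_primitive 0 (mean_part h1 h2 z) x = integral {t - x..t} (\<lambda>s. h2 * v1 s + h1 * v2 s) \<and>
     weighted_primitive (h1 + h2) (diff_part z) x = integral {t - x..t} (\<lambda>s. v1 s - v2 s))"

lemma inflow_parts:
  assumes "0 < h1" "0 < h2" "s \<le> 0"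
  shows "h2 * inflow1 h1 h2 z0 u s + h1 * inflow2 h1 h2 z0 u' s = rep_L2 (mean_part h1 h2 z0) (- s)"
    and "inflow1 h1 h2 z0 u s - inflow2 h1 h2 z0 u' s = exp (- (h1 + h2) * s) * rep_L2 (diff_part z0) (- s)"
proof -
  have *: "h2 * ((p + h1 * q) / (h1 + h2)) + h1 * ((p - h2 * q) / (h1 + h2)) = p"
    "(p + h1 * q) / (h1 + h2) - (p - h2 * q) / (h1 + h2) = q" for p q
    using assms by (simp_all add: divide_simps) (simp_all add: algebra_simps)
  show "h2 * inflow1 h1 h2 z0 u s + h1 * inflow2 h1 h2 z0 u' s = rep_L2 (mean_part h1 h2 z0) (- s)"
    "inflow1 h1 h2 z0 u s - inflow2 h1 h2 z0 u' s = exp (- (h1 + h2) * s) * rep_L2 (diff_part z0) (- s)"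
    using assms(3) by (simp_all only: inflow1_def inflow2_def if_True *)
qed

lemma locally_square_integrable_inflow:
  assumes u: "L2_loc {0..} u"
  shows "locally_square_integrable (inflow1 h1 h2 z0 u)" "locally_square_integrable (inflow2 h1 h2 z0 u)"
proof -
  have *: "locally_square_integrable (\<lambda>s. if s \<le> 0 then v s else u s)" if "locally_square_integrable v" for v
    unfolding locally_square_integrable_def
  proof (intro allI conjI)
    fix a b
    have u': "u integrable_on {a..b}" "(\<lambda>s. (u s)\<^sup>2) integrable_on {a..b}" if "0 \<le> a" for a b
      using L2_loc_integrable[OF u, of a b] that by auto
    show "(\<lambda>s. if s \<le> 0 then v s else u s) integrable_on {a..b}"
      by (intro integrable_on_piecewise locally_square_integrable_imp that u')
    have "(\<lambda>s. if s \<le> 0 then (v s)\<^sup>2 else (u s)\<^sup>2) integrable_on {a..b}"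
      by (intro integrable_on_piecewise locally_square_integrable_imp that u')
    also have "(\<lambda>s. if s \<le> 0 then (v s)\<^sup>2 else (u s)\<^sup>2) = (\<lambda>s. (if s \<le> 0 then v s else u s)\<^sup>2)" by auto
    finally show "(\<lambda>s. (if s \<le> 0 then v s else u s)\<^sup>2) integrable_on {a..b}" .
  qed
  have e: "locally_square_integrable (\<lambda>s. exp (- (h1 + h2) * s) * rep_L2 (diff_part z0) (- s))"
    by (intro locally_square_integrable_mult_continuous locally_square_integrable_reflected_rep_L2 continuous_intros)
  have "locally_square_integrable (\<lambda>s. 1 / (h1 + h2) * rep_L2 (mean_part h1 h2 z0) (- s)
     + c / (h1 + h2) * (exp (- (h1 + h2) * s) * rep_L2 (diff_part z0) (- s)))" for c
    by (rule locally_square_integrable_lincomb[OF locally_square_integrable_reflected_rep_L2 e])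
  from *[OF this[of h1]] *[OF this[of "- h2"]]
  show "locally_square_integrable (inflow1 h1 h2 z0 u)" "locally_square_integrable (inflow2 h1 h2 z0 u)"
    by (simp_all add: inflow1_def[abs_def] inflow2_def[abs_def] add_divide_distrib diff_divide_distrib cong: if_cong)
qed

lemma boundary_trace_inflow:
  assumes h: "0 < h1" "0 < h2"
  shows "boundary_trace l h1 h2 z0 0 (inflow1 h1 h2 z0 u1) (inflow2 h1 h2 z0 u2)"
  unfolding boundary_trace_def
proof (intro ballI conjI)
  fix x
  let ?v1 = "inflow1 h1 h2 z0 u1" and ?v2 = "inflow2 h1 h2 z0 u2"
  have "integral {0 - x..0} (\<lambda>s. h2 * ?v1 s + h1 * ?v2 s) = integral {0..x} (\<lambda>y. h2 * ?v1 (0 - y) + h1 * ?v2 (0 - y))"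
    using integral_reflect_shift[of 0 x "\<lambda>s. h2 * ?v1 s + h1 * ?v2 s" 0] by simp
  also have "\<dots> = weighted_primitive 0 (mean_part h1 h2 z0) x"
    unfolding weighted_primitive_def by (rule integral_cong) (simp add: inflow_parts(1)[OF h])
  finally show "weighted_primitive 0 (mean_part h1 h2 z0) x = integral {0 - x..0} (\<lambda>s. h2 * ?v1 s + h1 * ?v2 s)" ..
  have "integral {0 - x..0} (\<lambda>s. ?v1 s - ?v2 s) = integral {0..x} (\<lambda>y. ?v1 (0 - y) - ?v2 (0 - y))"
    using integral_reflect_shift[of 0 x "\<lambda>s. ?v1 s - ?v2 s" 0] by simp
  also have "\<dots> = weighted_primitive (h1 + h2) (diff_part z0) x"
    unfolding weighted_primitive_def by (rule integral_cong) (simp add: inflow_parts(2)[OF h] algebra_simps)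
  finally show "weighted_primitive (h1 + h2) (diff_part z0) x = integral {0 - x..0} (\<lambda>s. ?v1 s - ?v2 s)" ..
qed

text \<open>The trace is carried from time \<open>a\<close> to all later times. The plant and the
  observer use this with a = 0; the predictor uses it with a = t - \<tau>, where its initial trace
  comes from the observer.\<close>

lemma mild_solution_boundary_trace:
  assumes l: "0 < l" and h: "0 < h1" "0 < h2" and ab: "a \<le> b" "{a..b} \<subseteq> J"
    and mild: "mild_solution l h1 h2 a J z0 u1 u2 z"
    and v: "v1 integrable_on {a - l..b}" "v2 integrable_on {a - l..b}"
    and u: "\<And>s. a < s \<Longrightarrow> s \<le> b \<Longrightarrow> v1 s = u1 s \<and> v2 s = u2 s"
    and init: "boundary_trace l h1 h2 z0 a v1 v2"
    and t: "t \<in> {a..b}"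
  shows "boundary_trace l h1 h2 (z t) t v1 v2"
proof -
  have za: "z a = z0" and zc: "continuous_on {a..b} z"
    using mild ab by (auto simp: mild_solution_def intro: continuous_on_subset)
  have W: "\<exists>W1 W2 \<phi>1 \<phi>2 d1 d2. H1_rep l W1 \<phi>1 d1 \<and> H1_rep l W2 \<phi>2 d2 \<and> (z has_integral (W1, W2)) {a..t} \<and>
      fst (z t) = fst (z a) + (- d1 + h1 *\<^sub>R (W2 - W1)) \<and> snd (z t) = snd (z a) + (- d2 + h2 *\<^sub>R (W1 - W2)) \<and>
      \<phi>1 0 = integral {a..t} v1 \<and> \<phi>2 0 = integral {a..t} v2" if t: "t \<in> {a..b}" for t
  proof -
    have tJ: "t \<in> J" using t ab by auto
    from mild tJ obtain W1 W2 where W: "W1 \<in> H1 l" "W2 \<in> H1 l" "(z has_integral (W1, W2)) {a..t}"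
        "z t - z0 = exchanger_op l h1 h2 (W1, W2)"
        "(u1 has_integral H1_value l W1 0) {a..t}" "(u2 has_integral H1_value l W2 0) {a..t}"
      unfolding mild_solution_def by blast
    obtain \<phi>1 where \<phi>1: "H1_rep l W1 \<phi>1 (H1_deriv l W1)" "H1_value l W1 0 = \<phi>1 0"
      using H1_rep_of_H1[OF l W(1)] l by (metis atLeastAtMost_iff less_imp_le order_refl)
    obtain \<phi>2 where \<phi>2: "H1_rep l W2 \<phi>2 (H1_deriv l W2)" "H1_value l W2 0 = \<phi>2 0"
      using H1_rep_of_H1[OF l W(2)] l by (metis atLeastAtMost_iff less_imp_le order_refl)
    have "(v1 has_integral \<phi>1 0) {a..t}"
      \<comment> \<open>At the single time \<open>a\<close> the trace still belongs to the initial
        state and may differ from the input.\<close>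
      by (rule has_integral_spike[OF _ _ W(5)[unfolded \<phi>1(2)], of "{a}"]) (use u t in auto)
    moreover have "(v2 has_integral \<phi>2 0) {a..t}"
      by (rule has_integral_spike[OF _ _ W(6)[unfolded \<phi>2(2)], of "{a}"]) (use u t in auto)
    ultimately have "\<phi>1 0 = integral {a..t} v1" "\<phi>2 0 = integral {a..t} v2"
      by (simp_all add: integral_unique)
    moreover have "fst (z t) = fst (z a) + (- H1_deriv l W1 + h1 *\<^sub>R (W2 - W1))"
      "snd (z t) = snd (z a) + (- H1_deriv l W2 + h2 *\<^sub>R (W1 - W2))"
      using arg_cong[OF W(4), of fst] arg_cong[OF W(4), of snd] za by (auto simp: exchanger_op_def algebra_simps)
    ultimately show ?thesis using \<phi>1(1) \<phi>2(1) W(3) by blast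
  qed
  have vi: "v1 integrable_on {a..t}" "v2 integrable_on {a..t}" if "t \<in> {a..b}" for t
    using integrable_on_subinterval[OF v(1), of a t] integrable_on_subinterval[OF v(2), of a t] that l by auto
  have lin: "bounded_linear (\<lambda>z. c *\<^sub>R fst z + d *\<^sub>R snd z)" for c d :: real
    by (intro bounded_linear_add bounded_linear_compose[OF bounded_linear_scaleR_right]
      bounded_linear_fst bounded_linear_snd)
  have init': "weighted_primitive 0 (mean_part h1 h2 (z a)) x = integral {a - x..a} (\<lambda>s. h2 * v1 s + h1 * v2 s)"
    "weighted_primitive (h1 + h2) (diff_part (z a)) x = integral {a - x..a} (\<lambda>s. v1 s - v2 s)" if "x \<in> {0..l}" for x
    using init that by (auto simp: boundary_trace_def za)
  show ?thesis
    unfolding boundary_trace_def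
  proof (intro ballI conjI)
    fix x assume x: "x \<in> {0..l}"
    show "weighted_primitive 0 (mean_part h1 h2 (z t)) x = integral {t - x..t} (\<lambda>s. h2 * v1 s + h1 * v2 s)"
    proof (rule transport_mild_solution_primitive[where z = "\<lambda>t. mean_part h1 h2 (z t)", OF l order_refl ab(1) _ _ _ init'(1) t x])
      show "continuous_on {a..b} (\<lambda>t. mean_part h1 h2 (z t))"
        unfolding mean_part_def by (intro continuous_intros zc)
      show "(\<lambda>s. h2 * v1 s + h1 * v2 s) integrable_on {a - l..b}"
        by (intro integrable_add integrable_on_mult_right v)
      fix t assume t: "t \<in> {a..b}"
      then obtain W1 W2 \<phi>1 \<phi>2 d1 d2 where W: "H1_rep l W1 \<phi>1 d1" "H1_rep l W2 \<phi>2 d2" "(z has_integral (W1, W2)) {a..t}"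
        and z: "fst (z t) = fst (z a) + (- d1 + h1 *\<^sub>R (W2 - W1))" "snd (z t) = snd (z a) + (- d2 + h2 *\<^sub>R (W1 - W2))"
        and \<phi>: "\<phi>1 0 = integral {a..t} v1" "\<phi>2 0 = integral {a..t} v2" using W by blast
      show "\<exists>W \<phi> d. H1_rep l W \<phi> d \<and> ((\<lambda>t. mean_part h1 h2 (z t)) has_integral W) {a..t} \<and>
          mean_part h1 h2 (z t) - mean_part h1 h2 (z a) = - d - 0 *\<^sub>R W \<and>
          \<phi> 0 = integral {a..t} (\<lambda>s. h2 * v1 s + h1 * v2 s)"
      proof (intro exI conjI)
        show "H1_rep l (h2 *\<^sub>R W1 + h1 *\<^sub>R W2) (\<lambda>x. h2 * \<phi>1 x + h1 * \<phi>2 x) (h2 *\<^sub>R d1 + h1 *\<^sub>R d2)"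
          by (rule H1_rep_lincomb[OF W(1,2)])
        show "((\<lambda>t. mean_part h1 h2 (z t)) has_integral (h2 *\<^sub>R W1 + h1 *\<^sub>R W2)) {a..t}"
          using has_integral_linear[OF W(3) lin[of h2 h1]] by (simp add: mean_part_def o_def)
        show "mean_part h1 h2 (z t) - mean_part h1 h2 (z a) = - (h2 *\<^sub>R d1 + h1 *\<^sub>R d2) - 0 *\<^sub>R (h2 *\<^sub>R W1 + h1 *\<^sub>R W2)"
          by (rule inner_ext) (simp add: mean_part_def z inner_simps algebra_simps)
        show "h2 * \<phi>1 0 + h1 * \<phi>2 0 = integral {a..t} (\<lambda>s. h2 * v1 s + h1 * v2 s)"
          using vi[OF t] \<phi> by (simp add: integral_add integrable_on_mult_right)
      qed
    qed
    show "weighted_primitive (h1 + h2) (diff_part (z t)) x = integral {t - x..t} (\<lambda>s. v1 s - v2 s)"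
    proof (rule transport_mild_solution_primitive[where z = "\<lambda>t. diff_part (z t)", OF l _ ab(1) _ _ _ init'(2) t x])
      show "0 \<le> h1 + h2" using h by simp
      show "continuous_on {a..b} (\<lambda>t. diff_part (z t))"
        unfolding diff_part_def by (intro continuous_intros zc)
      show "(\<lambda>s. v1 s - v2 s) integrable_on {a - l..b}" by (intro integrable_diff v)
      fix t assume t: "t \<in> {a..b}"
      then obtain W1 W2 \<phi>1 \<phi>2 d1 d2 where W: "H1_rep l W1 \<phi>1 d1" "H1_rep l W2 \<phi>2 d2" "(z has_integral (W1, W2)) {a..t}"
        and z: "fst (z t) = fst (z a) + (- d1 + h1 *\<^sub>R (W2 - W1))" "snd (z t) = snd (z a) + (- d2 + h2 *\<^sub>R (W1 - W2))"
        and \<phi>: "\<phi>1 0 = integral {a..t} v1" "\<phi>2 0 = integral {a..t} v2" using W by blast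
      show "\<exists>W \<phi> d. H1_rep l W \<phi> d \<and> ((\<lambda>t. diff_part (z t)) has_integral W) {a..t} \<and>
          diff_part (z t) - diff_part (z a) = - d - (h1 + h2) *\<^sub>R W \<and>
          \<phi> 0 = integral {a..t} (\<lambda>s. v1 s - v2 s)"
      proof (intro exI conjI)
        show "H1_rep l (1 *\<^sub>R W1 + (- 1) *\<^sub>R W2) (\<lambda>x. 1 * \<phi>1 x + (- 1) * \<phi>2 x) (1 *\<^sub>R d1 + (- 1) *\<^sub>R d2)"
          by (rule H1_rep_lincomb[OF W(1,2)])
        show "((\<lambda>t. diff_part (z t)) has_integral (1 *\<^sub>R W1 + (- 1) *\<^sub>R W2)) {a..t}"
          using has_integral_linear[OF W(3) lin[of 1 "-1"]] by (simp add: diff_part_def o_def)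
        show "diff_part (z t) - diff_part (z a) = - (1 *\<^sub>R d1 + (- 1) *\<^sub>R d2) - (h1 + h2) *\<^sub>R (1 *\<^sub>R W1 + (- 1) *\<^sub>R W2)"
          by (rule inner_ext) (simp add: diff_part_def z inner_simps algebra_simps)
        show "1 * \<phi>1 0 + (- 1) * \<phi>2 0 = integral {a..t} (\<lambda>s. v1 s - v2 s)"
          using vi[OF t] \<phi> by (simp add: integral_diff)
      qed
    qed
  qed
qed

text \<open>\<open>outflow2\<close> and \<open>outflow1\<close> are the first and the second
  component of e^(Hl) (a1, a2); the numbering is that of the outputs, so it is swapped.\<close>

definition outflow1 :: "real \<Rightarrow> real \<Rightarrow> real \<Rightarrow> real \<Rightarrow> real \<Rightarrow> real" where
  "outflow1 l h1 h2 a1 a2 = (h2 * a1 + h1 * a2 - h2 * (exp (- (h1 + h2) * l) * (a1 - a2))) / (h1 + h2)"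

definition outflow2 :: "real \<Rightarrow> real \<Rightarrow> real \<Rightarrow> real \<Rightarrow> real \<Rightarrow> real" where
  "outflow2 l h1 h2 a1 a2 = (h2 * a1 + h1 * a2 + h1 * (exp (- (h1 + h2) * l) * (a1 - a2))) / (h1 + h2)"

text \<open>The substitution x = t - s reverses orientation: a left difference quotient at x = l of
  a primitive of the state is a right difference quotient at time t - l of the integrated trace.
  Thus \<open>a1\<close> and \<open>a2\<close> are the values of the trace when t - l is a right
  Lebesgue point.\<close>

lemma C_Lambda_boundary_trace:
  assumes l: "0 < l" and h: "0 < h1" "0 < h2" and z: "z \<in> state_space l"
    and tr: "boundary_trace l h1 h2 z t v1 v2"
    and v: "v1 integrable_on {t - l..t}" "v2 integrable_on {t - l..t}"
    and a1: "((\<lambda>h. integral {t - l..t - l + h} v1 / h) \<longlongrightarrow> a1) (at_right 0)"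
    and a2: "((\<lambda>h. integral {t - l..t - l + h} v2 / h) \<longlongrightarrow> a2) (at_right 0)"
    and C: "C_Lambda l h1 h2 z c1 c2"
  shows "c1 = outflow1 l h1 h2 a1 a2" "c2 = outflow2 l h1 h2 a1 a2"
proof -
  have *: "((\<lambda>h. (F l - F (l - h)) / h) \<longlongrightarrow> c * a1 + d * a2) (at_right 0)"
    if F: "\<And>x. x \<in> {0..l} \<Longrightarrow> F x = integral {t - x..t} (\<lambda>s. c * v1 s + d * v2 s)" for F c d
  proof -
    have "((\<lambda>h. c * (integral {t - l..t - l + h} v1 / h) + d * (integral {t - l..t - l + h} v2 / h)) \<longlongrightarrow> c * a1 + d * a2) (at_right 0)"
      by (intro tendsto_intros a1 a2)
    moreover have "\<forall>\<^sub>F h in at_right 0. c * (integral {t - l..t - l + h} v1 / h) + d * (integral {t - l..t - l + h} v2 / h)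
        = (F l - F (l - h)) / h"
    proof -
      have "c * (integral {t - l..t - l + h} v1 / h) + d * (integral {t - l..t - l + h} v2 / h)
        = (F l - F (l - h)) / h" if hh: "0 < h" "h < l" for h
      proof -
        have i: "(\<lambda>s. c * v1 s + d * v2 s) integrable_on {t - l..t}"
          by (intro integrable_add integrable_on_mult_right v)
        have vs: "v1 integrable_on {t - l..t - l + h}" "v2 integrable_on {t - l..t - l + h}"
          using integrable_on_subinterval[OF v(1), of "t - l" "t - l + h"]
            integrable_on_subinterval[OF v(2), of "t - l" "t - l + h"] hh by auto
        have "integral {t - l..t - l + h} (\<lambda>s. c * v1 s + d * v2 s) + integral {t - l + h..t} (\<lambda>s. c * v1 s + d * v2 s)
          = integral {t - l..t} (\<lambda>s. c * v1 s + d * v2 s)"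
          by (rule Henstock_Kurzweil_Integration.integral_combine) (use hh i in auto)
        moreover have "F l = integral {t - l..t} (\<lambda>s. c * v1 s + d * v2 s)"
          by (rule F) (use l in auto)
        moreover have "F (l - h) = integral {t - l + h..t} (\<lambda>s. c * v1 s + d * v2 s)"
          using F[of "l - h"] hh by (simp add: algebra_simps)
        moreover have "integral {t - l..t - l + h} (\<lambda>s. c * v1 s + d * v2 s)
            = c * integral {t - l..t - l + h} v1 + d * integral {t - l..t - l + h} v2"
          by (simp add: integral_add integrable_on_mult_right vs)
        ultimately have "F l - F (l - h) = c * integral {t - l..t - l + h} v1 + d * integral {t - l..t - l + h} v2"
          by linarith
        then show ?thesis by (simp add: add_divide_distrib)
      qed
      then show ?thesis unfolding eventually_at_right_field using l by blast
    qed
    ultimately show ?thesis by (rule Lim_transform_eventually)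
  qed
  have P: "((\<lambda>h. (weighted_primitive 0 (mean_part h1 h2 z) l - weighted_primitive 0 (mean_part h1 h2 z) (l - h)) / h)
       \<longlongrightarrow> h2 * a1 + h1 * a2) (at_right 0)"
    by (rule *) (use tr in \<open>auto simp: boundary_trace_def\<close>)
  have "((\<lambda>h. (weighted_primitive (h1 + h2) (diff_part z) l - weighted_primitive (h1 + h2) (diff_part z) (l - h)) / h)
       \<longlongrightarrow> 1 * a1 + (- 1) * a2) (at_right 0)"
    by (rule *) (use tr in \<open>auto simp: boundary_trace_def\<close>)
  then have Q: "((\<lambda>h. (weighted_primitive (h1 + h2) (diff_part z) l - weighted_primitive (h1 + h2) (diff_part z) (l - h)) / h)
       \<longlongrightarrow> a1 - a2) (at_right 0)" by simp
  show "c1 = outflow1 l h1 h2 a1 a2" "c2 = outflow2 l h1 h2 a1 a2"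
    using C_Lambda_eq_boundary_value[OF l h z C P Q] by (simp_all add: outflow1_def outflow2_def)
qed

section \<open>Traces of the closed loop\<close>

lemma integral_cong_except_endpoint:
  fixes f g :: "real \<Rightarrow> real"
  assumes "\<And>s. a \<le> s \<Longrightarrow> s < b \<Longrightarrow> f s = g s"
  shows "integral {a..b} f = integral {a..b} g"
  by (rule integral_spike[of "{b}"]) (use assms in auto)

text \<open>The delayed output \<open>y (s + \<tau>)\<close> is the plant output at time s, and the
  inputs of plant and observer share \<open>u\<close>, so both the delay and the control cancel from
  the recursion of the error \<open>w - v\<close>. The predictor output at time t is fixed by its
  trace just after t - l. This is the observer trace if t - l lies before t - \<tau> and the plant
  trace otherwise, which gives the last two cases.\<close>

lemma closed_loop_traces:
  fixes l h1 h2 \<tau> k1 k2 :: real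
  assumes l: "0 < l" and h: "0 < h1" "0 < h2" and \<tau>: "0 < \<tau>"
    and z0: "z0 \<in> state_space l" and zh0: "zh0 \<in> state_space l"
    and cl: "closed_loop l h1 h2 \<tau> k1 k2 z0 zh0 z zp zm u1 u2 y1 y2 q1 q2"
  obtains v1 v2 w1 w2 where
    "locally_square_integrable v1" "locally_square_integrable v2"
    "locally_square_integrable w1" "locally_square_integrable w2"
    "\<And>t. 0 \<le> t \<Longrightarrow> z t \<in> state_space l"
    "\<And>t. 0 \<le> t \<Longrightarrow> boundary_trace l h1 h2 (z t) t v1 v2"
    "\<And>t. t \<le> 0 \<Longrightarrow> v1 t = inflow1 h1 h2 z0 u1 t" "\<And>t. t \<le> 0 \<Longrightarrow> v2 t = inflow2 h1 h2 z0 u2 t"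
    "\<And>t. t \<le> 0 \<Longrightarrow> w1 t = inflow1 h1 h2 zh0 u1 t" "\<And>t. t \<le> 0 \<Longrightarrow> w2 t = inflow2 h1 h2 zh0 u2 t"
    "AE t in lebesgue. 0 < t \<longrightarrow>
       w1 t - v1 t = - k1 * (outflow1 l h1 h2 (w1 (t - l)) (w2 (t - l)) - outflow1 l h1 h2 (v1 (t - l)) (v2 (t - l))) \<and>
       w2 t - v2 t = - k2 * (outflow2 l h1 h2 (w1 (t - l)) (w2 (t - l)) - outflow2 l h1 h2 (v1 (t - l)) (v2 (t - l)))"
    "AE t in lebesgue. 0 < t \<and> t \<le> \<tau> \<longrightarrow> v1 t = 0 \<and> v2 t = 0"
    "\<tau> < l \<Longrightarrow> AE t in lebesgue. \<tau> < t \<longrightarrow>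
       v1 t = - k1 * outflow1 l h1 h2 (w1 (t - l)) (w2 (t - l)) \<and>
       v2 t = - k2 * outflow2 l h1 h2 (w1 (t - l)) (w2 (t - l))"
    "l \<le> \<tau> \<Longrightarrow> AE t in lebesgue. \<tau> < t \<longrightarrow>
       v1 t = - k1 * outflow1 l h1 h2 (v1 (t - l)) (v2 (t - l)) \<and>
       v2 t = - k2 * outflow2 l h1 h2 (v1 (t - l)) (v2 (t - l))"
proof -
  let ?o1 = "\<lambda>f1 f2 t. outflow1 l h1 h2 (f1 (t - l)) (f2 (t - l))"
  let ?o2 = "\<lambda>f1 f2 t. outflow2 l h1 h2 (f1 (t - l)) (f2 (t - l))"
  \<comment> \<open>The trace of the predictor at time t: observer trace before t - \<tau>, actual
    inputs afterwards. At s = t - \<tau> itself it takes the plant value, which puts \<tau> = l into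
    the exact case.\<close>
  let ?m = "\<lambda>w v t s. if s < t - \<tau> then w s else (v s :: real)"
  define i1 where "i1 = (\<lambda>s. - k1 * (q1 s - y1 (s + \<tau>)) + u1 s)"
  define i2 where "i2 = (\<lambda>s. - k2 * (q2 s - y2 (s + \<tau>)) + u2 s)"
  define v1 where "v1 = inflow1 h1 h2 z0 u1"
  define v2 where "v2 = inflow2 h1 h2 z0 u2"
  define w1 where "w1 = inflow1 h1 h2 zh0 i1"
  define w2 where "w2 = inflow2 h1 h2 zh0 i2"
  have mz: "mild_solution l h1 h2 0 {0..} z0 u1 u2 z"
    and ay: "AE t in lborel. t \<ge> \<tau> \<longrightarrow> C_Lambda l h1 h2 (z (t - \<tau>)) (y1 t) (y2 t)"
    and mzp: "mild_solution l h1 h2 0 {0..} zh0 i1 i2 zp"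
    and aq: "AE s in lborel. s \<ge> 0 \<longrightarrow> C_Lambda l h1 h2 (zp s) (q1 s) (q2 s)"
    and mzm: "\<And>t. t > \<tau> \<Longrightarrow> mild_solution l h1 h2 (t - \<tau>) {t - \<tau>..t} (zp (t - \<tau>)) u1 u2 (\<lambda>s. zm s t)"
    and a0: "AE t in lborel. 0 \<le> t \<and> t \<le> \<tau> \<longrightarrow> u1 t = 0 \<and> u2 t = 0"
    and ap: "AE t in lborel. t > \<tau> \<longrightarrow>
        (\<exists>p1 p2. C_Lambda l h1 h2 (zm t t) p1 p2 \<and> u1 t = - k1 * p1 \<and> u2 t = - k2 * p2)"
    using cl unfolding closed_loop_def i1_def i2_def by blast+
  have lv: "locally_square_integrable v1" "locally_square_integrable v2"
    unfolding v1_def v2_def using mz by (auto simp: mild_solution_def intro!: locally_square_integrable_inflow)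
  have lw: "locally_square_integrable w1" "locally_square_integrable w2"
    unfolding w1_def w2_def using mzp by (auto simp: mild_solution_def intro!: locally_square_integrable_inflow)
  have zs: "z t \<in> state_space l" "zp t \<in> state_space l" if "0 \<le> t" for t
    using mz mzp that by (auto simp: mild_solution_def)
  have tz: "boundary_trace l h1 h2 (z t) t v1 v2" if "0 \<le> t" for t
    by (rule mild_solution_boundary_trace[OF l h _ _ mz, of t])
      (use that h lv in \<open>auto intro: locally_square_integrable_imp boundary_trace_inflow simp: v1_def v2_def inflow1_def inflow2_def\<close>)
  have tzp: "boundary_trace l h1 h2 (zp t) t w1 w2" if "0 \<le> t" for t
    by (rule mild_solution_boundary_trace[OF l h _ _ mzp, of t])
      (use that h lw in \<open>auto intro: locally_square_integrable_imp boundary_trace_inflow simp: w1_def w2_def inflow1_def inflow2_def\<close>)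
  \<comment> \<open>\<open>RD v t\<close> says that t - l is a right Lebesgue point of
    \<open>v\<close>.\<close>
  define RD where "RD = (\<lambda>v t. ((\<lambda>h. integral {t - l..t - l + h} v / h) \<longlongrightarrow> v (t - l)) (at_right (0::real)))"
  have rd: "AE t in lebesgue. RD v t" if "locally_square_integrable v" for v
    using AE_lebesgue_shift[OF indefinite_integral_right_derivative_AE, of v "- l"]
      locally_square_integrable_imp(1)[OF that] by (simp add: RD_def)
  have ay': "AE t in lebesgue. 0 \<le> t \<longrightarrow> C_Lambda l h1 h2 (z t) (y1 (t + \<tau>)) (y2 (t + \<tau>))"
    using AE_lebesgue_shift[OF AE_completion[OF ay], of \<tau>] by simp
  have dev: "AE t in lebesgue. 0 < t \<longrightarrow>
       w1 t - v1 t = - k1 * (?o1 w1 w2 t - ?o1 v1 v2 t) \<and>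
       w2 t - v2 t = - k2 * (?o2 w1 w2 t - ?o2 v1 v2 t)"
    using ay' AE_completion[OF aq] rd[OF lv(1)] rd[OF lv(2)] rd[OF lw(1)] rd[OF lw(2)]
  proof eventually_elim
    case (elim t)
    show ?case
    proof
      assume t: "0 < t"
      have "y1 (t + \<tau>) = ?o1 v1 v2 t" "y2 (t + \<tau>) = ?o2 v1 v2 t"
        using C_Lambda_boundary_trace[OF l h zs(1) tz _ _ elim(3)[unfolded RD_def] elim(4)[unfolded RD_def]] elim(1) t
          locally_square_integrable_imp(1)[OF lv(1)] locally_square_integrable_imp(1)[OF lv(2)] by auto
      moreover have "q1 t = ?o1 w1 w2 t" "q2 t = ?o2 w1 w2 t"
        using C_Lambda_boundary_trace[OF l h zs(2) tzp _ _ elim(5)[unfolded RD_def] elim(6)[unfolded RD_def]] elim(2) t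
          locally_square_integrable_imp(1)[OF lw(1)] locally_square_integrable_imp(1)[OF lw(2)] by auto
      moreover have "w1 t = i1 t" "w2 t = i2 t" "v1 t = u1 t" "v2 t = u2 t"
        using t by (auto simp: v1_def v2_def w1_def w2_def inflow1_def inflow2_def)
      ultimately show "w1 t - v1 t = - k1 * (?o1 w1 w2 t - ?o1 v1 v2 t) \<and>
       w2 t - v2 t = - k2 * (?o2 w1 w2 t - ?o2 v1 v2 t)"
        by (simp add: i1_def i2_def)
    qed
  qed
  have zero: "AE t in lebesgue. 0 < t \<and> t \<le> \<tau> \<longrightarrow> v1 t = 0 \<and> v2 t = 0"
    using AE_completion[OF a0]
    by eventually_elim (auto simp: v1_def v2_def inflow1_def inflow2_def)
  have tzm: "boundary_trace l h1 h2 (zm t t) t (?m w1 v1 t) (?m w2 v2 t)"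
    and izm: "?m w1 v1 t integrable_on {t - l..t}"
      "?m w2 v2 t integrable_on {t - l..t}" if t: "\<tau> < t" for t
  proof -
    have pw: "(\<lambda>s. if s < t - \<tau> then w s else v s) integrable_on {a..b}"
      if "locally_square_integrable w" "locally_square_integrable v" for v w a b
    proof -
      have "(\<lambda>s. if s \<le> t - \<tau> then w s else v s) integrable_on {a..b}"
        by (intro integrable_on_piecewise locally_square_integrable_imp that)
      then show ?thesis by (rule integrable_spike[of _ _ "{t - \<tau>}"]) auto
    qed
    show "?m w1 v1 t integrable_on {t - l..t}"
      "?m w2 v2 t integrable_on {t - l..t}"
      by (intro pw lw lv)+
    show "boundary_trace l h1 h2 (zm t t) t (?m w1 v1 t) (?m w2 v2 t)"
    proof (rule mild_solution_boundary_trace[OF l h _ _ mzm[OF t], of t])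
      have *: "integral {t - \<tau> - x..t - \<tau>} (\<lambda>s. f (if s < t - \<tau> then w1 s else v1 s) (if s < t - \<tau> then w2 s else v2 s))
        = integral {t - \<tau> - x..t - \<tau>} (\<lambda>s. f (w1 s) (w2 s))" for f :: "real \<Rightarrow> real \<Rightarrow> real" and x
        by (rule integral_cong_except_endpoint) simp
      show "boundary_trace l h1 h2 (zp (t - \<tau>)) (t - \<tau>) (?m w1 v1 t) (?m w2 v2 t)"
        using tzp[of "t - \<tau>"] t unfolding boundary_trace_def
        by (simp add: *[where f = "\<lambda>a b. h2 * a + h1 * b"] *[where f = "\<lambda>a b. a - b"])
      show "?m w1 v1 t integrable_on {t - \<tau> - l..t}"
        "?m w2 v2 t integrable_on {t - \<tau> - l..t}"
        by (intro pw lw lv)+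
    qed (use t \<tau> in \<open>auto simp: v1_def v2_def inflow1_def inflow2_def\<close>)
  qed
  \<comment> \<open>The output depends on the trace only through difference quotients to the right
    of t - l, so agreement with \<open>f1\<close>, \<open>f2\<close> on an interval of length
    \<open>d\<close> suffices.\<close>
  have pred: "AE t in lebesgue. \<tau> < t \<longrightarrow> v1 t = - k1 * ?o1 f1 f2 t \<and>
       v2 t = - k2 * ?o2 f1 f2 t"
    if f: "locally_square_integrable f1" "locally_square_integrable f2"
      and d: "0 < d" and eq: "\<And>t s. \<tau> < t \<Longrightarrow> t - l \<le> s \<Longrightarrow> s < t - l + d \<Longrightarrow> (if s < t - \<tau> then w1 s else v1 s) = f1 s \<and>
         (if s < t - \<tau> then w2 s else v2 s) = f2 s" for f1 f2 d
    using AE_completion[OF ap] rd[OF f(1)] rd[OF f(2)]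
  proof eventually_elim
    case (elim t)
    show ?case
    proof
      assume t: "\<tau> < t"
      then obtain p1 p2 where p: "C_Lambda l h1 h2 (zm t t) p1 p2" "u1 t = - k1 * p1" "u2 t = - k2 * p2"
        using elim(1) by blast
      have *: "((\<lambda>h. integral {t - l..t - l + h} g / h) \<longlongrightarrow> f (t - l)) (at_right 0)"
        if "RD f t" "\<And>s. t - l \<le> s \<Longrightarrow> s < t - l + d \<Longrightarrow> g s = f s" for f g
      proof -
        have "integral {t - l..t - l + h} f / h = integral {t - l..t - l + h} g / h" if hh: "0 < h" "h < d" for h
        proof -
          have "integral {t - l..t - l + h} f = integral {t - l..t - l + h} g"
            by (rule integral_cong) (use \<open>\<And>s. t - l \<le> s \<Longrightarrow> s < t - l + d \<Longrightarrow> g s = f s\<close> hh in auto)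
          then show ?thesis by simp
        qed
        then have "\<forall>\<^sub>F h in at_right 0. integral {t - l..t - l + h} f / h = integral {t - l..t - l + h} g / h"
          unfolding eventually_at_right_field using d by blast
        with that(1) show ?thesis unfolding RD_def by (rule Lim_transform_eventually)
      qed
      have zmS: "zm t t \<in> state_space l" using mzm[OF t] \<tau> by (auto simp: mild_solution_def)
      have "p1 = ?o1 f1 f2 t \<and> p2 = ?o2 f1 f2 t"
        using C_Lambda_boundary_trace[OF l h zmS tzm[OF t] izm[OF t] *[OF elim(2)] *[OF elim(3)] p(1)] eq[OF t]
        by blast
      moreover have "v1 t = u1 t" "v2 t = u2 t"
        using t \<tau> by (auto simp: v1_def v2_def inflow1_def inflow2_def)
      ultimately show "v1 t = - k1 * ?o1 f1 f2 t \<and>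
       v2 t = - k2 * ?o2 f1 f2 t"
        using p(2,3) by simp
    qed
  qed
  show ?thesis
  proof (rule that[OF lv lw zs(1) tz _ _ _ _ dev zero])
    show "AE t in lebesgue. \<tau> < t \<longrightarrow>
       v1 t = - k1 * ?o1 w1 w2 t \<and>
       v2 t = - k2 * ?o2 w1 w2 t" if "\<tau> < l"
      \<comment> \<open>With this width, s < t - l + d means s < t - \<tau>, where the predictor
        still carries the observer trace.\<close>
      by (rule pred[OF lw, of "l - \<tau>"]) (use that in auto)
    show "AE t in lebesgue. \<tau> < t \<longrightarrow>
       v1 t = - k1 * ?o1 v1 v2 t \<and>
       v2 t = - k2 * ?o2 v1 v2 t" if "l \<le> \<tau>"
      by (rule pred[OF lv, of 1]) (use that in auto)
  qed (auto simp: v1_def v2_def w1_def w2_def inflow1_def inflow2_def)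
qed

section \<open>The feedback matrix\<close>

text \<open>Recursions with delay l are iterated along whole orbits, so the null set is replaced by
  the countable union of its translates. Integers rather than naturals keep the property invariant
  under steps in both directions.\<close>

lemma AE_all_integer_shifts:
  assumes "AE t in lebesgue. P t"
  shows "AE t in lebesgue. \<forall>k::int. P (t + real_of_int k * l)"
  using AE_lebesgue_shift[OF assms] by (simp add: AE_all_countable)

lemma outflow_zero: "outflow1 l h1 h2 0 0 = 0" "outflow2 l h1 h2 0 0 = 0"
  by (simp_all add: outflow1_def outflow2_def)

lemma mean_diff_part_bound:
  assumes h: "0 < h1" "0 < h2"
  shows "norm z \<le> 2 / (h1 + h2) * norm (mean_part h1 h2 z) + norm (diff_part z)"
proof -
  let ?k = "h1 + h2"
  have f: "fst z = (1 / ?k) *\<^sub>R mean_part h1 h2 z + (h1 / ?k) *\<^sub>R diff_part z"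
    by (rule inner_ext) (use h in \<open>simp add: mean_part_def diff_part_def inner_simps divide_simps\<close>, algebra)
  have g: "snd z = (1 / ?k) *\<^sub>R mean_part h1 h2 z - (h2 / ?k) *\<^sub>R diff_part z"
    by (rule inner_ext) (use h in \<open>simp add: mean_part_def diff_part_def inner_simps divide_simps\<close>, algebra)
  have "norm z \<le> norm (fst z) + norm (snd z)"
    using norm_Pair_le[of "fst z" "snd z"] by simp
  also have "norm (fst z) \<le> norm ((1 / ?k) *\<^sub>R mean_part h1 h2 z) + norm ((h1 / ?k) *\<^sub>R diff_part z)"
    by (subst f) (rule norm_triangle_ineq)
  also have "norm (snd z) \<le> norm ((1 / ?k) *\<^sub>R mean_part h1 h2 z) + norm ((h2 / ?k) *\<^sub>R diff_part z)"
    by (subst g) (rule norm_triangle_ineq4)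
  also have "norm ((1 / ?k) *\<^sub>R mean_part h1 h2 z) + norm ((h1 / ?k) *\<^sub>R diff_part z)
      + (norm ((1 / ?k) *\<^sub>R mean_part h1 h2 z) + norm ((h2 / ?k) *\<^sub>R diff_part z))
     = 1 / ?k * norm (mean_part h1 h2 z) + h1 / ?k * norm (diff_part z)
      + (1 / ?k * norm (mean_part h1 h2 z) + h2 / ?k * norm (diff_part z))"
    using h by simp
  also have "\<dots> = 2 / ?k * norm (mean_part h1 h2 z) + norm (diff_part z)"
    by (use h in \<open>simp add: divide_simps\<close>, algebra)
  finally show ?thesis by simp
qed

text \<open>The control is zero on (0, \<tau>], which contains a full window of length l, and then
  v(t) = N v(t - l) propagates the zero whatever the gains are. For t at least l the state sees the
  trace only at nonnegative times.\<close>

lemma closed_loop_dead_beat: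
  assumes l: "0 < l" and h: "0 < h1" "0 < h2" and \<tau>: "l \<le> \<tau>"
    and z0: "z0 \<in> state_space l" and zh0: "zh0 \<in> state_space l"
    and cl: "closed_loop l h1 h2 \<tau> k1 k2 z0 zh0 z zp zm u1 u2 y1 y2 q1 q2"
    and t: "l \<le> t"
  shows "z t = 0"
proof (rule closed_loop_traces[OF l h less_le_trans[OF l \<tau>] z0 zh0 cl])
  fix v1 v2
  assume zS: "\<And>t. 0 \<le> t \<Longrightarrow> z t \<in> state_space l"
    and tr: "\<And>t. 0 \<le> t \<Longrightarrow> boundary_trace l h1 h2 (z t) t v1 v2"
    and zero: "AE t in lebesgue. 0 < t \<and> t \<le> \<tau> \<longrightarrow> v1 t = 0 \<and> v2 t = 0"
    and rec': "l \<le> \<tau> \<Longrightarrow> AE t in lebesgue. \<tau> < t \<longrightarrow>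
       v1 t = - k1 * outflow1 l h1 h2 (v1 (t - l)) (v2 (t - l)) \<and>
       v2 t = - k2 * outflow2 l h1 h2 (v1 (t - l)) (v2 (t - l))"
  note rec = rec'[OF \<tau>]
  define P where "P = (\<lambda>t. (0 < t \<and> t \<le> \<tau> \<longrightarrow> v1 t = 0 \<and> v2 t = 0) \<and> (\<tau> < t \<longrightarrow>
       v1 t = - k1 * outflow1 l h1 h2 (v1 (t - l)) (v2 (t - l)) \<and>
       v2 t = - k2 * outflow2 l h1 h2 (v1 (t - l)) (v2 (t - l))))"
  have "AE t in lebesgue. P t" using zero rec by eventually_elim (auto simp: P_def)
  then have good: "AE t in lebesgue. \<forall>k::int. P (t + real_of_int k * l)" by (rule AE_all_integer_shifts)
  \<comment> \<open>\<open>n\<close> counts windows of length l. Beyond \<tau> the time t - l is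
    still positive, because l is at most \<tau>.\<close>
  have ind: "v1 t = 0 \<and> v2 t = 0"
    if "\<forall>k::int. P (t + real_of_int k * l)" "0 < t" "t \<le> real n * l" for t n
    using that
  proof (induction n arbitrary: t)
    case (Suc n)
    show ?case
    proof (cases "t \<le> \<tau>")
      case True
      then show ?thesis using Suc.prems(1)[rule_format, of 0] Suc.prems(2) by (simp add: P_def)
    next
      case False
      have "\<forall>k::int. P (t - l + real_of_int k * l)"
      proof
        fix k :: int
        show "P (t - l + real_of_int k * l)"
          using Suc.prems(1)[rule_format, of "k - 1"] by (simp add: algebra_simps)
      qed
      then have "v1 (t - l) = 0 \<and> v2 (t - l) = 0"
        using Suc.prems(3) False \<tau> by (intro Suc.IH) (auto simp: algebra_simps)
      then show ?thesis using Suc.prems(1)[rule_format, of 0] False by (simp add: P_def outflow_zero)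
    qed
  qed (use l in auto)
  have v0: "AE t in lebesgue. 0 < t \<longrightarrow> v1 t = 0 \<and> v2 t = 0"
    using good
  proof eventually_elim
    case (elim t)
    obtain n :: nat where "t / l \<le> real n" using real_arch_simple by blast
    then have "t \<le> real n * l" using l by (simp add: field_simps)
    then show ?case using ind[OF elim] by blast
  qed
  have int0: "integral {t - x..t} f = integral {t - x..t} (\<lambda>s. 0)"
    if x: "x \<in> {0..l}" and f: "\<And>s. v1 s = 0 \<Longrightarrow> v2 s = 0 \<Longrightarrow> f s = 0" for x and f :: "real \<Rightarrow> real"
  proof (rule integral_cong_AE_Icc[of "t - x" t])
    show "AE s in lebesgue. s \<in> {t - x<..<t} \<longrightarrow> f s = 0"
      using v0 by eventually_elim (use x t f in auto)
  qed auto
  have t0: "0 \<le> t" using l t by simp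
  have "(norm (mean_part h1 h2 (z t)))\<^sup>2 \<le> integral {t - l..t} (\<lambda>s. 0\<^sup>2)"
  proof (rule norm_L2_le_trace[OF mean_part_in_L2_space[OF zS[OF t0]], of 0])
    fix x assume x: "x \<in> {0..l}"
    then show "weighted_primitive 0 (mean_part h1 h2 (z t)) x = integral {t - x..t} (\<lambda>s. 0)"
      using tr[OF t0] int0[OF x, of "\<lambda>s. h2 * v1 s + h1 * v2 s"] by (auto simp: boundary_trace_def)
  qed auto
  moreover have "(norm (diff_part (z t)))\<^sup>2 \<le> integral {t - l..t} (\<lambda>s. 0\<^sup>2)"
  proof (rule norm_L2_le_trace[OF diff_part_in_L2_space[OF zS[OF t0]], of "h1 + h2"])
    fix x assume x: "x \<in> {0..l}"
    then show "weighted_primitive (h1 + h2) (diff_part (z t)) x = integral {t - x..t} (\<lambda>s. 0)"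
      using tr[OF t0] int0[OF x, of "\<lambda>s. v1 s - v2 s"] by (auto simp: boundary_trace_def)
  qed (use h in auto)
  ultimately show ?thesis
    using mean_diff_part_bound[OF h, of "z t"] by simp
qed

section \<open>The Perron eigenvector and the weighted maximum norm\<close>

lemma positive_matrix_perron:
  fixes a b c d :: real
  assumes "0 < a" "0 < b" "0 < c" "0 < d"
  obtains \<rho> c1 c2 where "0 < \<rho>" "0 < c1" "0 < c2" "a * c1 + b * c2 = \<rho> * c1" "c * c1 + d * c2 = \<rho> * c2"
proof
  \<comment> \<open>The witnesses are the larger root \<open>\<rho>\<close> of the characteristic
    polynomial and the vector (b, \<rho> - a), read off the first row. It is positive because
    \<open>\<Delta>\<close> exceeds the absolute value of a - d.\<close>
  define \<Delta> where "\<Delta> = sqrt ((a - d)\<^sup>2 + 4 * b * c)"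
  define \<rho> where "\<rho> = (a + d + \<Delta>) / 2"
  have "sqrt ((a - d)\<^sup>2) < \<Delta>" unfolding \<Delta>_def by (rule real_sqrt_less_mono) (use assms in auto)
  then have \<Delta>: "\<bar>a - d\<bar> < \<Delta>" by simp
  show "0 < \<rho>" "0 < b" "0 < \<rho> - a" using \<Delta> assms by (auto simp: \<rho>_def)
  have "\<Delta>\<^sup>2 = (a - d)\<^sup>2 + 4 * b * c" unfolding \<Delta>_def using assms by simp
  moreover have "\<Delta> = 2 * \<rho> - a - d" by (simp add: \<rho>_def field_simps)
  ultimately have "(2 * \<rho> - a - d)\<^sup>2 = (a - d)\<^sup>2 + 4 * b * c" by simp
  then show "c * b + d * (\<rho> - a) = \<rho> * (\<rho> - a)" by (simp add: power2_eq_square algebra_simps)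
  show "a * b + b * (\<rho> - a) = \<rho> * b" by (simp add: algebra_simps)
qed

text \<open>Written out, the matrix has positive entries, because the exponential lies strictly
  between 0 and 1. This is the input for Perron's argument.\<close>

lemma outflow_matrix:
  assumes "0 < h1" "0 < h2"
  shows "outflow1 l h1 h2 a1 a2 = h2 * (1 - exp (- (h1 + h2) * l)) / (h1 + h2) * a1
      + (h1 + h2 * exp (- (h1 + h2) * l)) / (h1 + h2) * a2"
    and "outflow2 l h1 h2 a1 a2 = (h2 + h1 * exp (- (h1 + h2) * l)) / (h1 + h2) * a1
      + h1 * (1 - exp (- (h1 + h2) * l)) / (h1 + h2) * a2"
  by (use assms in \<open>simp add: outflow1_def divide_simps\<close>, algebra)
    (use assms in \<open>simp add: outflow2_def divide_simps\<close>, algebra)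

definition weighted_max :: "real \<Rightarrow> real \<Rightarrow> real \<Rightarrow> real \<Rightarrow> real" where
  "weighted_max c1 c2 a1 a2 = max (\<bar>a1\<bar> / c1) (\<bar>a2\<bar> / c2)"

lemma weighted_max_le_iff:
  assumes "0 < c1" "0 < c2"
  shows "weighted_max c1 c2 a1 a2 \<le> r \<longleftrightarrow> \<bar>a1\<bar> \<le> r * c1 \<and> \<bar>a2\<bar> \<le> r * c2"
  using assms by (simp add: weighted_max_def pos_divide_le_eq)

lemma weighted_max_triangle:
  assumes "0 < c1" "0 < c2"
  shows "weighted_max c1 c2 (a1 + b1) (a2 + b2) \<le> weighted_max c1 c2 a1 a2 + weighted_max c1 c2 b1 b2"
proof -
  have "\<bar>a1\<bar> \<le> weighted_max c1 c2 a1 a2 * c1" "\<bar>a2\<bar> \<le> weighted_max c1 c2 a1 a2 * c2"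
    "\<bar>b1\<bar> \<le> weighted_max c1 c2 b1 b2 * c1" "\<bar>b2\<bar> \<le> weighted_max c1 c2 b1 b2 * c2"
    using weighted_max_le_iff[OF assms] by blast+
  then show ?thesis
    unfolding weighted_max_le_iff[OF assms] distrib_right by linarith
qed

lemma weighted_max_nonneg: "0 < c1 \<Longrightarrow> 0 < c2 \<Longrightarrow> 0 \<le> weighted_max c1 c2 a1 a2"
  by (simp add: weighted_max_def le_max_iff_disj)

text \<open>With the eigenvector as weights, the bounds m c1 and m c2 on the absolute values of a1
  and a2 are mapped by the positive matrix to \<rho> m c1 and \<rho> m c2. The contraction factor is
  thus exactly the eigenvalue, and iteration costs no extra constant.\<close>

lemma feedback_perron:
  fixes l h1 h2 k1 k2 :: real
  assumes l: "0 < l" and h: "0 < h1" "0 < h2" and k: "0 < k1" "0 < k2"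
  obtains \<rho> c1 c2 where "0 < \<rho>" "0 < c1" "0 < c2"
    "k1 * outflow1 l h1 h2 c1 c2 = \<rho> * c1" "k2 * outflow2 l h1 h2 c1 c2 = \<rho> * c2"
    "\<And>a1 a2. weighted_max c1 c2 (- k1 * outflow1 l h1 h2 a1 a2) (- k2 * outflow2 l h1 h2 a1 a2)
       \<le> \<rho> * weighted_max c1 c2 a1 a2"
proof -
  define e where "e = exp (- (h1 + h2) * l)"
  have "(h1 + h2) * l > 0" using h l by simp
  then have e: "0 < e" "e < 1" unfolding e_def mult_minus_left by simp_all
  define a where "a = k1 * (h2 * (1 - e) / (h1 + h2))"
  define b where "b = k1 * ((h1 + h2 * e) / (h1 + h2))"
  define c where "c = k2 * ((h2 + h1 * e) / (h1 + h2))"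
  define d where "d = k2 * (h1 * (1 - e) / (h1 + h2))"
  have pos: "0 < a" "0 < b" "0 < c" "0 < d"
    using h k e by (simp_all add: a_def b_def c_def d_def add_pos_pos)
  have out: "k1 * outflow1 l h1 h2 a1 a2 = a * a1 + b * a2" "k2 * outflow2 l h1 h2 a1 a2 = c * a1 + d * a2" for a1 a2
    by (simp_all only: outflow_matrix[OF h] e_def[symmetric] a_def b_def c_def d_def distrib_left mult.assoc)
  obtain \<rho> c1 c2 where \<rho>: "0 < \<rho>" "0 < c1" "0 < c2" "a * c1 + b * c2 = \<rho> * c1" "c * c1 + d * c2 = \<rho> * c2"
    using positive_matrix_perron[OF pos] .
  have "weighted_max c1 c2 (- k1 * outflow1 l h1 h2 a1 a2) (- k2 * outflow2 l h1 h2 a1 a2)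
       \<le> \<rho> * weighted_max c1 c2 a1 a2" for a1 a2
  proof -
    define m where "m = weighted_max c1 c2 a1 a2"
    have m: "\<bar>a1\<bar> \<le> m * c1" "\<bar>a2\<bar> \<le> m * c2"
      using weighted_max_le_iff[OF \<rho>(2,3)] m_def by blast+
    have bnd: "\<bar>p * a1 + q * a2\<bar> \<le> m * (p * c1 + q * c2)" if "0 < p" "0 < q" for p q
    proof -
      have "\<bar>p * a1 + q * a2\<bar> \<le> p * \<bar>a1\<bar> + q * \<bar>a2\<bar>"
        using abs_triangle_ineq[of "p * a1" "q * a2"] that by (simp add: abs_mult)
      also have "\<dots> \<le> p * (m * c1) + q * (m * c2)"
        using m that by (intro add_mono mult_left_mono) auto
      finally show ?thesis by (simp add: algebra_simps)
    qed
    have "\<bar>- (a * a1 + b * a2)\<bar> \<le> \<rho> * m * c1" "\<bar>- (c * a1 + d * a2)\<bar> \<le> \<rho> * m * c2"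
      using bnd[of a b] bnd[of c d] pos \<rho>(4,5) by (simp_all add: mult_ac)
    then show ?thesis
      unfolding weighted_max_le_iff[OF \<rho>(2,3)] m_def[symmetric] mult_minus_left out by blast
  qed
  then show ?thesis using that[OF \<rho>(1-3)] \<rho>(4,5) by (simp only: out)
qed

section \<open>The decay rate of the semigroup\<close>

text \<open>No integral of the orbit is used, since \<open>L2\<close> is not known to be complete: the
  error of the explicit solution over \<open>n\<close> steps of length \<open>t / n\<close> is \<open>n o(t / n)\<close>.\<close>

lemma semigroup_orbit_rotation:
  fixes T :: "real \<Rightarrow> 'a :: real_normed_vector \<Rightarrow> 'a"
  assumes sg: "C0_semigroup_on S T" and gen: "generator_on S T D A"
    and S: "\<And>x y a b. x \<in> S \<Longrightarrow> y \<in> S \<Longrightarrow> a *\<^sub>R x + b *\<^sub>R y \<in> S"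
    and M: "0 \<le> M" "\<And>t x. 0 \<le> t \<Longrightarrow> x \<in> S \<Longrightarrow> norm (T t x) \<le> M * norm x"
    and D: "\<Phi> \<in> D" "\<Psi> \<in> D"
    and A: "A \<Phi> = \<alpha> *\<^sub>R \<Phi> + \<beta> *\<^sub>R \<Psi>" "A \<Psi> = \<alpha> *\<^sub>R \<Psi> - \<beta> *\<^sub>R \<Phi>"
    and t: "0 \<le> t"
  shows "T t \<Phi> = (exp (\<alpha> * t) * cos (\<beta> * t)) *\<^sub>R \<Phi> + (exp (\<alpha> * t) * sin (\<beta> * t)) *\<^sub>R \<Psi>"
proof (cases "t = 0")
  have \<Phi>S: "\<Phi> \<in> S" "\<Psi> \<in> S" using D gen by (auto simp: generator_on_def)
  {
    case True
    then show ?thesis using sg \<Phi>S by (simp add: C0_semigroup_on_def)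
  next
    case False
    with t have t0: "0 < t" by simp
    define c where "c = (\<lambda>s. exp (\<alpha> * s) * cos (\<beta> * s))"
    define d where "d = (\<lambda>s. exp (\<alpha> * s) * sin (\<beta> * s))"
    \<comment> \<open>With \<lambda> = \<alpha> + i \<beta>, the vector \<Phi> - i \<Psi> is an
      eigenvector for \<lambda>; \<open>X s\<close> and \<open>Y s\<close> are the real part and
      minus the imaginary part of e^(\<lambda> s) (\<Phi> - i \<Psi>). The defect of one step of
      length h is \<open>r h\<close>.\<close>
    define X where "X = (\<lambda>s. c s *\<^sub>R \<Phi> + d s *\<^sub>R \<Psi>)"
    define Y where "Y = (\<lambda>s. c s *\<^sub>R \<Psi> + (- d s) *\<^sub>R \<Phi>)"
    define r where "r = (\<lambda>h. norm (T h \<Phi> - X h) + norm (T h \<Psi> - Y h))"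
    have lin: "T s (a *\<^sub>R x + b *\<^sub>R y) = a *\<^sub>R T s x + b *\<^sub>R T s y" if "0 \<le> s" "x \<in> S" "y \<in> S" for s a b x y
    proof -
      have "a *\<^sub>R x \<in> S" "b *\<^sub>R y \<in> S"
        using S[of x x a 0] S[of y y b 0] that by auto
      then show ?thesis using sg that by (simp add: C0_semigroup_on_def)
    qed
    have XS: "X s \<in> S" for s unfolding X_def by (intro S \<Phi>S)
    have cd: "c (s + h) = c s * c h - d s * d h" "d (s + h) = c s * d h + d s * c h" for s h
      by (simp_all add: c_def d_def distrib_left exp_add cos_add sin_add algebra_simps)
    have X_add: "X (s + h) = c s *\<^sub>R X h + d s *\<^sub>R Y h" for s h
      by (simp add: X_def Y_def cd algebra_simps)
    define K where "K = exp (\<bar>\<alpha>\<bar> * t)"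
    have K: "\<bar>c s\<bar> \<le> K" "\<bar>d s\<bar> \<le> K" if "0 \<le> s" "s \<le> t" for s
    proof -
      have "\<alpha> * s \<le> \<bar>\<alpha>\<bar> * s" using that by (intro mult_right_mono) auto
      also have "\<dots> \<le> \<bar>\<alpha>\<bar> * t" using that by (intro mult_left_mono) auto
      finally have e: "exp (\<alpha> * s) \<le> K" by (simp add: K_def)
      have "exp (\<alpha> * s) * \<bar>cos (\<beta> * s)\<bar> \<le> K * 1" "exp (\<alpha> * s) * \<bar>sin (\<beta> * s)\<bar> \<le> K * 1"
        using e by (intro mult_mono; simp add: K_def)+
      then show "\<bar>c s\<bar> \<le> K" "\<bar>d s\<bar> \<le> K" by (simp_all add: c_def d_def abs_mult)
    qed
    \<comment> \<open>By the addition theorem in \<open>X_add\<close>, a step from time s has the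
      defect of a step from time 0, up to the factor \<open>K\<close>.\<close>
    have step: "norm (T h (X s) - X (s + h)) \<le> K * r h" if "0 \<le> h" "0 \<le> s" "s \<le> t" for h s
    proof -
      have "T h (X s) - X (s + h) = c s *\<^sub>R (T h \<Phi> - X h) + d s *\<^sub>R (T h \<Psi> - Y h)"
        unfolding X_add unfolding X_def[THEN fun_cong, of s] by (simp add: lin that \<Phi>S algebra_simps)
      also have "norm \<dots> \<le> norm (c s *\<^sub>R (T h \<Phi> - X h)) + norm (d s *\<^sub>R (T h \<Psi> - Y h))"
        by (rule norm_triangle_ineq)
      also have "\<dots> \<le> K * norm (T h \<Phi> - X h) + K * norm (T h \<Psi> - Y h)"
        using K[OF that(2,3)] by (simp add: add_mono mult_right_mono)
      finally show ?thesis by (simp add: r_def distrib_left)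
    qed
    \<comment> \<open>Telescoping: each local defect is carried to the end by the semigroup at the
      cost of the uniform bound \<open>M\<close>.\<close>
    have iter: "norm (T (real m * h) (X s) - X (s + real m * h)) \<le> real m * (M * (K * r h))"
      if "0 \<le> h" "0 \<le> s" "s + real m * h \<le> t" for m h s
      using that
    proof (induction m arbitrary: s)
      case 0
      then show ?case using sg XS by (simp add: C0_semigroup_on_def)
    next
      case (Suc m)
      have mh: "0 \<le> real m * h" using Suc.prems by simp
      have s: "s \<le> t" "s + h + real m * h \<le> t" using Suc.prems mh unfolding of_nat_Suc distrib_right mult_1 by linarith+
      have *: "T (real m * h + h) (X s) = T (real m * h) (T h (X s))"
        using sg mh Suc.prems XS by (simp add: C0_semigroup_on_def)
      have TS: "T h (X s) \<in> S" using sg Suc.prems XS by (simp add: C0_semigroup_on_def)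
      have "T (real m * h) (T h (X s) - X (s + h)) = T (real m * h) (T h (X s)) - T (real m * h) (X (s + h))"
        using lin[OF mh TS XS[of "s + h"], of 1 "-1"] by simp
      then have "norm (T (real m * h) (T h (X s)) - T (real m * h) (X (s + h)))
          = norm (T (real m * h) (T h (X s) - X (s + h)))" by simp
      also have "\<dots> \<le> M * norm (T h (X s) - X (s + h))"
        using S[OF TS XS[of "s + h"], of 1 "-1"] by (intro M mh) simp
      also have "\<dots> \<le> M * (K * r h)"
        using step[of h s] Suc.prems s by (intro mult_left_mono M) auto
      finally have 1: "norm (T (real m * h) (T h (X s)) - T (real m * h) (X (s + h))) \<le> M * (K * r h)" .
      have 2: "norm (T (real m * h) (X (s + h)) - X (s + h + real m * h)) \<le> real m * (M * (K * r h))"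
        using Suc.prems s by (intro Suc.IH) auto
      have fin: "norm (T (real m * h) (T h (X s)) - X (s + h + real m * h)) \<le> M * (K * r h) + real m * (M * (K * r h))"
        using norm_triangle_mono[OF 1 2] by simp
      have e1: "real (Suc m) * h = real m * h + h" by (simp add: algebra_simps)
      have e2: "s + (real m * h + h) = s + h + real m * h" by simp
      have e3: "real (Suc m) * (M * (K * r h)) = M * (K * r h) + real m * (M * (K * r h))"
        by (simp add: algebra_simps)
      show ?case unfolding e1 e3 * e2 by (rule fin)
    qed
    \<comment> \<open>The orbit and the candidate have the same right derivative at 0, so the local
      defect is o(h).\<close>
    have small: "((\<lambda>h. r h / h) \<longlongrightarrow> 0) (at_right 0)"
    proof -
      have dc: "((\<lambda>h. (c h - 1) / h) \<longlongrightarrow> \<alpha>) (at_right 0)"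
      proof -
        have "(c has_real_derivative \<alpha>) (at 0)"
          unfolding c_def by (auto intro!: derivative_eq_intros)
        then have "((\<lambda>h. (c h - 1) / h) \<longlongrightarrow> \<alpha>) (at 0)"
          by (simp add: DERIV_def c_def)
        then show ?thesis by (rule tendsto_mono[OF at_le, rotated]) simp
      qed
      have dd: "((\<lambda>h. d h / h) \<longlongrightarrow> \<beta>) (at_right 0)"
      proof -
        have "(d has_real_derivative \<beta>) (at 0)"
          unfolding d_def by (auto intro!: derivative_eq_intros)
        then have "((\<lambda>h. d h / h) \<longlongrightarrow> \<beta>) (at 0)"
          by (simp add: DERIV_def d_def)
        then show ?thesis by (rule tendsto_mono[OF at_le, rotated]) simp
      qed
      have gen': "((\<lambda>h. (T h x - x) /\<^sub>R h) \<longlongrightarrow> A x) (at_right 0)" if "x \<in> D" for x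
        using gen that by (auto simp: generator_on_def)
      let ?E = "\<lambda>h. norm ((T h \<Phi> - \<Phi>) /\<^sub>R h - (((c h - 1) / h) *\<^sub>R \<Phi> + (d h / h) *\<^sub>R \<Psi>))
          + norm ((T h \<Psi> - \<Psi>) /\<^sub>R h - (((c h - 1) / h) *\<^sub>R \<Psi> - (d h / h) *\<^sub>R \<Phi>))"
      have "((?E)
        \<longlongrightarrow> norm (A \<Phi> - (\<alpha> *\<^sub>R \<Phi> + \<beta> *\<^sub>R \<Psi>)) + norm (A \<Psi> - (\<alpha> *\<^sub>R \<Psi> - \<beta> *\<^sub>R \<Phi>))) (at_right 0)"
        by (intro tendsto_intros gen' D dc dd)
      then have "((?E) \<longlongrightarrow> 0) (at_right 0)"
        by (simp add: A)
      moreover have "\<forall>\<^sub>F h in at_right 0. ?E h = r h / h"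
      proof -
        have "?E h = r h / h" if h: "0 < h" for h
        proof -
          have "(T h \<Phi> - \<Phi>) /\<^sub>R h - (((c h - 1) / h) *\<^sub>R \<Phi> + (d h / h) *\<^sub>R \<Psi>) = (T h \<Phi> - X h) /\<^sub>R h"
            by (simp add: X_def algebra_simps divide_inverse)
          moreover have "(T h \<Psi> - \<Psi>) /\<^sub>R h - (((c h - 1) / h) *\<^sub>R \<Psi> - (d h / h) *\<^sub>R \<Phi>) = (T h \<Psi> - Y h) /\<^sub>R h"
            by (simp add: Y_def algebra_simps divide_inverse)
          ultimately show ?thesis using h by (simp add: r_def divide_inverse mult.commute distrib_left)
        qed
        then show ?thesis unfolding eventually_at_right_field using zero_less_one by blast
      qed
      ultimately show ?thesis by (rule Lim_transform_eventually)
    qed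
    have "filterlim (\<lambda>n. t / real (Suc n)) (at_right 0) sequentially"
    proof -
      have "((\<lambda>n. t / real (Suc n)) \<longlongrightarrow> 0) sequentially"
        by (rule LIMSEQ_Suc[of "\<lambda>n. t / real n"]) (rule lim_const_over_n)
      then show ?thesis using t0 by (auto simp: filterlim_at)
    qed
    from filterlim_compose[OF small this]
    have "(\<lambda>n. M * K * t * (r (t / real (Suc n)) / (t / real (Suc n)))) \<longlonglongrightarrow> M * K * t * 0"
      by (intro tendsto_intros)
    then have lim: "(\<lambda>n. M * K * t * (r (t / real (Suc n)) / (t / real (Suc n)))) \<longlonglongrightarrow> 0" by simp
    have "norm (T t \<Phi> - X t) \<le> M * K * t * (r (t / real (Suc n)) / (t / real (Suc n)))" for n
    proof -
      have X0: "X 0 = \<Phi>" by (simp add: X_def c_def d_def)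
      have n: "real (Suc n) * (t / real (Suc n)) = t" by simp
      have "norm (T t \<Phi> - X t) \<le> real (Suc n) * (M * (K * r (t / real (Suc n))))"
        using iter[of "t / real (Suc n)" 0 "Suc n"] t0 unfolding n X0 by simp
      also have "\<dots> = M * K * t * (r (t / real (Suc n)) / (t / real (Suc n)))"
        using t0 by (simp add: field_simps)
      finally show ?thesis .
    qed
    then have "norm (T t \<Phi> - X t) \<le> 0"
      using LIMSEQ_le_const[OF lim] by blast
    then show ?thesis by (simp add: X_def c_def d_def)
  }
qed

lemma cut_L2_lincomb:
  assumes "continuous_on {0..l} \<phi>" "continuous_on {0..l} \<psi>"
  shows "cut_L2 l (\<lambda>x. a * \<phi> x + b * \<psi> x) = a *\<^sub>R cut_L2 l \<phi> + b *\<^sub>R cut_L2 l \<psi>"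
proof (rule L2_eqI)
  have c: "continuous_on {0..l} (\<lambda>x. a * \<phi> x + b * \<psi> x)" by (intro continuous_intros assms)
  show "AE x in lborel. rep_L2 (cut_L2 l (\<lambda>x. a * \<phi> x + b * \<psi> x)) x = rep_L2 (a *\<^sub>R cut_L2 l \<phi> + b *\<^sub>R cut_L2 l \<psi>) x"
    using rep_cut_L2[OF c] rep_cut_L2[OF assms(1)] rep_cut_L2[OF assms(2)]
      rep_L2_add[of "a *\<^sub>R cut_L2 l \<phi>" "b *\<^sub>R cut_L2 l \<psi>"] rep_L2_scaleR[of a "cut_L2 l \<phi>"] rep_L2_scaleR[of b "cut_L2 l \<psi>"]
    by eventually_elim (simp add: algebra_simps)
qed

lemma cut_L2_nonzero:
  assumes l: "0 < l" and \<phi>: "\<And>x. x \<in> {0..l} \<Longrightarrow> (\<phi> has_real_derivative \<phi>' x) (at x within {0..l})"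
    and \<phi>': "continuous_on {0..l} \<phi>'" and "\<phi> 0 \<noteq> 0"
  shows "cut_L2 l \<phi> \<noteq> 0"
proof
  assume 0: "cut_L2 l \<phi> = 0"
  have 1: "H1_rep l 0 \<phi> (cut_L2 l \<phi>')" using H1_rep_cut_L2[OF \<phi> \<phi>'] by (simp add: 0)
  have "H1_rep l 0 (\<lambda>x. 0) 0"
    using H1_rep_lincomb[OF 1 1, of 0 0] by simp
  from H1_rep_unique(2)[OF l 1 this, of 0] show False using l assms(4) by simp
qed

text \<open>The boundary conditions of A_K ask for e^(\<lambda> l) = -\<rho>, which holds for
  \<lambda> = \<alpha> + i \<beta> with \<alpha> = ln \<rho> / l and \<beta> = \<pi> / l. The
  eigenfunction is e^(-\<lambda> x) E(x) = \<Phi> - i \<Psi>. As T(l) \<Phi> = -\<rho> \<Phi>, the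
  orbit has norm \<rho>^n at time n l relative to the start, and letting n grow removes the constant
  \<open>M\<close> from the decay estimate.\<close>

lemma perron_decay:
  fixes l h1 h2 k1 k2 \<rho> c1 c2 M \<gamma> :: real
  assumes l: "0 < l" and h: "0 < h1" "0 < h2" and k: "0 < k1" "0 < k2"
    and \<rho>: "0 < \<rho>" "0 < c1" "0 < c2"
    and eig: "k1 * outflow1 l h1 h2 c1 c2 = \<rho> * c1" "k2 * outflow2 l h1 h2 c1 c2 = \<rho> * c2"
    and sg: "C0_semigroup_on (state_space l) T"
    and gen: "generator_on (state_space l) T (dom_AK l k1 k2) (exchanger_op l h1 h2)"
    and M: "0 < M" "0 < \<gamma>" "\<forall>t\<ge>0. \<forall>x\<in>state_space l. norm (T t x) \<le> M * exp (- \<gamma> * t) * norm x"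
  shows "\<rho> \<le> exp (- \<gamma> * l)"
proof -
  define \<alpha> where "\<alpha> = ln \<rho> / l"
  define \<beta> where "\<beta> = pi / l"
  define \<kappa> where "\<kappa> = h1 + h2"
  have \<kappa>: "0 < \<kappa>" using h by (simp add: \<kappa>_def)
  have \<alpha>l: "exp (\<alpha> * l) = \<rho>" using \<rho> l by (simp add: \<alpha>_def)
  have \<alpha>l': "exp (- \<alpha> * l) = 1 / \<rho>" using \<alpha>l by (simp add: exp_minus field_simps)
  have \<beta>l: "\<beta> * l = pi" using l by (simp add: \<beta>_def)
  \<comment> \<open>(E1, E2) is e^(Hx) (c1, c2), the stationary profile of the exchange with the
    Perron vector at the inlet.\<close>
  define E1 where "E1 = (\<lambda>x. (h2 * c1 + h1 * c2 + h1 * (exp (- \<kappa> * x) * (c1 - c2))) / \<kappa>)"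
  define E2 where "E2 = (\<lambda>x. (h2 * c1 + h1 * c2 - h2 * (exp (- \<kappa> * x) * (c1 - c2))) / \<kappa>)"
  have E12: "E2 x - E1 x = - (exp (- \<kappa> * x) * (c1 - c2))" for x
    using \<kappa> by (simp add: E1_def E2_def diff_divide_distrib[symmetric]) (simp add: \<kappa>_def field_simps)
  have dE1: "(E1 has_real_derivative h1 * (E2 x - E1 x)) (at x within X)" for x X
    unfolding E12 unfolding E1_def using \<kappa> by (auto intro!: derivative_eq_intros simp: field_simps)
  have dE2: "(E2 has_real_derivative h2 * (E1 x - E2 x)) (at x within X)" for x X
  proof -
    have e: "E1 x - E2 x = exp (- \<kappa> * x) * (c1 - c2)" using E12[of x] by simp
    show ?thesis
      unfolding e unfolding E2_def using \<kappa> by (auto intro!: derivative_eq_intros simp: field_simps)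
  qed
  have cE: "continuous_on X E1" "continuous_on X E2" for X
    unfolding E1_def E2_def using \<kappa> by (auto intro!: continuous_intros)
  have E0: "E1 0 = c1" "E2 0 = c2"
    using \<kappa> by (simp_all add: E1_def E2_def divide_simps) (simp_all add: \<kappa>_def algebra_simps)
  have El: "k2 * E1 l = \<rho> * c2" "k1 * E2 l = \<rho> * c1"
    using eig by (simp_all add: E1_def E2_def outflow1_def outflow2_def \<kappa>_def)
  define C where "C = (\<lambda>x. exp (- \<alpha> * x) * cos (\<beta> * x))"
  define Z where "Z = (\<lambda>x. exp (- \<alpha> * x) * sin (\<beta> * x))"
  have dC: "(C has_real_derivative - \<alpha> * C x - \<beta> * Z x) (at x within X)" for x X
    unfolding C_def Z_def by (auto intro!: derivative_eq_intros simp: algebra_simps)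
  have dZ: "(Z has_real_derivative - \<alpha> * Z x + \<beta> * C x) (at x within X)" for x X
    unfolding C_def Z_def by (auto intro!: derivative_eq_intros simp: algebra_simps)
  have cC: "continuous_on X C" "continuous_on X Z" for X
    unfolding C_def Z_def by (auto intro!: continuous_intros)
  \<comment> \<open>The cosine factor carries the sign of -1 / \<rho> at x = l, as the negative
    feedback demands; the sine factor vanishes at both ends, so \<open>\<Psi>\<close> meets the
    boundary conditions trivially.\<close>
  have CZ: "C 0 = 1" "Z 0 = 0" "C l = - 1 / \<rho>" "Z l = 0"
    using \<alpha>l' by (simp_all add: C_def Z_def \<beta>l)
  note cont = continuous_intros cE cC
  define cut where "cut = cut_L2 l"
  have rep: "H1_rep l (cut (\<lambda>x. f x * E x)) (\<lambda>x. f x * E x)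
      (a *\<^sub>R cut (\<lambda>x. f x * E x) + b *\<^sub>R cut (\<lambda>x. g x * E x) + e *\<^sub>R (cut (\<lambda>x. f x * F x) - cut (\<lambda>x. f x * E x)))"
    if df: "\<And>x X. (f has_real_derivative a * f x + b * g x) (at x within X)"
      and dE: "\<And>x X. (E has_real_derivative e * (F x - E x)) (at x within X)"
      and c: "\<And>X. continuous_on X f" "\<And>X. continuous_on X g" "\<And>X. continuous_on X E" "\<And>X. continuous_on X F"
    for f g E F a b e
  proof -
    \<comment> \<open>The factors 1 and -1 write the derivative as nested combinations to which
      \<open>cut_L2_lincomb\<close> applies.\<close>
    let ?d = "\<lambda>x. 1 * (a * (f x * E x) + b * (g x * E x)) + e * (1 * (f x * F x) + (- 1) * (f x * E x))"
    have "H1_rep l (cut (\<lambda>x. f x * E x)) (\<lambda>x. f x * E x) (cut_L2 l ?d)"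
      unfolding cut_def
    proof (rule H1_rep_cut_L2)
      show "((\<lambda>x. f x * E x) has_real_derivative ?d x) (at x within {0..l})" for x
        using DERIV_mult[OF df dE, of x "{0..l}"] by (simp add: algebra_simps)
      show "continuous_on {0..l} ?d" by (intro continuous_intros c)
    qed
    also have "cut_L2 l ?d = 1 *\<^sub>R (a *\<^sub>R cut (\<lambda>x. f x * E x) + b *\<^sub>R cut (\<lambda>x. g x * E x))
        + e *\<^sub>R (1 *\<^sub>R cut (\<lambda>x. f x * F x) + (- 1) *\<^sub>R cut (\<lambda>x. f x * E x))"
      unfolding cut_def by (subst cut_L2_lincomb, (intro continuous_intros c)+)+ (rule refl)
    finally show ?thesis by simp
  qed
  have r\<Phi>1: "H1_rep l (cut (\<lambda>x. C x * E1 x)) (\<lambda>x. C x * E1 x)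
      ((- \<alpha>) *\<^sub>R cut (\<lambda>x. C x * E1 x) + (- \<beta>) *\<^sub>R cut (\<lambda>x. Z x * E1 x) + h1 *\<^sub>R (cut (\<lambda>x. C x * E2 x) - cut (\<lambda>x. C x * E1 x)))"
    by (rule rep) (use dC dE1 cC cE in \<open>auto\<close>)
  have r\<Phi>2: "H1_rep l (cut (\<lambda>x. C x * E2 x)) (\<lambda>x. C x * E2 x)
      ((- \<alpha>) *\<^sub>R cut (\<lambda>x. C x * E2 x) + (- \<beta>) *\<^sub>R cut (\<lambda>x. Z x * E2 x) + h2 *\<^sub>R (cut (\<lambda>x. C x * E1 x) - cut (\<lambda>x. C x * E2 x)))"
    by (rule rep) (use dC dE2 cC cE in \<open>auto\<close>)
  have r\<Psi>1: "H1_rep l (cut (\<lambda>x. Z x * E1 x)) (\<lambda>x. Z x * E1 x)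
      ((- \<alpha>) *\<^sub>R cut (\<lambda>x. Z x * E1 x) + \<beta> *\<^sub>R cut (\<lambda>x. C x * E1 x) + h1 *\<^sub>R (cut (\<lambda>x. Z x * E2 x) - cut (\<lambda>x. Z x * E1 x)))"
    by (rule rep) (use dZ dE1 cC cE in \<open>auto\<close>)
  have r\<Psi>2: "H1_rep l (cut (\<lambda>x. Z x * E2 x)) (\<lambda>x. Z x * E2 x)
      ((- \<alpha>) *\<^sub>R cut (\<lambda>x. Z x * E2 x) + \<beta> *\<^sub>R cut (\<lambda>x. C x * E2 x) + h2 *\<^sub>R (cut (\<lambda>x. Z x * E1 x) - cut (\<lambda>x. Z x * E2 x)))"
    by (rule rep) (use dZ dE2 cC cE in \<open>auto\<close>)
  define \<Phi> where "\<Phi> = (cut (\<lambda>x. C x * E1 x), cut (\<lambda>x. C x * E2 x))"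
  define \<Psi> where "\<Psi> = (cut (\<lambda>x. Z x * E1 x), cut (\<lambda>x. Z x * E2 x))"
  have mem: "f \<in> H1 l" if "H1_rep l f \<phi> d" for f \<phi> d using that by (auto simp: H1_def)
  have l0: "0 \<in> {0..l}" "l \<in> {0..l}" using l by auto
  have \<Phi>D: "\<Phi> \<in> dom_AK l k1 k2"
    using El \<rho>(1) k
    by (simp add: \<Phi>_def dom_AK_def mem[OF r\<Phi>1] mem[OF r\<Phi>2] H1_value_eq[OF l r\<Phi>1 l0(1)] H1_value_eq[OF l r\<Phi>1 l0(2)]
      H1_value_eq[OF l r\<Phi>2 l0(1)] H1_value_eq[OF l r\<Phi>2 l0(2)] CZ E0 field_simps)
  have \<Psi>D: "\<Psi> \<in> dom_AK l k1 k2"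
    by (simp add: \<Psi>_def dom_AK_def mem[OF r\<Psi>1] mem[OF r\<Psi>2] H1_value_eq[OF l r\<Psi>1 l0(1)] H1_value_eq[OF l r\<Psi>1 l0(2)]
      H1_value_eq[OF l r\<Psi>2 l0(1)] H1_value_eq[OF l r\<Psi>2 l0(2)] CZ)
  have A\<Phi>: "exchanger_op l h1 h2 \<Phi> = \<alpha> *\<^sub>R \<Phi> + \<beta> *\<^sub>R \<Psi>"
    by (simp add: exchanger_op_def \<Phi>_def \<Psi>_def H1_deriv_eq[OF l r\<Phi>1] H1_deriv_eq[OF l r\<Phi>2])
  have A\<Psi>: "exchanger_op l h1 h2 \<Psi> = \<alpha> *\<^sub>R \<Psi> - \<beta> *\<^sub>R \<Phi>"
    by (simp add: exchanger_op_def \<Phi>_def \<Psi>_def H1_deriv_eq[OF l r\<Psi>1] H1_deriv_eq[OF l r\<Psi>2])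
  have \<Phi>S: "\<Phi> \<in> state_space l"
    using r\<Phi>1 r\<Phi>2 by (simp add: \<Phi>_def state_space_def H1_rep_def)
  have T\<Phi>: "T l \<Phi> = (- \<rho>) *\<^sub>R \<Phi>"
  proof -
    have "T l \<Phi> = (exp (\<alpha> * l) * cos (\<beta> * l)) *\<^sub>R \<Phi> + (exp (\<alpha> * l) * sin (\<beta> * l)) *\<^sub>R \<Psi>"
    proof (rule semigroup_orbit_rotation[OF sg gen _ _ _ \<Phi>D \<Psi>D A\<Phi> A\<Psi>, of M])
      show "a *\<^sub>R x + b *\<^sub>R y \<in> state_space l" if "x \<in> state_space l" "y \<in> state_space l" for x y a b
        using that by (auto simp: state_space_def intro!: L2_space_add L2_space_scaleR)
      show "norm (T t x) \<le> M * norm x" if "0 \<le> t" "x \<in> state_space l" for t x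
      proof -
        have "norm (T t x) \<le> M * exp (- \<gamma> * t) * norm x" using M that by blast
        also have "\<dots> \<le> M * 1 * norm x" using M that by (intro mult_right_mono mult_left_mono) auto
        finally show ?thesis by simp
      qed
    qed (use M l in auto)
    then show ?thesis by (simp add: \<alpha>l \<beta>l)
  qed
  have Tn: "T (real n * l) \<Phi> = (- \<rho>) ^ n *\<^sub>R \<Phi>" for n
  proof (induction n)
    case 0
    then show ?case using sg \<Phi>S by (simp add: C0_semigroup_on_def)
  next
    case (Suc n)
    have "T (real (Suc n) * l) \<Phi> = T (l + real n * l) \<Phi>" by (simp add: algebra_simps)
    also have "\<dots> = T l (T (real n * l) \<Phi>)" using sg \<Phi>S l by (simp add: C0_semigroup_on_def)
    also have "\<dots> = (- \<rho>) ^ n *\<^sub>R T l \<Phi>" using sg \<Phi>S l by (simp add: Suc C0_semigroup_on_def)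
    finally show ?case by (simp add: T\<Phi> mult.commute)
  qed
  have \<Phi>0: "0 < norm \<Phi>"
  proof -
    have "cut_L2 l (\<lambda>x. C x * E1 x) \<noteq> 0"
    proof (rule cut_L2_nonzero[OF l])
      show "((\<lambda>x. C x * E1 x) has_real_derivative (- \<alpha> * C x - \<beta> * Z x) * E1 x + h1 * (E2 x - E1 x) * C x) (at x within {0..l})" for x
        by (rule DERIV_mult[OF dC dE1])
      show "continuous_on {0..l} (\<lambda>x. (- \<alpha> * C x - \<beta> * Z x) * E1 x + h1 * (E2 x - E1 x) * C x)"
        by (intro continuous_intros cE cC)
      show "C 0 * E1 0 \<noteq> 0" using CZ E0 \<rho> by simp
    qed
    then show ?thesis by (simp add: \<Phi>_def cut_def prod_eq_iff)
  qed
  have pow: "(\<rho> * exp (\<gamma> * l)) ^ n \<le> M" for n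
  proof -
    have "norm (T (real n * l) \<Phi>) \<le> M * exp (- \<gamma> * (real n * l)) * norm \<Phi>"
      using M \<Phi>S l by simp
    then have "\<rho> ^ n * norm \<Phi> \<le> M * exp (- \<gamma> * (real n * l)) * norm \<Phi>"
      using \<rho>(1) by (simp add: Tn power_abs)
    then have "\<rho> ^ n \<le> M * exp (- \<gamma> * (real n * l))" using \<Phi>0 by simp
    then have "\<rho> ^ n * exp (\<gamma> * (real n * l)) \<le> M * exp (- \<gamma> * (real n * l)) * exp (\<gamma> * (real n * l))"
      by (rule mult_right_mono) simp
    also have "\<dots> = M" by (simp add: mult.assoc flip: exp_add)
    also have "exp (\<gamma> * (real n * l)) = exp (\<gamma> * l) ^ n"
      by (simp add: exp_of_nat_mult[symmetric] mult_ac)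
    finally show ?thesis by (simp add: power_mult_distrib)
  qed
  \<comment> \<open>A number whose powers are bounded by \<open>M\<close> cannot exceed 1.\<close>
  have "\<rho> * exp (\<gamma> * l) \<le> 1"
  proof (rule ccontr)
    assume "\<not> \<rho> * exp (\<gamma> * l) \<le> 1"
    then obtain n where "M < (\<rho> * exp (\<gamma> * l)) ^ n" using real_arch_pow[of "\<rho> * exp (\<gamma> * l)" M] by auto
    with pow[of n] show False by simp
  qed
  then have "\<rho> * exp (\<gamma> * l) * exp (- \<gamma> * l) \<le> 1 * exp (- \<gamma> * l)" by (rule mult_right_mono) simp
  moreover have "exp (\<gamma> * l) * exp (- \<gamma> * l) = 1" by (simp flip: exp_add)
  ultimately show ?thesis by (simp only: mult.assoc mult_1_left mult_1_right)
qed

section \<open>Bounds between states and traces\<close>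

lemma AE_lebesgue_reflect:
  assumes "AE t in lebesgue. P (t :: real)"
  shows "AE t in lebesgue. P (- t)"
proof -
  obtain N where N: "negligible N" "{t. \<not> P t} \<subseteq> N"
    using assms by (auto simp: eventually_ae_filter_negligible)
  have "negligible (uminus ` N)"
    by (rule negligible_differentiable_image_negligible[OF _ N(1)])
      (auto intro!: derivative_intros)
  moreover have "{t. \<not> P (- t)} \<subseteq> uminus ` N"
    using N(2) by (force intro: image_eqI[of _ _ "- _"])
  ultimately show ?thesis by (auto simp: eventually_ae_filter_negligible)
qed

lemma mean_diff_part_norm_le:
  assumes "0 < h1" "0 < h2"
  shows "norm (mean_part h1 h2 z) \<le> (h1 + h2) * norm z" "norm (diff_part z) \<le> 2 * norm z"
proof -
  have n: "norm (fst z) \<le> norm z" "norm (snd z) \<le> norm z"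
    using norm_fst_le[of "fst z" "snd z"] norm_snd_le[of "snd z" "fst z"] by simp_all
  have "norm (mean_part h1 h2 z) \<le> norm (h2 *\<^sub>R fst z) + norm (h1 *\<^sub>R snd z)"
    unfolding mean_part_def by (rule norm_triangle_ineq)
  also have "\<dots> \<le> h2 * norm z + h1 * norm z"
    using n assms by (simp add: add_mono mult_left_mono)
  finally show "norm (mean_part h1 h2 z) \<le> (h1 + h2) * norm z" by (simp add: algebra_simps)
  show "norm (diff_part z) \<le> 2 * norm z"
    unfolding diff_part_def using norm_triangle_ineq4[of "fst z" "snd z"] n by linarith
qed

text \<open>Only almost everywhere, because the choice of representatives by \<open>rep_L2\<close>
  is linear only up to null sets.\<close>

lemma inflow_diff:
  "AE t in lebesgue. t \<le> 0 \<longrightarrow>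
     inflow1 h1 h2 (z - z') u1 t = inflow1 h1 h2 z u1 t - inflow1 h1 h2 z' u1 t \<and>
     inflow2 h1 h2 (z - z') u2 t = inflow2 h1 h2 z u2 t - inflow2 h1 h2 z' u2 t"
proof -
  have m: "mean_part h1 h2 (z - z') = mean_part h1 h2 z - mean_part h1 h2 z'"
    "diff_part (z - z') = diff_part z - diff_part z'"
    by (simp_all add: mean_part_def diff_part_def algebra_simps)
  show ?thesis
    using AE_lebesgue_reflect[OF AE_completion[OF rep_L2_diff[of "mean_part h1 h2 z" "mean_part h1 h2 z'"]]]
      AE_lebesgue_reflect[OF AE_completion[OF rep_L2_diff[of "diff_part z" "diff_part z'"]]]
    by eventually_elim (simp add: inflow1_def inflow2_def m diff_divide_distrib[symmetric] add_divide_distrib[symmetric] right_diff_distrib)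
qed

text \<open>A bounded inverse of A_K into bounded functions. The trace a(x) = e^(-Hx) w(x) has
  derivative -e^(-Hx) A_K w, so it varies over [0, l] by at most a multiple of the norm of A_K w.
  The boundary conditions read a(0) = N a(l), so the size of a(0) is at most \<rho> times that of
  a(l), and \<rho> < 1 allows solving for it.\<close>

lemma dom_AK_inflow_bound:
  fixes l h1 h2 k1 k2 \<rho> c1 c2 :: real
  assumes l: "0 < l" and h: "0 < h1" "0 < h2"
    and \<rho>: "0 < \<rho>" "\<rho> < 1" "0 < c1" "0 < c2"
    and contr: "\<And>a1 a2. weighted_max c1 c2 (- k1 * outflow1 l h1 h2 a1 a2) (- k2 * outflow2 l h1 h2 a1 a2)
       \<le> \<rho> * weighted_max c1 c2 a1 a2"
  shows "\<exists>C\<ge>0. \<forall>w\<in>dom_AK l k1 k2. \<forall>u1 u2. AE t in lebesgue. t \<in> {- l<..<0} \<longrightarrow>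
     weighted_max c1 c2 (inflow1 h1 h2 w u1 t) (inflow2 h1 h2 w u2 t) \<le> C * norm (exchanger_op l h1 h2 w)"
proof -
  define \<kappa> where "\<kappa> = h1 + h2"
  have \<kappa>: "0 < \<kappa>" using h by (simp add: \<kappa>_def)
  define NP where "NP = sqrt l * \<kappa>"
  define NQ where "NQ = exp (\<kappa> * l) * sqrt l * 2"
  \<comment> \<open>The last factor dominates both 1 / c1 and 1 / c2, as the passage to the weighted
    maximum requires.\<close>
  define J where "J = (NP + (h1 + h2) * NQ) / \<kappa> * (1 / c1 + 1 / c2)"
  have N0: "0 \<le> NP" "0 \<le> NQ" using l \<kappa> by (simp_all add: NP_def NQ_def)
  have J0: "0 \<le> J" using N0 h \<kappa> \<rho> by (simp add: J_def)
  have main: "AE t in lebesgue. t \<in> {- l<..<0} \<longrightarrow>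
     weighted_max c1 c2 (inflow1 h1 h2 w u1 t) (inflow2 h1 h2 w u2 t) \<le> J / (1 - \<rho>) * norm (exchanger_op l h1 h2 w)"
    if w: "w \<in> dom_AK l k1 k2" for w u1 u2
  proof -
    obtain f g where w_eq: "w = (f, g)" by force
    have fg: "f \<in> H1 l" "g \<in> H1 l" "H1_value l f 0 = - k1 * H1_value l g l" "H1_value l g 0 = - k2 * H1_value l f l"
      using w by (auto simp: w_eq dom_AK_def)
    obtain \<phi> where \<phi>: "H1_rep l f \<phi> (H1_deriv l f)" "\<And>x. x \<in> {0..l} \<Longrightarrow> H1_value l f x = \<phi> x"
      using H1_rep_of_H1[OF l fg(1)] by blast
    obtain \<psi> where \<psi>: "H1_rep l g \<psi> (H1_deriv l g)" "\<And>x. x \<in> {0..l} \<Longrightarrow> H1_value l g x = \<psi> x"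
      using H1_rep_of_H1[OF l fg(2)] by blast
    define r where "r = exchanger_op l h1 h2 w"
    have r: "fst r = - H1_deriv l f + h1 *\<^sub>R (g - f)" "snd r = - H1_deriv l g + h2 *\<^sub>R (f - g)"
      by (simp_all add: r_def w_eq exchanger_op_def)
    have dP: "h2 *\<^sub>R H1_deriv l f + h1 *\<^sub>R H1_deriv l g + 0 *\<^sub>R (h2 *\<^sub>R f + h1 *\<^sub>R g) = - mean_part h1 h2 r"
      unfolding mean_part_def r by (rule inner_ext) (simp add: inner_simps algebra_simps)
    have dQ: "1 *\<^sub>R H1_deriv l f + (- 1) *\<^sub>R H1_deriv l g + \<kappa> *\<^sub>R (1 *\<^sub>R f + (- 1) *\<^sub>R g) = - diff_part r"
      unfolding diff_part_def r \<kappa>_def by (rule inner_ext) (simp add: inner_simps algebra_simps)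
    note P = H1_rep_lincomb[OF \<phi>(1) \<psi>(1), of h2 h1]
    note Q = H1_rep_lincomb[OF \<phi>(1) \<psi>(1), of 1 "-1"]
    define cP where "cP = (\<lambda>x. h2 * \<phi> x + h1 * \<psi> x)"
    define cQ where "cQ = (\<lambda>x. exp (\<kappa> * x) * (\<phi> x - \<psi> x))"
    define a1 where "a1 = (\<lambda>x. (cP x + h1 * cQ x) / \<kappa>)"
    define a2 where "a2 = (\<lambda>x. (cP x - h2 * cQ x) / \<kappa>)"
    have cP: "\<bar>cP x - cP 0\<bar> \<le> NP * norm r" if x: "x \<in> {0..l}" for x
    proof -
      have "cP x - cP 0 = weighted_primitive 0 (- mean_part h1 h2 r) x"
        using H1_rep_weighted[OF P x, of 0, unfolded dP] by (simp add: cP_def)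
      also have "\<bar>\<dots>\<bar> \<le> exp (0 * l) * sqrt l * norm (- mean_part h1 h2 r)"
        by (rule weighted_primitive_bound[OF order_refl x])
      also have "\<dots> \<le> sqrt l * (\<kappa> * norm r)"
        using mean_diff_part_norm_le(1)[OF h, of r] l by (simp add: \<kappa>_def)
      finally show ?thesis by (simp add: NP_def)
    qed
    have cQ: "\<bar>cQ x - cQ 0\<bar> \<le> NQ * norm r" if x: "x \<in> {0..l}" for x
    proof -
      have "cQ x - cQ 0 = weighted_primitive \<kappa> (- diff_part r) x"
        using H1_rep_weighted[OF Q x, of \<kappa>, unfolded dQ] by (simp add: cQ_def)
      also have "\<bar>\<dots>\<bar> \<le> exp (\<kappa> * l) * sqrt l * norm (- diff_part r)"
        by (rule weighted_primitive_bound[OF less_imp_le[OF \<kappa>] x])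
      also have "\<dots> \<le> exp (\<kappa> * l) * sqrt l * (2 * norm r)"
        using mean_diff_part_norm_le(2)[OF h, of r] l by (intro mult_left_mono) auto
      finally show ?thesis by (simp add: NQ_def)
    qed
    have a: "weighted_max c1 c2 (a1 x - a1 0) (a2 x - a2 0) \<le> J * norm r" if x: "x \<in> {0..l}" for x
    proof -
      define m where "m = (NP + (h1 + h2) * NQ) / \<kappa> * norm r"
      have m0: "0 \<le> m" using N0 h \<kappa> by (simp add: m_def)
      have b: "\<bar>(p + c * q) / \<kappa>\<bar> \<le> m" if "\<bar>p\<bar> \<le> NP * norm r" "\<bar>q\<bar> \<le> NQ * norm r" "\<bar>c\<bar> \<le> h1 + h2" for p q c
      proof -
        have "\<bar>p + c * q\<bar> \<le> \<bar>p\<bar> + \<bar>c\<bar> * \<bar>q\<bar>" using abs_triangle_ineq[of p "c * q"] by (simp add: abs_mult)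
        also have "\<dots> \<le> NP * norm r + (h1 + h2) * (NQ * norm r)"
          using that h by (intro add_mono mult_mono) auto
        also have "\<dots> = (NP + (h1 + h2) * NQ) * norm r" by (simp add: algebra_simps)
        finally show ?thesis using \<kappa> by (simp add: m_def divide_right_mono)
      qed
      have e1: "a1 x - a1 0 = (cP x - cP 0 + h1 * (cQ x - cQ 0)) / \<kappa>"
        by (simp add: a1_def algebra_simps flip: diff_divide_distrib)
      have e2: "a2 x - a2 0 = (cP x - cP 0 + (- h2) * (cQ x - cQ 0)) / \<kappa>"
        by (simp add: a2_def algebra_simps flip: diff_divide_distrib)
      have m1: "\<bar>a1 x - a1 0\<bar> \<le> m" unfolding e1 by (rule b[OF cP[OF x] cQ[OF x]]) (use h in simp)
      have m2: "\<bar>a2 x - a2 0\<bar> \<le> m" unfolding e2 by (rule b[OF cP[OF x] cQ[OF x]]) (use h in simp)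
      have "J * norm r = m * (1 / c1 + 1 / c2)" by (simp add: J_def m_def)
      moreover have "m * (1 / c1 + 1 / c2) * c1 = m + m * (c1 / c2)" "m * (1 / c1 + 1 / c2) * c2 = m + m * (c2 / c1)"
        using \<rho> by (simp_all add: field_simps)
      moreover have "0 \<le> m * (c1 / c2)" "0 \<le> m * (c2 / c1)" using m0 \<rho> by simp_all
      ultimately show ?thesis
        unfolding weighted_max_le_iff[OF \<rho>(3,4)] using m1 m2 by auto
    qed
    \<comment> \<open>Since a(l) = e^(-Hl) w(l), the outflow of a(l) is w(l) itself, and a(0) =
      w(0).\<close>
    have bc: "a1 0 = - k1 * outflow1 l h1 h2 (a1 l) (a2 l)" "a2 0 = - k2 * outflow2 l h1 h2 (a1 l) (a2 l)"
    proof -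
      have e: "exp (- \<kappa> * l) * cQ l = \<phi> l - \<psi> l"
        unfolding cQ_def by (rule exp_minus_cancel)
      have s: "h2 * a1 l + h1 * a2 l = cP l" "a1 l - a2 l = cQ l"
        unfolding a1_def a2_def
        by (use \<kappa> in \<open>simp add: divide_simps\<close>, use \<kappa>_def in algebra)+
      have "outflow1 l h1 h2 (a1 l) (a2 l) = \<psi> l" "outflow2 l h1 h2 (a1 l) (a2 l) = \<phi> l"
        unfolding outflow1_def outflow2_def s \<kappa>_def[symmetric] e unfolding cP_def
        by (use \<kappa> in \<open>simp add: divide_simps\<close>, use \<kappa>_def in algebra)+
      moreover have "a1 0 = \<phi> 0" "a2 0 = \<psi> 0"
        unfolding a1_def a2_def cP_def cQ_def
        by (use \<kappa> in \<open>simp add: divide_simps\<close>, use \<kappa>_def in algebra)+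
      ultimately show "a1 0 = - k1 * outflow1 l h1 h2 (a1 l) (a2 l)" "a2 0 = - k2 * outflow2 l h1 h2 (a1 l) (a2 l)"
        using fg(3,4) \<phi>(2) \<psi>(2) l by simp_all
    qed
    have tri: "weighted_max c1 c2 (a1 x) (a2 x) \<le> weighted_max c1 c2 (a1 0) (a2 0) + J * norm r" if "x \<in> {0..l}" for x
      using weighted_max_triangle[OF \<rho>(3,4), of "a1 0" "a1 x - a1 0" "a2 0" "a2 x - a2 0"] a[OF that] by simp
    have "weighted_max c1 c2 (a1 0) (a2 0) \<le> \<rho> * weighted_max c1 c2 (a1 l) (a2 l)"
      using contr[of "a1 l" "a2 l"] by (simp only: bc[symmetric])
    also have "\<dots> \<le> \<rho> * (weighted_max c1 c2 (a1 0) (a2 0) + J * norm r)"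
      using tri[of l] l \<rho> by (intro mult_left_mono) auto
    finally have "(1 - \<rho>) * weighted_max c1 c2 (a1 0) (a2 0) \<le> \<rho> * (J * norm r)"
      by (simp add: algebra_simps)
    then have "weighted_max c1 c2 (a1 0) (a2 0) \<le> \<rho> * (J * norm r) / (1 - \<rho>)"
      using \<rho> by (simp add: pos_le_divide_eq mult.commute)
    then have bound: "weighted_max c1 c2 (a1 x) (a2 x) \<le> J / (1 - \<rho>) * norm r" if "x \<in> {0..l}" for x
    proof -
      have "\<rho> * (J * norm r) / (1 - \<rho>) + J * norm r = J / (1 - \<rho>) * norm r"
        using \<rho> by (simp add: divide_simps) (simp add: algebra_simps)
      then show ?thesis using tri[OF that] \<open>weighted_max c1 c2 (a1 0) (a2 0) \<le> \<rho> * (J * norm r) / (1 - \<rho>)\<close> by linarith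
    qed
    have "AE x in lborel. x \<in> {0<..<l} \<longrightarrow> rep_L2 (h2 *\<^sub>R f + h1 *\<^sub>R g) x = h2 * \<phi> x + h1 * \<psi> x"
      "AE x in lborel. x \<in> {0<..<l} \<longrightarrow> rep_L2 (1 *\<^sub>R f + (- 1) *\<^sub>R g) x = 1 * \<phi> x + (- 1) * \<psi> x"
      using P Q unfolding H1_rep_def by blast+
    note ae = this[THEN AE_completion, THEN AE_lebesgue_reflect]
    have mp: "mean_part h1 h2 w = h2 *\<^sub>R f + h1 *\<^sub>R g" "diff_part w = 1 *\<^sub>R f + (- 1) *\<^sub>R g"
      by (simp_all add: mean_part_def diff_part_def w_eq)
    show ?thesis
      using ae
    proof eventually_elim
      case (elim t)
      show ?case
      proof
        assume t: "t \<in> {- l<..<0}"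
        have "inflow1 h1 h2 w u1 t = a1 (- t)" "inflow2 h1 h2 w u2 t = a2 (- t)"
        proof -
          have rp: "rep_L2 (mean_part h1 h2 w) (- t) = h2 * \<phi> (- t) + h1 * \<psi> (- t)"
            "rep_L2 (diff_part w) (- t) = \<phi> (- t) - \<psi> (- t)"
            using elim t unfolding mp by auto
          have ex: "exp (- (h1 + h2) * t) = exp (\<kappa> * (- t))" by (simp add: \<kappa>_def algebra_simps)
          show "inflow1 h1 h2 w u1 t = a1 (- t)" "inflow2 h1 h2 w u2 t = a2 (- t)"
            unfolding inflow1_def inflow2_def rp ex a1_def a2_def cP_def cQ_def \<kappa>_def[symmetric]
            using t by simp_all
        qed
        then show "weighted_max c1 c2 (inflow1 h1 h2 w u1 t) (inflow2 h1 h2 w u2 t) \<le> J / (1 - \<rho>) * norm (exchanger_op l h1 h2 w)"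
          using bound[of "- t"] t by (simp add: r_def)
      qed
    qed
  qed
  show ?thesis
    by (rule exI[of _ "J / (1 - \<rho>)"]) (use main J0 \<rho> in auto)
qed

text \<open>Transporting the initial state back in time multiplies the difference part by at most
  e^(\<kappa> l), which bounds the trace on the initial window by the norm of the state.\<close>

lemma inflow_square_bound:
  fixes l h1 h2 :: real
  assumes l: "0 < l" and h: "0 < h1" "0 < h2"
  shows "\<exists>C\<ge>0. \<forall>z0\<in>state_space l. \<forall>u1 u2.
     integral {- l..0} (\<lambda>s. (inflow1 h1 h2 z0 u1 s)\<^sup>2 + (inflow2 h1 h2 z0 u2 s)\<^sup>2) \<le> C * (norm z0)\<^sup>2"
proof -
  define \<kappa> where "\<kappa> = h1 + h2"
  have \<kappa>: "0 < \<kappa>" using h by (simp add: \<kappa>_def)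
  define A where "A = 4 / \<kappa>\<^sup>2"
  define B where "B = 2 * (h1\<^sup>2 + h2\<^sup>2) * (exp (\<kappa> * l))\<^sup>2 / \<kappa>\<^sup>2"
  have AB: "0 \<le> A" "0 \<le> B" by (simp_all add: A_def B_def)
  have main: "integral {- l..0} (\<lambda>s. (inflow1 h1 h2 z0 u1 s)\<^sup>2 + (inflow2 h1 h2 z0 u2 s)\<^sup>2) \<le> (A * \<kappa>\<^sup>2 + B * 4) * (norm z0)\<^sup>2"
    if z0: "z0 \<in> state_space l" for z0 u1 u2
  proof -
    let ?p = "rep_L2 (mean_part h1 h2 z0)" and ?q = "rep_L2 (diff_part z0)"
    define v1 where "v1 = (\<lambda>y. (?p y + h1 * (exp (\<kappa> * y) * ?q y)) / \<kappa>)"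
    define v2 where "v2 = (\<lambda>y. (?p y - h2 * (exp (\<kappa> * y) * ?q y)) / \<kappa>)"
    note np = norm_L2_space[OF mean_part_in_L2_space[OF z0, of h1 h2]]
    note nq = norm_L2_space[OF diff_part_in_L2_space[OF z0]]
    have sq: "(x + y)\<^sup>2 \<le> 2 * x\<^sup>2 + 2 * y\<^sup>2" for x y :: real
      using zero_le_power2[of "x - y"] unfolding power2_sum power2_diff by linarith
    have pt: "(v1 y)\<^sup>2 + (v2 y)\<^sup>2 \<le> A * (?p y)\<^sup>2 + B * (?q y)\<^sup>2" if y: "y \<in> {0..l}" for y
    proof -
      have e: "(exp (\<kappa> * y))\<^sup>2 \<le> (exp (\<kappa> * l))\<^sup>2" using y \<kappa> by (intro power_mono) auto
      have "(c * (exp (\<kappa> * y) * ?q y))\<^sup>2 \<le> c\<^sup>2 * ((exp (\<kappa> * l))\<^sup>2 * (?q y)\<^sup>2)" for c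
        unfolding power_mult_distrib using e by (intro mult_left_mono mult_right_mono) auto
      then have "(?p y + c * (exp (\<kappa> * y) * ?q y))\<^sup>2 \<le> 2 * (?p y)\<^sup>2 + 2 * (c\<^sup>2 * ((exp (\<kappa> * l))\<^sup>2 * (?q y)\<^sup>2))" for c
        using sq[of "?p y" "c * (exp (\<kappa> * y) * ?q y)"] by (smt (verit))
      from this[of h1] this[of "- h2"]
      have "(?p y + h1 * (exp (\<kappa> * y) * ?q y))\<^sup>2 + (?p y - h2 * (exp (\<kappa> * y) * ?q y))\<^sup>2
        \<le> 4 * (?p y)\<^sup>2 + 2 * (h1\<^sup>2 + h2\<^sup>2) * (exp (\<kappa> * l))\<^sup>2 * (?q y)\<^sup>2"
        by (simp add: algebra_simps)
      then have "((?p y + h1 * (exp (\<kappa> * y) * ?q y))\<^sup>2 + (?p y - h2 * (exp (\<kappa> * y) * ?q y))\<^sup>2) / \<kappa>\<^sup>2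
        \<le> (4 * (?p y)\<^sup>2 + 2 * (h1\<^sup>2 + h2\<^sup>2) * (exp (\<kappa> * l))\<^sup>2 * (?q y)\<^sup>2) / \<kappa>\<^sup>2"
        by (rule divide_right_mono) simp
      then show ?thesis
        by (simp only: v1_def v2_def A_def B_def power_divide add_divide_distrib[symmetric] times_divide_eq_left)
    qed
    \<comment> \<open>The functions \<open>u1\<close>, \<open>u2\<close> are arbitrary here, but on
      [-l, 0] the inflow coincides with that for zero input, for which integrability is
      known.\<close>
    have L0: "L2_loc {0..} (\<lambda>s. 0)" by (simp add: L2_loc_def)
    have i: "(\<lambda>s. (inflow1 h1 h2 z0 (\<lambda>s. 0) s)\<^sup>2) integrable_on {- l..0}" "(\<lambda>s. (inflow2 h1 h2 z0 (\<lambda>s. 0) s)\<^sup>2) integrable_on {- l..0}"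
      by (intro locally_square_integrable_imp(2) locally_square_integrable_inflow L0)+
    have eq: "(inflow1 h1 h2 z0 u1 s)\<^sup>2 + (inflow2 h1 h2 z0 u2 s)\<^sup>2 = (inflow1 h1 h2 z0 (\<lambda>s. 0) s)\<^sup>2 + (inflow2 h1 h2 z0 (\<lambda>s. 0) s)\<^sup>2"
      "(inflow1 h1 h2 z0 u1 s)\<^sup>2 + (inflow2 h1 h2 z0 u2 s)\<^sup>2 = (v1 (- s))\<^sup>2 + (v2 (- s))\<^sup>2" if "s \<in> {- l..0}" for s
    proof -
      have ex: "exp (- (h1 + h2) * s) = exp (\<kappa> * (- s))" by (simp add: \<kappa>_def algebra_simps)
      show "(inflow1 h1 h2 z0 u1 s)\<^sup>2 + (inflow2 h1 h2 z0 u2 s)\<^sup>2 = (inflow1 h1 h2 z0 (\<lambda>s. 0) s)\<^sup>2 + (inflow2 h1 h2 z0 (\<lambda>s. 0) s)\<^sup>2"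
        "(inflow1 h1 h2 z0 u1 s)\<^sup>2 + (inflow2 h1 h2 z0 u2 s)\<^sup>2 = (v1 (- s))\<^sup>2 + (v2 (- s))\<^sup>2"
        unfolding inflow1_def inflow2_def ex v1_def v2_def \<kappa>_def[symmetric] using that by simp_all
    qed
    have ip: "(\<lambda>s. A * (?p (0 - s))\<^sup>2 + B * (?q (0 - s))\<^sup>2) integrable_on {- l..0}"
    proof -
      have "(\<lambda>y. A * (?p y)\<^sup>2 + B * (?q y)\<^sup>2) integrable_on {0..l}"
        by (intro integrable_add integrable_on_mult_right rep_L2_square_integrable_on)
      then show ?thesis
        using has_integral_reflect_shift[of "\<lambda>y. A * (?p y)\<^sup>2 + B * (?q y)\<^sup>2" _ 0 0 "- l"]
        by (auto simp: integrable_on_def)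
    qed
    have "integral {- l..0} (\<lambda>s. (inflow1 h1 h2 z0 u1 s)\<^sup>2 + (inflow2 h1 h2 z0 u2 s)\<^sup>2)
      \<le> integral {- l..0} (\<lambda>s. A * (?p (0 - s))\<^sup>2 + B * (?q (0 - s))\<^sup>2)"
    proof (rule integral_le[OF _ ip])
      have "(\<lambda>s. (inflow1 h1 h2 z0 (\<lambda>s. 0) s)\<^sup>2 + (inflow2 h1 h2 z0 (\<lambda>s. 0) s)\<^sup>2) integrable_on {- l..0}"
        by (intro integrable_add i)
      then show "(\<lambda>s. (inflow1 h1 h2 z0 u1 s)\<^sup>2 + (inflow2 h1 h2 z0 u2 s)\<^sup>2) integrable_on {- l..0}"
        by (rule integrable_eq) (simp add: eq(1))
      show "(inflow1 h1 h2 z0 u1 s)\<^sup>2 + (inflow2 h1 h2 z0 u2 s)\<^sup>2 \<le> A * (?p (0 - s))\<^sup>2 + B * (?q (0 - s))\<^sup>2"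
        if "s \<in> {- l..0}" for s
        unfolding eq(2)[OF that] using pt[of "- s"] that by simp
    qed
    also have "\<dots> = integral {0..l} (\<lambda>y. A * (?p y)\<^sup>2 + B * (?q y)\<^sup>2)"
      using integral_reflect_shift[of "- l" 0 "\<lambda>y. A * (?p y)\<^sup>2 + B * (?q y)\<^sup>2" 0] by simp
    also have "\<dots> = A * integral {0..l} (\<lambda>y. (?p y)\<^sup>2) + B * integral {0..l} (\<lambda>y. (?q y)\<^sup>2)"
      by (simp add: integral_add integrable_on_mult_right rep_L2_square_integrable_on)
    also have "\<dots> = A * (norm (mean_part h1 h2 z0))\<^sup>2 + B * (norm (diff_part z0))\<^sup>2"
      by (simp only: np nq)
    also have "\<dots> \<le> A * (\<kappa> * norm z0)\<^sup>2 + B * (2 * norm z0)\<^sup>2"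
      using mean_diff_part_norm_le[OF h, of z0] AB
      by (intro add_mono mult_left_mono power_mono) (auto simp: \<kappa>_def)
    also have "\<dots> = (A * \<kappa>\<^sup>2 + B * 4) * (norm z0)\<^sup>2" by (simp add: power_mult_distrib algebra_simps)
    finally show ?thesis .
  qed
  show ?thesis
    by (rule exI[of _ "A * \<kappa>\<^sup>2 + B * 4"]) (use main AB in auto)
qed

text \<open>A coordinate \<open>a * v1 + b * v2\<close> with coefficients of size at most d has norm
  at most d times 2 sqrt V. Here d is \<open>h1 + h2\<close> for the mean part and 1 for the
  difference part, so \<open>mean_diff_part_bound\<close> gives 4 + 2 = 6.\<close>

lemma norm_le_boundary_trace:
  assumes l: "0 < l" and h: "0 < h1" "0 < h2" and z: "z \<in> state_space l"
    and tr: "boundary_trace l h1 h2 z t v1 v2"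
    and v: "locally_square_integrable v1" "locally_square_integrable v2"
  shows "norm z \<le> 6 * sqrt (integral {t - l..t} (\<lambda>s. (v1 s)\<^sup>2 + (v2 s)\<^sup>2))"
proof -
  define V where "V = integral {t - l..t} (\<lambda>s. (v1 s)\<^sup>2 + (v2 s)\<^sup>2)"
  have iV: "(\<lambda>s. (v1 s)\<^sup>2 + (v2 s)\<^sup>2) integrable_on {t - l..t}"
    by (intro integrable_add locally_square_integrable_imp v)
  have V0: "0 \<le> V" unfolding V_def by (rule integral_nonneg[OF iV]) simp
  have *: "norm f \<le> d * (2 * sqrt V)"
    if f: "f \<in> L2_space l" "0 \<le> \<kappa>" and F: "\<And>x. x \<in> {0..l} \<Longrightarrow> weighted_primitive \<kappa> f x = integral {t - x..t} (\<lambda>s. a * v1 s + b * v2 s)"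
      and ab: "\<bar>a\<bar> \<le> d" "\<bar>b\<bar> \<le> d" for f \<kappa> a b d
  proof -
    note L = locally_square_integrable_lincomb[OF v, of a b]
    have d: "a\<^sup>2 \<le> d\<^sup>2" "b\<^sup>2 \<le> d\<^sup>2" "0 \<le> d" using ab by (auto simp: abs_le_square_iff[symmetric])
    have "(norm f)\<^sup>2 \<le> integral {t - l..t} (\<lambda>s. (a * v1 s + b * v2 s)\<^sup>2)"
      by (rule norm_L2_le_trace[OF f _ _ F]) (use locally_square_integrable_imp[OF L] in auto)
    also have "\<dots> \<le> integral {t - l..t} (\<lambda>s. (4 * d\<^sup>2) * ((v1 s)\<^sup>2 + (v2 s)\<^sup>2))"
    proof (rule integral_le)
      fix s
      have "(a * v1 s + b * v2 s)\<^sup>2 \<le> 2 * (a * v1 s)\<^sup>2 + 2 * (b * v2 s)\<^sup>2"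
        using zero_le_power2[of "a * v1 s - b * v2 s"] unfolding power2_sum power2_diff by linarith
      also have "\<dots> \<le> 2 * (d\<^sup>2 * (v1 s)\<^sup>2) + 2 * (d\<^sup>2 * (v2 s)\<^sup>2)"
        unfolding power_mult_distrib using d by (intro add_mono mult_left_mono mult_right_mono) auto
      also have "\<dots> \<le> (4 * d\<^sup>2) * ((v1 s)\<^sup>2 + (v2 s)\<^sup>2)" by (simp add: algebra_simps)
      finally show "(a * v1 s + b * v2 s)\<^sup>2 \<le> (4 * d\<^sup>2) * ((v1 s)\<^sup>2 + (v2 s)\<^sup>2)" .
    qed (intro locally_square_integrable_imp L integrable_on_mult_right iV)+
    also have "\<dots> = (d * (2 * sqrt V))\<^sup>2" using V0 by (simp add: V_def power_mult_distrib)
    finally show ?thesis by (rule power2_le_imp_le) (use d V0 in simp)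
  qed
  have P: "norm (mean_part h1 h2 z) \<le> (h1 + h2) * (2 * sqrt V)"
    by (rule *[where \<kappa> = 0 and a = h2 and b = h1, OF mean_part_in_L2_space[OF z]]) (use tr h in \<open>auto simp: boundary_trace_def\<close>)
  have Q: "norm (diff_part z) \<le> 1 * (2 * sqrt V)"
    by (rule *[where \<kappa> = "h1 + h2" and a = 1 and b = "-1", OF diff_part_in_L2_space[OF z]]) (use tr h in \<open>auto simp: boundary_trace_def\<close>)
  have "norm z \<le> 2 / (h1 + h2) * norm (mean_part h1 h2 z) + norm (diff_part z)"
    by (rule mean_diff_part_bound[OF h])
  also have "\<dots> \<le> 2 / (h1 + h2) * ((h1 + h2) * (2 * sqrt V)) + 1 * (2 * sqrt V)"
    using h by (intro add_mono mult_left_mono P Q) auto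
  also have "\<dots> = 6 * sqrt V" using h by simp
  finally show ?thesis by (simp add: V_def)
qed

section \<open>Decay of the closed loop\<close>

text \<open>The error \<mu> decays like r^n and feeds a recursion with the same factor r, so m
  itself may grow like n r^n. The larger rate \<sigma> absorbs the factor n.\<close>

lemma coupled_geometric_decay:
  fixes m \<mu> :: "nat \<Rightarrow> real"
  assumes r: "0 \<le> r" "r < \<sigma>" and B: "0 \<le> B" and m: "\<And>n. 0 \<le> m n"
    and \<mu>0: "\<mu> 0 \<le> B" and \<mu>: "\<And>n. \<mu> (Suc n) \<le> r * \<mu> n"
    and rec: "\<And>n. m (Suc n) \<le> r * (m n + \<mu> n)"
  shows "m n \<le> \<sigma> ^ n * (m 0 + r / (\<sigma> - r) * B)"
proof -
  \<comment> \<open>Chosen so that \<open>r * (1 + b) = \<sigma> * b\<close>. Then the sum of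
    \<open>m n\<close> and b times the bound r^n B of the error shrinks by \<sigma> in each
    step.\<close>
  define b where "b = r / (\<sigma> - r)"
  have b: "0 \<le> b" "r * (1 + b) = \<sigma> * b" using r by (simp_all add: b_def divide_simps)
  have \<mu>n: "\<mu> n \<le> r ^ n * B" for n
  proof (induction n)
    case (Suc n)
    have "\<mu> (Suc n) \<le> r * \<mu> n" by (rule \<mu>)
    also have "\<dots> \<le> r * (r ^ n * B)" using Suc r by (intro mult_left_mono) auto
    finally show ?case by simp
  qed (use \<mu>0 in simp)
  have "m n + b * (r ^ n * B) \<le> \<sigma> ^ n * (m 0 + b * B)"
  proof (induction n)
    case (Suc n)
    have "m (Suc n) + b * (r ^ Suc n * B) \<le> r * (m n + \<mu> n) + b * (r * (r ^ n * B))"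
      using rec[of n] by (simp add: mult.assoc)
    also have "\<dots> \<le> r * (m n + r ^ n * B) + b * (r * (r ^ n * B))"
      using \<mu>n[of n] r by (intro add_right_mono mult_left_mono add_left_mono) auto
    also have "\<dots> = r * m n + (r * (1 + b)) * (r ^ n * B)" by (simp add: algebra_simps)
    also have "\<dots> \<le> \<sigma> * m n + (\<sigma> * b) * (r ^ n * B)"
      unfolding b(2) using r m[of n] by (intro add_right_mono mult_right_mono) auto
    also have "\<dots> = \<sigma> * (m n + b * (r ^ n * B))" by (simp add: algebra_simps)
    also have "\<dots> \<le> \<sigma> * (\<sigma> ^ n * (m 0 + b * B))" using Suc r by (intro mult_left_mono) auto
    finally show ?case by simp
  qed simp
  moreover have "0 \<le> b * (r ^ n * B)" using b r B by simp
  ultimately show ?thesis by (simp add: b_def)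
qed

text \<open>The window ending at T is covered by two consecutive windows of the lattice of multiples
  of l, each a translate of [-l, 0]. As \<theta> is at most 1, both carry at most the factor for k =
  floor(T / l), hence the 2.\<close>

lemma window_integral_decay:
  fixes f G :: "real \<Rightarrow> real"
  assumes l: "0 < l" and \<theta>: "0 \<le> \<theta>" "\<theta> \<le> 1" and T: "0 \<le> T"
    and f: "\<And>a b. f integrable_on {a..b}" "\<And>s. 0 \<le> f s"
    and G: "G integrable_on {- l..0}" "\<And>s. 0 \<le> G s"
    and le: "AE s in lebesgue. s \<in> {- l<..<0} \<longrightarrow> (\<forall>n. f (s + real n * l) \<le> \<theta> ^ n * G s)"
  shows "integral {T - l..T} f \<le> 2 * \<theta> ^ nat \<lfloor>T / l\<rfloor> * integral {- l..0} G"
proof -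
  define k where "k = nat \<lfloor>T / l\<rfloor>"
  have "real k \<le> T / l" "T / l < real k + 1" using T l by (simp_all add: k_def)
  then have k: "real k * l \<le> T" "T \<le> real k * l + l"
    using l by (simp_all add: field_simps)
  define I where "I = integral {- l..0} G"
  have I0: "0 \<le> I" unfolding I_def by (rule integral_nonneg[OF G(1)]) (rule G(2))
  have win: "integral {real n * l - l..real n * l} f \<le> \<theta> ^ n * I" for n
  proof -
    have sh: "integral {- l..0} (\<lambda>s. f (s + real n * l)) = integral {real n * l - l..real n * l} f"
      using integral_shift_real_ivl[of "real n * l - l" "real n * l" "real n * l" f] by simp
    have i: "(\<lambda>s. f (s + real n * l)) integrable_on {- l..0}"
    proof -
      \<comment> \<open>Two reflections compose to the shift by n l.\<close>
      have "(\<lambda>s. f (- s)) integrable_on {- (real n * l)..l - real n * l}"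
        using has_integral_reflect_shift[of f _ 0 "l - real n * l" "- (real n * l)"] f(1)[of "real n * l - l" "real n * l"]
        by (auto simp: integrable_on_def)
      then show ?thesis
        using has_integral_reflect_shift[of "\<lambda>s. f (- s)" _ "- (real n * l)" 0 "- l"]
        by (auto simp: integrable_on_def add.commute)
    qed
    obtain N where N: "negligible N" "{s. \<not> (s \<in> {- l<..<0} \<longrightarrow> (\<forall>n. f (s + real n * l) \<le> \<theta> ^ n * G s))} \<subseteq> N"
      using le by (auto simp: eventually_ae_filter_negligible)
    \<comment> \<open>The shifted function is changed on a null set, so that the comparison holds at
      every point as \<open>integral_le\<close> demands.\<close>
    define g where "g = (\<lambda>s. if s \<in> N \<union> {- l, 0} then \<theta> ^ n * G s else f (s + real n * l))"
    have Nn: "negligible (N \<union> {- l, 0})" using N by simp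
    have ig: "g integrable_on {- l..0}" "integral {- l..0} g = integral {- l..0} (\<lambda>s. f (s + real n * l))"
      using integrable_spike[OF i Nn, of g] integral_spike[OF Nn, of "{- l..0}" g "\<lambda>s. f (s + real n * l)"]
      by (auto simp: g_def)
    have "integral {- l..0} g \<le> integral {- l..0} (\<lambda>s. \<theta> ^ n * G s)"
    proof (rule integral_le[OF ig(1)])
      show "(\<lambda>s. \<theta> ^ n * G s) integrable_on {- l..0}" by (intro integrable_on_mult_right G)
      show "g s \<le> \<theta> ^ n * G s" if "s \<in> {- l..0}" for s
      proof (cases "s \<in> N \<union> {- l, 0}")
        case False
        then have "s \<in> {- l<..<0} \<longrightarrow> (\<forall>n. f (s + real n * l) \<le> \<theta> ^ n * G s)"
          using N(2) by blast
        then show ?thesis using False that by (auto simp: g_def)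
      qed (simp add: g_def)
    qed
    then show ?thesis by (simp add: ig(2) sh I_def)
  qed
  have "integral {T - l..T} f \<le> integral {real k * l - l..real k * l + l} f"
    by (rule integral_subset_le) (use k f in auto)
  also have "\<dots> = integral {real k * l - l..real k * l} f + integral {real k * l..real k * l + l} f"
    by (rule Henstock_Kurzweil_Integration.integral_combine[symmetric]) (use l f in auto)
  also have "{real k * l..real k * l + l} = {real (Suc k) * l - l..real (Suc k) * l}"
    by (simp add: algebra_simps)
  also have "integral {real k * l - l..real k * l} f + integral {real (Suc k) * l - l..real (Suc k) * l} f
      \<le> \<theta> ^ k * I + \<theta> ^ Suc k * I"
    by (intro add_mono win)
  also have "\<dots> \<le> 2 * \<theta> ^ k * I"
  proof -
    have "\<theta> ^ Suc k * I \<le> \<theta> ^ k * I"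
      using \<theta> I0 by (intro mult_right_mono power_decreasing) auto
    then show ?thesis by linarith
  qed
  finally show ?thesis unfolding k_def I_def .
qed

lemma outflow_diff:
  "outflow1 l h1 h2 a1 a2 - outflow1 l h1 h2 b1 b2 = outflow1 l h1 h2 (a1 - b1) (a2 - b2)"
  "outflow2 l h1 h2 a1 a2 - outflow2 l h1 h2 b1 b2 = outflow2 l h1 h2 (a1 - b1) (a2 - b2)"
  by (simp_all add: outflow1_def outflow2_def algebra_simps flip: diff_divide_distrib)

text \<open>Along an orbit s + n l with s in (-l, 0), the weighted norms of plant trace and error
  trace satisfy the recursions of \<open>coupled_geometric_decay\<close>. The initial error trace is
  bounded, but the initial plant trace is only square integrable, so the pointwise estimate is
  squared and integrated over s before the state is recovered from one window.\<close>

lemma closed_loop_decay: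
  fixes l h1 h2 \<tau> k1 k2 \<rho> c1 c2 \<gamma>\<^sub>0 \<gamma> :: real
  assumes l: "0 < l" and h: "0 < h1" "0 < h2" and \<tau>: "0 < \<tau>" "\<tau> < l"
    and \<rho>: "0 < \<rho>" "0 < c1" "0 < c2" "\<rho> \<le> exp (- \<gamma>\<^sub>0 * l)"
    and contr: "\<And>a1 a2. weighted_max c1 c2 (- k1 * outflow1 l h1 h2 a1 a2) (- k2 * outflow2 l h1 h2 a1 a2)
       \<le> \<rho> * weighted_max c1 c2 a1 a2"
    and \<gamma>: "0 < \<gamma>" "\<gamma> < \<gamma>\<^sub>0"
  shows "\<exists>D>0. \<forall>z0\<in>state_space l. \<forall>zh0\<in>state_space l. zh0 - z0 \<in> dom_AK l k1 k2 \<longrightarrow>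
    (\<forall>z zp zm u1 u2 y1 y2 q1 q2. closed_loop l h1 h2 \<tau> k1 k2 z0 zh0 z zp zm u1 u2 y1 y2 q1 q2 \<longrightarrow>
      (\<forall>t>\<tau>. norm (z t) \<le> D * exp (- \<gamma> * t) * (norm z0 + norm (exchanger_op l h1 h2 (zh0 - z0)))))"
proof -
  define r where "r = exp (- \<gamma>\<^sub>0 * l)"
  define \<sigma> where "\<sigma> = exp (- \<gamma> * l)"
  have \<gamma>l: "0 < \<gamma> * l" "\<gamma> * l < \<gamma>\<^sub>0 * l" using \<gamma> l by simp_all
  have r: "0 \<le> r" "r < \<sigma>" "\<sigma> < 1" "0 < \<sigma>" "r < 1"
    using \<gamma>l by (simp_all add: r_def \<sigma>_def)
  define b where "b = r / (\<sigma> - r)"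
  have \<rho>r: "\<rho> \<le> r" using \<rho>(4) by (simp only: r_def)
  then have "\<rho> < 1" using r(5) by linarith
  from dom_AK_inflow_bound[OF l h \<rho>(1) this \<rho>(2,3) contr]
  obtain C2 where C2: "0 \<le> C2" "\<And>w u1 u2. w \<in> dom_AK l k1 k2 \<Longrightarrow> AE t in lebesgue. t \<in> {- l<..<0} \<longrightarrow>
     weighted_max c1 c2 (inflow1 h1 h2 w u1 t) (inflow2 h1 h2 w u2 t) \<le> C2 * norm (exchanger_op l h1 h2 w)"
    by blast
  from inflow_square_bound[OF l h] obtain C1 where C1: "0 \<le> C1" "\<And>z0 u1 u2. z0 \<in> state_space l \<Longrightarrow>
     integral {- l..0} (\<lambda>s. (inflow1 h1 h2 z0 u1 s)\<^sup>2 + (inflow2 h1 h2 z0 u2 s)\<^sup>2) \<le> C1 * (norm z0)\<^sup>2"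
    by blast
  \<comment> \<open>\<open>K1\<close> and \<open>K2\<close> collect the comparison of the square of
    the weighted maximum with the sum of squares in both directions, and the inequality (x + y)^2
    \<le> 2 x^2 + 2 y^2.\<close>
  define K1 where "K1 = 2 * (c1\<^sup>2 + c2\<^sup>2) * (1 / c1\<^sup>2 + 1 / c2\<^sup>2)"
  define K2 where "K2 = 2 * (c1\<^sup>2 + c2\<^sup>2) * b\<^sup>2"
  have K0: "0 \<le> K1" "0 \<le> K2" by (simp_all add: K1_def K2_def)
  define Q where "Q = K1 * C1 + l * K2 * C2\<^sup>2"
  have Q0: "0 \<le> Q" using K0 C1 l by (simp add: Q_def)
  \<comment> \<open>The factors come from \<open>norm_le_boundary_trace\<close> (6), the two windows
    (2 Q) and the rounding of t / l to an integer; adding 1 keeps \<open>D\<close> positive when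
    \<open>Q\<close> is 0.\<close>
  define D where "D = 6 * sqrt (2 * Q) * exp (\<gamma> * l) + 1"
  have D0: "0 < D" using Q0 by (simp add: D_def add_nonneg_pos)
  have main: "norm (z t) \<le> D * exp (- \<gamma> * t) * (norm z0 + norm (exchanger_op l h1 h2 (zh0 - z0)))"
    if z0: "z0 \<in> state_space l" and zh0: "zh0 \<in> state_space l" and w: "zh0 - z0 \<in> dom_AK l k1 k2"
      and cl: "closed_loop l h1 h2 \<tau> k1 k2 z0 zh0 z zp zm u1 u2 y1 y2 q1 q2" and t\<tau>: "\<tau> < t"
    for z0 zh0 z zp zm u1 u2 y1 y2 q1 q2 t
  proof (rule closed_loop_traces[OF l h \<tau>(1) z0 zh0 cl])
    fix v1 v2 w1 w2
    assume lv: "locally_square_integrable v1" "locally_square_integrable v2"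
      and zS: "\<And>t. 0 \<le> t \<Longrightarrow> z t \<in> state_space l"
      and tr: "\<And>t. 0 \<le> t \<Longrightarrow> boundary_trace l h1 h2 (z t) t v1 v2"
      and v0: "\<And>t. t \<le> 0 \<Longrightarrow> v1 t = inflow1 h1 h2 z0 u1 t" "\<And>t. t \<le> 0 \<Longrightarrow> v2 t = inflow2 h1 h2 z0 u2 t"
      and w0: "\<And>t. t \<le> 0 \<Longrightarrow> w1 t = inflow1 h1 h2 zh0 u1 t" "\<And>t. t \<le> 0 \<Longrightarrow> w2 t = inflow2 h1 h2 zh0 u2 t"
      and dev: "AE t in lebesgue. 0 < t \<longrightarrow>
         w1 t - v1 t = - k1 * (outflow1 l h1 h2 (w1 (t - l)) (w2 (t - l)) - outflow1 l h1 h2 (v1 (t - l)) (v2 (t - l))) \<and>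
         w2 t - v2 t = - k2 * (outflow2 l h1 h2 (w1 (t - l)) (w2 (t - l)) - outflow2 l h1 h2 (v1 (t - l)) (v2 (t - l)))"
      and zero: "AE t in lebesgue. 0 < t \<and> t \<le> \<tau> \<longrightarrow> v1 t = 0 \<and> v2 t = 0"
      and rec': "\<tau> < l \<Longrightarrow> AE t in lebesgue. \<tau> < t \<longrightarrow>
         v1 t = - k1 * outflow1 l h1 h2 (w1 (t - l)) (w2 (t - l)) \<and>
         v2 t = - k2 * outflow2 l h1 h2 (w1 (t - l)) (w2 (t - l))"
    note rec = rec'[OF \<tau>(2)]
    have t: "0 \<le> t" using t\<tau> \<tau>(1) by simp
    define R where "R = norm (exchanger_op l h1 h2 (zh0 - z0))"
    define B where "B = C2 * R"
    have B0: "0 \<le> B" using C2 by (simp add: B_def R_def)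
    define m where "m = (\<lambda>t. weighted_max c1 c2 (v1 t) (v2 t))"
    define \<mu> where "\<mu> = (\<lambda>t. weighted_max c1 c2 (w1 t - v1 t) (w2 t - v2 t))"
    have m0: "0 \<le> m t" "0 \<le> \<mu> t" for t
      unfolding m_def \<mu>_def using weighted_max_nonneg \<rho> by blast+
    have A1: "AE t in lebesgue. 0 < t \<longrightarrow> \<mu> t \<le> r * \<mu> (t - l)"
      using dev
    proof eventually_elim
      case (elim t)
      show ?case
      proof
        assume "0 < t"
        then have "\<mu> t \<le> \<rho> * \<mu> (t - l)"
          using elim contr[of "w1 (t - l) - v1 (t - l)" "w2 (t - l) - v2 (t - l)"] by (simp only: \<mu>_def outflow_diff)
        also have "\<dots> \<le> r * \<mu> (t - l)" using \<rho>r m0 by (intro mult_right_mono) auto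
        finally show "\<mu> t \<le> r * \<mu> (t - l)" .
      qed
    qed
    \<comment> \<open>On (0, \<tau>] the trace is zero and the inequality is trivial, so the
      recursion needs no separate start-up phase.\<close>
    have A2: "AE t in lebesgue. 0 < t \<longrightarrow> m t \<le> r * (m (t - l) + \<mu> (t - l))"
      using zero rec
    proof eventually_elim
      case (elim t)
      show ?case
      proof
        assume t: "0 < t"
        show "m t \<le> r * (m (t - l) + \<mu> (t - l))"
        proof (cases "t \<le> \<tau>")
          case True
          then have "m t = 0" using elim t by (simp add: m_def weighted_max_def)
          then show ?thesis using r m0 by simp
        next
          case False
          then have "m t \<le> \<rho> * weighted_max c1 c2 (w1 (t - l)) (w2 (t - l))"
            using elim contr[of "w1 (t - l)" "w2 (t - l)"] by (simp only: m_def not_le)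
          also have "\<dots> \<le> \<rho> * (m (t - l) + \<mu> (t - l))"
            using weighted_max_triangle[OF \<rho>(2,3), of "v1 (t - l)" "w1 (t - l) - v1 (t - l)" "v2 (t - l)" "w2 (t - l) - v2 (t - l)"] \<rho>
            by (intro mult_left_mono) (auto simp: m_def \<mu>_def)
          also have "\<dots> \<le> r * (m (t - l) + \<mu> (t - l))"
            using \<rho>r m0 by (intro mult_right_mono add_nonneg_nonneg) auto
          finally show ?thesis .
        qed
      qed
    qed
    \<comment> \<open>On the initial window the error trace is the inflow of the initial error, by
      linearity.\<close>
    have A3: "AE t in lebesgue. t \<in> {- l<..<0} \<longrightarrow> \<mu> t \<le> B"
      using C2(2)[OF w, of u1 u2] inflow_diff[of h1 h2 zh0 z0 u1 u2]
    proof eventually_elim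
      case (elim t)
      then show ?case by (auto simp: \<mu>_def v0 w0 B_def R_def)
    qed
    define f where "f = (\<lambda>s. (v1 s)\<^sup>2 + (v2 s)\<^sup>2)"
    define G where "G = (\<lambda>s. K1 * f s + K2 * B\<^sup>2)"
    have fi: "f integrable_on {c..d}" for c d
      unfolding f_def by (intro integrable_add locally_square_integrable_imp lv)
    have f0: "0 \<le> f s" for s by (simp add: f_def)
    have le: "AE s in lebesgue. s \<in> {- l<..<0} \<longrightarrow> (\<forall>n. f (s + real n * l) \<le> (\<sigma>\<^sup>2) ^ n * G s)"
      using AE_all_integer_shifts[OF A1, of l] AE_all_integer_shifts[OF A2, of l] A3
    proof eventually_elim
      case (elim s)
      show ?case
      proof (intro impI allI)
        fix n assume s: "s \<in> {- l<..<0}"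
        \<comment> \<open>Starting in (-l, 0), the first step already lands at positive times, where
          \<open>A1\<close> and \<open>A2\<close> apply.\<close>
        have pos: "0 < s + real (Suc n) * l" for n
        proof -
          have "0 \<le> real n * l" using l by simp
          then have "l \<le> real (Suc n) * l" by (simp add: distrib_right)
          with s show ?thesis unfolding greaterThanLessThan_iff by linarith
        qed
        have shift: "s + real (Suc n) * l - l = s + real n * l" for n by (simp add: algebra_simps)
        have "m (s + real n * l) \<le> \<sigma> ^ n * (m (s + real 0 * l) + r / (\<sigma> - r) * B)"
        proof (rule coupled_geometric_decay[where m = "\<lambda>n. m (s + real n * l)" and \<mu> = "\<lambda>n. \<mu> (s + real n * l)", OF r(1,2) B0])
          show "\<mu> (s + real 0 * l) \<le> B" using elim(3) s by simp
          show "\<mu> (s + real (Suc n) * l) \<le> r * \<mu> (s + real n * l)" for n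
            using elim(1)[rule_format, of "int (Suc n)"] pos[of n] shift[of n] by (simp only: of_int_of_nat_eq)
          show "m (s + real (Suc n) * l) \<le> r * (m (s + real n * l) + \<mu> (s + real n * l))" for n
            using elim(2)[rule_format, of "int (Suc n)"] pos[of n] shift[of n] by (simp only: of_int_of_nat_eq)
        qed (rule m0)
        then have mle: "m (s + real n * l) \<le> \<sigma> ^ n * (m s + b * B)" by (simp add: b_def)
        have fm: "f t \<le> (c1\<^sup>2 + c2\<^sup>2) * (m t)\<^sup>2" for t
        proof -
          have "\<bar>v1 t\<bar> \<le> \<bar>m t * c1\<bar>" "\<bar>v2 t\<bar> \<le> \<bar>m t * c2\<bar>"
            using weighted_max_le_iff[OF \<rho>(2,3), of "v1 t" "v2 t" "m t"] by (auto simp: m_def)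
          then have "(v1 t)\<^sup>2 \<le> (m t * c1)\<^sup>2" "(v2 t)\<^sup>2 \<le> (m t * c2)\<^sup>2"
            unfolding abs_le_square_iff by blast+
          then show ?thesis by (simp add: f_def power_mult_distrib algebra_simps)
        qed
        have mf: "(m s)\<^sup>2 \<le> (1 / c1\<^sup>2 + 1 / c2\<^sup>2) * f s"
        proof -
          have "(m s)\<^sup>2 \<le> (v1 s)\<^sup>2 / c1\<^sup>2 + (v2 s)\<^sup>2 / c2\<^sup>2"
            unfolding m_def weighted_max_def max_def by (auto simp: power_divide)
          also have "\<dots> \<le> (1 / c1\<^sup>2 + 1 / c2\<^sup>2) * f s"
            by (simp add: f_def algebra_simps add_divide_distrib)
          finally show ?thesis .
        qed
        have "f (s + real n * l) \<le> (c1\<^sup>2 + c2\<^sup>2) * (m (s + real n * l))\<^sup>2" by (rule fm)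
        also have "\<dots> \<le> (c1\<^sup>2 + c2\<^sup>2) * (\<sigma> ^ n * (m s + b * B))\<^sup>2"
          using mle m0 by (intro mult_left_mono power_mono) auto
        also have "\<dots> = (\<sigma>\<^sup>2) ^ n * ((c1\<^sup>2 + c2\<^sup>2) * (m s + b * B)\<^sup>2)"
          by (simp add: power_mult_distrib mult_ac flip: power_mult)
        also have "\<dots> \<le> (\<sigma>\<^sup>2) ^ n * ((c1\<^sup>2 + c2\<^sup>2) * (2 * (m s)\<^sup>2 + 2 * (b * B)\<^sup>2))"
        proof (intro mult_left_mono)
          show "(m s + b * B)\<^sup>2 \<le> 2 * (m s)\<^sup>2 + 2 * (b * B)\<^sup>2"
            using zero_le_power2[of "m s - b * B"] unfolding power2_sum power2_diff by linarith
        qed auto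
        also have "\<dots> \<le> (\<sigma>\<^sup>2) ^ n * ((c1\<^sup>2 + c2\<^sup>2) * (2 * ((1 / c1\<^sup>2 + 1 / c2\<^sup>2) * f s) + 2 * (b * B)\<^sup>2))"
          using mf by (intro mult_left_mono add_mono) auto
        also have "(c1\<^sup>2 + c2\<^sup>2) * (2 * ((1 / c1\<^sup>2 + 1 / c2\<^sup>2) * f s) + 2 * (b * B)\<^sup>2) = G s"
        proof -
          have "p * (2 * (q * x) + 2 * (b * B)\<^sup>2) = 2 * p * q * x + 2 * p * b\<^sup>2 * B\<^sup>2" for p q x :: real
            by (simp add: power_mult_distrib algebra_simps)
          then show ?thesis unfolding G_def K1_def K2_def .
        qed
        finally show "f (s + real n * l) \<le> (\<sigma>\<^sup>2) ^ n * G s" .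
      qed
    qed
    have Gi: "G integrable_on {- l..0}"
      unfolding G_def by (intro integrable_add integrable_on_mult_right fi integrable_const_ivl)
    have G0: "0 \<le> G s" for s using K0 f0 by (simp add: G_def)
    have \<sigma>2: "0 \<le> \<sigma>\<^sup>2" "\<sigma>\<^sup>2 \<le> 1" using r by (auto intro: power_le_one)
    define k where "k = nat \<lfloor>t / l\<rfloor>"
    define S where "S = norm z0 + R"
    have S0: "0 \<le> S" by (simp add: S_def R_def)
    have IG: "integral {- l..0} G \<le> Q * S\<^sup>2"
    proof -
      have "integral {- l..0} G = K1 * integral {- l..0} f + l * K2 * B\<^sup>2"
        unfolding G_def using l by (subst integral_add) (auto intro: fi integrable_on_mult_right)
      also have "integral {- l..0} f = integral {- l..0} (\<lambda>s. (inflow1 h1 h2 z0 u1 s)\<^sup>2 + (inflow2 h1 h2 z0 u2 s)\<^sup>2)"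
        by (rule integral_cong) (simp add: f_def v0)
      also have "K1 * \<dots> + l * K2 * B\<^sup>2 \<le> K1 * (C1 * (norm z0)\<^sup>2) + l * K2 * B\<^sup>2"
        using C1(2)[OF z0] K0 by (intro add_right_mono mult_left_mono) auto
      also have "\<dots> = K1 * C1 * (norm z0)\<^sup>2 + l * K2 * C2\<^sup>2 * R\<^sup>2"
        by (simp add: B_def power_mult_distrib)
      also have "\<dots> \<le> K1 * C1 * S\<^sup>2 + l * K2 * C2\<^sup>2 * S\<^sup>2"
        using K0 C1 l by (intro add_mono mult_left_mono power_mono) (auto simp: S_def R_def)
      finally show ?thesis by (simp add: Q_def distrib_right)
    qed
    have "integral {t - l..t} f \<le> 2 * (\<sigma>\<^sup>2) ^ k * integral {- l..0} G"
      unfolding k_def by (rule window_integral_decay[OF l \<sigma>2 t fi f0 Gi G0 le])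
    also have "\<dots> \<le> 2 * (\<sigma>\<^sup>2) ^ k * (Q * S\<^sup>2)" using IG by (intro mult_left_mono) auto
    also have "\<dots> = 2 * Q * (\<sigma> ^ k * S)\<^sup>2" by (simp add: power_mult_distrib mult_ac flip: power_mult)
    finally have V: "sqrt (integral {t - l..t} f) \<le> sqrt (2 * Q) * (\<sigma> ^ k * S)"
      using real_sqrt_le_mono[of "integral {t - l..t} f" "2 * Q * (\<sigma> ^ k * S)\<^sup>2"] r S0 by (simp add: real_sqrt_mult)
    have \<sigma>k: "\<sigma> ^ k \<le> exp (\<gamma> * l) * exp (- \<gamma> * t)"
    proof -
      have "t / l < real k + 1" using t l by (simp add: k_def)
      then have "t \<le> real k * l + l" using l by (simp add: field_simps)
      then have "\<gamma> * t \<le> \<gamma> * (real k * l + l)" using \<gamma> by (intro mult_left_mono) auto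
      then have "real k * (- \<gamma> * l) \<le> \<gamma> * l + (- \<gamma> * t)" by (simp add: algebra_simps)
      then show ?thesis unfolding \<sigma>_def by (simp flip: exp_of_nat_mult exp_add)
    qed
    have "norm (z t) \<le> 6 * sqrt (integral {t - l..t} f)"
      unfolding f_def by (rule norm_le_boundary_trace[OF l h zS[OF t] tr[OF t] lv])
    also have "\<dots> \<le> 6 * (sqrt (2 * Q) * (\<sigma> ^ k * S))" using V by (intro mult_left_mono) auto
    also have "\<dots> \<le> 6 * (sqrt (2 * Q) * ((exp (\<gamma> * l) * exp (- \<gamma> * t)) * S))"
      using \<sigma>k S0 Q0 by (intro mult_left_mono mult_right_mono) auto
    also have "\<dots> = 6 * sqrt (2 * Q) * exp (\<gamma> * l) * (exp (- \<gamma> * t) * S)" by (simp only: mult_ac)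
    also have "\<dots> \<le> D * (exp (- \<gamma> * t) * S)" using S0 by (intro mult_right_mono) (auto simp: D_def)
    finally show ?thesis by (simp add: S_def R_def mult.assoc)
  qed
  show ?thesis
    by (intro exI[of _ D] conjI D0 ballI impI allI) (rule main)
qed

theorem theorem1p1:
  fixes l h1 h2 \<tau> k1 k2 :: real
  assumes "l > 0" and "h1 > 0" and "h2 > 0" and "\<tau> > 0"
    and "0 < k1" and "k1 < sqrt (h1 / h2)"
    and "0 < k2" and "k2 < sqrt (h2 / h1)"
  shows
    "(\<tau> > l \<longrightarrow>
       (\<exists>D>0. \<exists>\<omega>>0. \<forall>z0\<in>state_space l. \<forall>zh0\<in>state_space l. \<forall>z zp zm u1 u2 y1 y2 q1 q2.
          closed_loop l h1 h2 \<tau> k1 k2 z0 zh0 z zp zm u1 u2 y1 y2 q1 q2 \<longrightarrow>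
          (\<forall>t>\<tau>. norm (z t) \<le> D * exp (- \<omega> * t) * norm z0)))
     \<and>
     (\<forall>T M \<gamma>\<^sub>0 \<gamma>.
        C0_semigroup_on (state_space l) T \<and>
        generator_on (state_space l) T (dom_AK l k1 k2) (exchanger_op l h1 h2) \<and>
        M > 0 \<and> \<gamma>\<^sub>0 > 0 \<and>
        (\<forall>t\<ge>0. \<forall>x\<in>state_space l. norm (T t x) \<le> M * exp (- \<gamma>\<^sub>0 * t) * norm x) \<and>
        \<tau> \<le> l \<and> 0 < \<gamma> \<and> \<gamma> < \<gamma>\<^sub>0 \<longrightarrow>
        (\<exists>D\<^sub>\<tau>>0. \<exists>C\<^sub>\<tau>>0. \<forall>z0\<in>state_space l. \<forall>zh0\<in>state_space l. zh0 - z0 \<in> dom_AK l k1 k2 \<longrightarrow>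
          (\<forall>z zp zm u1 u2 y1 y2 q1 q2.
             closed_loop l h1 h2 \<tau> k1 k2 z0 zh0 z zp zm u1 u2 y1 y2 q1 q2 \<longrightarrow>
             (\<forall>t>\<tau>. norm (z t) \<le>
                D\<^sub>\<tau> * exp (- \<gamma> * t) *
                  (norm z0 + C\<^sub>\<tau> * norm (exchanger_op l h1 h2 (zh0 - z0)))))))"
proof (intro conjI impI allI, goal_cases)
  case \<tau>: 1
  have z: "z t = 0"
    if "z0 \<in> state_space l" "zh0 \<in> state_space l" "closed_loop l h1 h2 \<tau> k1 k2 z0 zh0 z zp zm u1 u2 y1 y2 q1 q2" "\<tau> < t"
    for z0 zh0 z zp zm u1 u2 y1 y2 q1 q2 t
    by (rule closed_loop_dead_beat[OF assms(1-3) less_imp_le[OF \<tau>] that(1-3)]) (use \<tau> that in simp)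
  show ?case
  \<comment> \<open>The state is exactly zero for t > \<tau>, so any positive constants
    serve.\<close>
  proof (rule exI[of _ "1::real"], rule conjI[OF zero_less_one], rule exI[of _ "1::real"], rule conjI[OF zero_less_one],
      intro ballI allI impI)
    fix z0 zh0 z zp zm u1 u2 y1 y2 q1 q2 t
    assume "z0 \<in> state_space l" "zh0 \<in> state_space l" "closed_loop l h1 h2 \<tau> k1 k2 z0 zh0 z zp zm u1 u2 y1 y2 q1 q2" "\<tau> < t"
    from z[OF this] show "norm (z t) \<le> 1 * exp (- 1 * t) * norm z0" by simp
  qed
next
  case asm: (2 T M \<gamma>\<^sub>0 \<gamma>)
  have "\<exists>D>0. \<forall>z0\<in>state_space l. \<forall>zh0\<in>state_space l. zh0 - z0 \<in> dom_AK l k1 k2 \<longrightarrow>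
    (\<forall>z zp zm u1 u2 y1 y2 q1 q2. closed_loop l h1 h2 \<tau> k1 k2 z0 zh0 z zp zm u1 u2 y1 y2 q1 q2 \<longrightarrow>
      (\<forall>t>\<tau>. norm (z t) \<le> D * exp (- \<gamma> * t) * (norm z0 + norm (exchanger_op l h1 h2 (zh0 - z0)))))"
  proof (cases "\<tau> < l")
    case True
    obtain \<rho> c1 c2 where \<rho>: "0 < \<rho>" "0 < c1" "0 < c2"
      and eig: "k1 * outflow1 l h1 h2 c1 c2 = \<rho> * c1" "k2 * outflow2 l h1 h2 c1 c2 = \<rho> * c2"
      and contr: "\<And>a1 a2. weighted_max c1 c2 (- k1 * outflow1 l h1 h2 a1 a2) (- k2 * outflow2 l h1 h2 a1 a2)
         \<le> \<rho> * weighted_max c1 c2 a1 a2"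
      using feedback_perron[OF assms(1-3,5,7)] by blast
    have "\<rho> \<le> exp (- \<gamma>\<^sub>0 * l)"
      by (rule perron_decay[OF assms(1-3,5,7) \<rho> eig, of T M]) (use asm in blast)+
    then show ?thesis
      by (rule closed_loop_decay[OF assms(1-4) True \<rho> _ contr]) (use asm in simp_all)
  next
    \<comment> \<open>Here \<tau> = l, and the predictor is still exact.\<close>
    case False
    have z: "norm (z t) \<le> 1 * exp (- \<gamma> * t) * (norm z0 + norm (exchanger_op l h1 h2 (zh0 - z0)))"
      if "z0 \<in> state_space l" "zh0 \<in> state_space l" "closed_loop l h1 h2 \<tau> k1 k2 z0 zh0 z zp zm u1 u2 y1 y2 q1 q2" "\<tau> < t"
      for z0 zh0 z zp zm u1 u2 y1 y2 q1 q2 t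
    proof -
      have "z t = 0"
        by (rule closed_loop_dead_beat[OF assms(1-3) _ that(1-3)]) (use False that in simp_all)
      then show ?thesis by simp
    qed
    show ?thesis
      by (intro exI[of _ "1::real"] conjI zero_less_one ballI impI allI) (rule z)
  qed
  then show ?case
  proof (elim exE conjE)
    fix D :: real
    assume D: "0 < D" "\<forall>z0\<in>state_space l. \<forall>zh0\<in>state_space l. zh0 - z0 \<in> dom_AK l k1 k2 \<longrightarrow>
      (\<forall>z zp zm u1 u2 y1 y2 q1 q2. closed_loop l h1 h2 \<tau> k1 k2 z0 zh0 z zp zm u1 u2 y1 y2 q1 q2 \<longrightarrow>
        (\<forall>t>\<tau>. norm (z t) \<le> D * exp (- \<gamma> * t) * (norm z0 + norm (exchanger_op l h1 h2 (zh0 - z0)))))"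
    show ?thesis
      \<comment> \<open>The weight of the initial error is already contained in \<open>D\<close>, so
        the second constant is 1.\<close>
      by (rule exI[of _ D], rule conjI[OF D(1)], rule exI[of _ "1::real"], rule conjI[OF zero_less_one])
        (unfold mult_1, rule D(2))
  qed
qed

end
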